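(* For all integers $p\ge 1$ and $q\ge 3$, the jellyfish graph $JFG(p,q)$ is DQS.
   Context: All graphs are finite and simple. The jellyfish graph $JFG(p,q)$ is obtained from a cycle $C_q$ and $q$ copies of the star $K_{1,p}$ by identifying each vertex of $C_q$ with the center (vertex of maximum degree) of a distinct copy of $K_{1,p}$. The signless Laplacian matrix is $Q(G)=A(G)+D(G)$, with $A(G)$ the adjacency matrix and $D(G)$ the diagonal degree matrix. Two graphs are $Q$-cospectral if their signless Laplacian matrices have the same spectrum. A graph is DQS (determined by its signless Laplacian spectrum) if every graph $Q$-cospectral with it is isomorphic to it. *)

theory Defs
  imports "Jordan_Normal_Form.Char_Poly" "HOL-Computational_Algebra.Fundamental_Theorem_Algebra"
begin

text \<open>A finite simple graph is represented by a vertex count n (vertex set {0..<n})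
  and an adjacency relation E that is symmetric, irreflexive and only relates
  vertices in {0..<n}. Every finite simple graph is isomorphic to such a graph.\<close>

definition simple_graph :: "nat \<Rightarrow> (nat \<Rightarrow> nat \<Rightarrow> bool) \<Rightarrow> bool" where
  "simple_graph n E \<longleftrightarrow>
     (\<forall>i j. E i j \<longrightarrow> i < n \<and> j < n) \<and>
     (\<forall>i j. E i j \<longrightarrow> E j i) \<and>
     (\<forall>i. \<not> E i i)"

definition graph_iso :: "nat \<Rightarrow> (nat \<Rightarrow> nat \<Rightarrow> bool) \<Rightarrow> nat \<Rightarrow> (nat \<Rightarrow> nat \<Rightarrow> bool) \<Rightarrow> bool" where
  "graph_iso n E m F \<longleftrightarrow>
     (\<exists>f. bij_betw f {0..<n} {0..<m} \<and>
          (\<forall>i<n. \<forall>j<n. E i j \<longleftrightarrow> F (f i) (f j)))"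

definition vdeg :: "nat \<Rightarrow> (nat \<Rightarrow> nat \<Rightarrow> bool) \<Rightarrow> nat \<Rightarrow> nat" where
  "vdeg n E i = card {j. j < n \<and> E i j}"

definition adj_mat :: "nat \<Rightarrow> (nat \<Rightarrow> nat \<Rightarrow> bool) \<Rightarrow> complex mat" where
  "adj_mat n E = mat n n (\<lambda>(i, j). if E i j then 1 else 0)"

definition deg_mat :: "nat \<Rightarrow> (nat \<Rightarrow> nat \<Rightarrow> bool) \<Rightarrow> complex mat" where
  "deg_mat n E = mat n n (\<lambda>(i, j). if i = j then of_nat (vdeg n E i) else 0)"

definition signless_laplacian :: "nat \<Rightarrow> (nat \<Rightarrow> nat \<Rightarrow> bool) \<Rightarrow> complex mat" where
  "signless_laplacian n E = adj_mat n E + deg_mat n E"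

definition Q_spectrum :: "nat \<Rightarrow> (nat \<Rightarrow> nat \<Rightarrow> bool) \<Rightarrow> complex multiset" where
  "Q_spectrum n E = proots (char_poly (signless_laplacian n E))"

definition Q_cospectral :: "nat \<Rightarrow> (nat \<Rightarrow> nat \<Rightarrow> bool) \<Rightarrow> nat \<Rightarrow> (nat \<Rightarrow> nat \<Rightarrow> bool) \<Rightarrow> bool" where
  "Q_cospectral n E m F \<longleftrightarrow> Q_spectrum n E = Q_spectrum m F"

definition DQS :: "nat \<Rightarrow> (nat \<Rightarrow> nat \<Rightarrow> bool) \<Rightarrow> bool" where
  "DQS n E \<longleftrightarrow>
     (\<forall>m F. simple_graph m F \<longrightarrow> Q_cospectral m F n E \<longrightarrow> graph_iso m F n E)"

text \<open>Jellyfish graph JFG(p,q): cycle vertices 0..q-1 (i adjacent to (i+1) mod q);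
  the p pendant vertices of the star centred at cycle vertex i are q + i*p + k, k < p.
  Total number of vertices: q + q*p.\<close>

definition jfg_n :: "nat \<Rightarrow> nat \<Rightarrow> nat" where
  "jfg_n p q = q + q * p"

definition jfg_edge0 :: "nat \<Rightarrow> nat \<Rightarrow> nat \<Rightarrow> nat \<Rightarrow> bool" where
  "jfg_edge0 p q u v \<longleftrightarrow>
     (u < q \<and> v = Suc u mod q) \<or>
     (u < q \<and> (\<exists>k<p. v = q + u * p + k))"

definition jfg_E :: "nat \<Rightarrow> nat \<Rightarrow> nat \<Rightarrow> nat \<Rightarrow> bool" where
  "jfg_E p q u v \<longleftrightarrow> jfg_edge0 p q u v \<or> jfg_edge0 p q v u"

end

theory Submission
  imports Defs
begin

text \<open>Let \<open>G\<close> be \<open>Q\<close>-cospectral with \<open>H = JFG(p,q)\<close>. The spectral theorem gives an orthogonal matrix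
  conjugating \<open>Q(G)\<close> to \<open>Q(H)\<close>, so bounds of the quadratic form of \<open>Q(H)\<close> on coordinate subspaces
  bound the dimension of subspaces of the \<open>G\<close>-side on which the form of \<open>Q(G)\<close> is large. The spectral
  radius \<open>\<mu>\<close> of \<open>H\<close> is the larger root of \<open>x\<^sup>2 - (p+5)x + 4\<close>, with eigenvector \<open>1\<close> on the cycle and
  \<open>1/(\<mu>-1)\<close> on the leaves; it bounds the degrees of \<open>G\<close> by \<open>p + 3\<close>, and the kernel of \<open>Q(H)\<close> has
  dimension at most one, so \<open>G\<close> has at most one isolated vertex.

  Without isolated vertices, the traces of \<open>Q\<close>, \<open>Q\<^sup>2\<close>, \<open>Q\<^sup>3\<close> force all degrees to be \<open>1\<close> or \<open>p + 2\<close>.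
  The corresponding two-valued vector then attains the Rayleigh quotient \<open>\<mu>\<close>, hence is an eigenvector:
  the vertices of degree \<open>p + 2\<close> induce a 2-regular graph, which is connected because \<open>\<mu>\<close> is simple.

  With one isolated vertex, let \<open>q + k\<close> be the number of vertices of degree at least two. The trace
  identities give \<open>k \<ge> 1\<close>, and \<open>k \<ge> 2\<close> only for \<open>p \<le> 2\<close> with explicit degree sequences. As \<open>Q(H)\<close>
  has only \<open>q\<close> eigenvalues above \<open>1\<close> and \<open>pq\<close> eigenvalues at least \<open>1\<close>, the form \<open>Q - 1\<close> restricted to
  the vertices of degree at least two without a pendant neighbour would need many nonpositive directions,
  which a bounded number of vertices with these degrees cannot supply. The one remaining degree
  sequence, with a vertex of degree four for \<open>p = 1\<close>, contradicts the spectral radius.\<close>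

text \<open>The kernel of \<open>Q\<close> has one dimension for each bipartite component, so for
  even \<open>q\<close> its dimension alone does not exclude a mate made of an isolated vertex and a
  non-bipartite rest; this case causes most of the work. Traces leave several degree sequences open
  there, so eigenvalues in the middle of the spectrum have to be counted. The threshold
  \<open>1\<close> is natural because a pendant vertex has diagonal entry \<open>1\<close>:
  \<open>Q - 1\<close> vanishes on vectors supported on pairwise nonadjacent pendant vertices. Two
  counts complement each other. If many core vertices lack a pendant neighbour, some of these
  together with all pendant vertices give too many eigenvalues that are at least \<open>1\<close>.
  If few do, the other core vertices, each corrected by one of its pendant neighbours, give too many
  eigenvalues above \<open>1\<close>. For \<open>p = 1\<close> the threshold can be lowered to
  \<open>4 / 5\<close> at the same cost in linear conditions, which enlarges the diagonal of the
  restricted form.\<close>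

section \<open>Householder reflections and the real spectral theorem\<close>

text \<open>For a unit vector \<open>u\<close> the number \<open>1 - u $ 0\<close> is half the
  squared length of \<open>u - e\<close>, where \<open>e\<close> is the first unit vector, so this
  is the reflection interchanging \<open>u\<close> and \<open>e\<close>. For \<open>u = e\<close>
  the quotient is \<open>0 / 0 = 0\<close> and the matrix is the identity.\<close>

definition householder :: "nat \<Rightarrow> real vec \<Rightarrow> real mat" where
  "householder n u = mat n n (\<lambda>(i, j). (if i = j then 1 else 0)
     - (u $ i - (if i = 0 then 1 else 0)) * (u $ j - (if j = 0 then 1 else 0)) / (1 - u $ 0))"

lemma householder_carrier [simp]: "householder n u \<in> carrier_mat n n"
  by (simp add: householder_def)

lemma householder_dims [simp]: "dim_row (householder n u) = n" "dim_col (householder n u) = n"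
  by (simp_all add: householder_def)

lemma transpose_householder: "transpose_mat (householder n u) = householder n u"
  by (rule eq_matI) (auto simp: householder_def mult.commute)

context
  fixes n :: nat and u :: "real vec"
  assumes u: "u \<in> carrier_vec n" and n: "0 < n" and unit: "u \<bullet> u = 1"
begin

private definition w where "w i = u $ i - (if i = 0 then 1 else 0)"

private lemma sum_uu: "(\<Sum>i<n. u $ i * u $ i) = 1"
  using unit u by (simp add: scalar_prod_def atLeast0LessThan)

private lemma sum_wu: "(\<Sum>i<n. w i * u $ i) = 1 - u $ 0"
proof -
  have "(\<Sum>i<n. w i * u $ i) = (\<Sum>i<n. u $ i * u $ i) - (\<Sum>i<n. if i = 0 then u $ 0 else 0)"
    unfolding sum_subtractf[symmetric] by (rule sum.cong) (auto simp: w_def algebra_simps)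
  then show ?thesis using n sum_uu by (simp add: sum.delta)
qed

private lemma sum_ww: "(\<Sum>i<n. w i * w i) = 2 * (1 - u $ 0)"
proof -
  have "(\<Sum>i<n. w i * w i) = (\<Sum>i<n. w i * u $ i) - (\<Sum>i<n. if i = 0 then w 0 else 0)"
    unfolding sum_subtractf[symmetric] by (rule sum.cong) (auto simp: w_def algebra_simps)
  then show ?thesis using n sum_wu by (simp add: sum.delta w_def)
qed

private lemma w_zero: "u $ 0 = 1 \<Longrightarrow> i < n \<Longrightarrow> w i = 0"
  using sum_ww sum_nonneg_eq_0_iff[of "{..<n}" "\<lambda>i. w i * w i"] by auto

private lemma hh: "i < n \<Longrightarrow> j < n \<Longrightarrow>
    householder n u $$ (i, j) = (if i = j then 1 else 0) - w i * w j / (1 - u $ 0)"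
  by (simp add: householder_def w_def)

lemma householder_involution: "householder n u * householder n u = 1\<^sub>m n"
proof (rule eq_matI)
  fix i j assume "i < dim_row (1\<^sub>m n :: real mat)" "j < dim_col (1\<^sub>m n :: real mat)"
  then have ij: "i < n" "j < n" by auto
  let ?c = "1 / (1 - u $ 0)"
  have "(householder n u * householder n u) $$ (i, j) =
      (\<Sum>k<n. householder n u $$ (i, k) * householder n u $$ (k, j))"
    using ij by (simp add: scalar_prod_def atLeast0LessThan)
  also have "\<dots> = (\<Sum>k<n. (if i = k then (if k = j then 1 else 0) - ?c * w k * w j else 0)
      - (if k = j then ?c * w i * w k else 0) + ?c * ?c * w i * w j * (w k * w k))"
    using ij by (intro sum.cong) (auto simp: hh algebra_simps)
  also have "\<dots> = (if i = j then 1 else 0) - 2 * (?c * w i * w j)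
      + ?c * ?c * w i * w j * (2 * (1 - u $ 0))"
    unfolding sum.distrib sum_subtractf sum_distrib_left[symmetric] sum_ww
    using ij by (simp add: sum.delta sum.delta')
  also have "\<dots> = (if i = j then 1 else 0)"
  proof (cases "u $ 0 = 1")
    case False
    then have "?c * ?c * w i * w j * (2 * (1 - u $ 0)) = 2 * (?c * w i * w j) * (?c * (1 - u $ 0))"
      by (simp only: mult_ac)
    also have "?c * (1 - u $ 0) = 1" using False by simp
    finally show ?thesis by simp
  qed simp
  finally show "(householder n u * householder n u) $$ (i, j) = 1\<^sub>m n $$ (i, j)"
    using ij by simp
qed auto

lemma householder_maps_to_unit: "householder n u *\<^sub>v u = unit_vec n 0"
proof (rule eq_vecI)
  fix i assume "i < dim_vec (unit_vec n 0 :: real vec)"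
  then have i: "i < n" by simp
  have "(householder n u *\<^sub>v u) $ i = (\<Sum>k<n. householder n u $$ (i, k) * u $ k)"
    using i u by (simp add: scalar_prod_def atLeast0LessThan)
  also have "\<dots> = (\<Sum>k<n. (if i = k then u $ i else 0) - w i / (1 - u $ 0) * (w k * u $ k))"
    using i by (intro sum.cong) (auto simp: hh algebra_simps)
  also have "\<dots> = u $ i - w i / (1 - u $ 0) * (1 - u $ 0)"
    unfolding sum_subtractf sum_distrib_left[symmetric] sum_wu
    using i by (simp add: sum.delta sum.delta')
  also have "\<dots> = u $ i - w i"
    using w_zero[OF _ i] by (cases "u $ 0 = 1") auto
  finally show "(householder n u *\<^sub>v u) $ i = unit_vec n 0 $ i"
    using i by (simp add: w_def)
qed simp

end

text \<open>Deflation: a reflection moves a unit eigenvector to the first unit vector, symmetry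
  clears the first row along with the first column, and the characteristic polynomial of the
  remaining block has lost one linear factor. The diagonal follows the order of \<open>es\<close>,
  so two matrices with the same characteristic polynomial receive literally the same
  diagonal.\<close>

lemma symmetric_mat_orthogonally_diagonalizable:
  fixes M :: "real mat"
  assumes "M \<in> carrier_mat n n" and "transpose_mat M = M"
    and "char_poly M = (\<Prod>e\<leftarrow>es. [:- e, 1:])"
  shows "\<exists>P \<in> carrier_mat n n. transpose_mat P * P = 1\<^sub>m n \<and> P * transpose_mat P = 1\<^sub>m n
    \<and> transpose_mat P * M * P = mat n n (\<lambda>(i, j). if i = j then es ! i else 0)"
  using assms
proof (induction es arbitrary: n M)
  case Nil
  then have "n = 0" using degree_monic_char_poly[of M n] by simp
  with Nil show ?case by (intro bexI[of _ "1\<^sub>m n"]) (auto intro!: eq_matI)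
next
  case (Cons e es)
  note M = Cons.prems(1) and sym = Cons.prems(2)
  have cp: "char_poly M = [:- e, 1:] * (\<Prod>e\<leftarrow>es. [:- e, 1:])"
    using Cons.prems(3) by simp
  have "degree (char_poly M) = Suc (length es)"
    unfolding Cons.prems(3) using degree_linear_factors[of uminus "e # es"] by simp
  then obtain m where n: "n = Suc m" and m: "m = length es"
    using degree_monic_char_poly[OF M] by simp
  have "eigenvalue M e" unfolding eigenvalue_root_char_poly[OF M] cp by simp
  then obtain v where v: "v \<in> carrier_vec n" "v \<noteq> 0\<^sub>v n" and Mv: "M *\<^sub>v v = e \<cdot>\<^sub>v v"
    unfolding eigenvalue_def eigenvector_def using M by auto
  define u where "u = (1 / sqrt (v \<bullet> v)) \<cdot>\<^sub>v v"
  have vv: "v \<bullet> v > 0"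
  proof -
    have "v \<bullet> v = (\<Sum>i<n. v $ i * v $ i)" using v by (simp add: scalar_prod_def atLeast0LessThan)
    moreover obtain i where "i < n" "v $ i \<noteq> 0" using v by (metis carrier_vecD eq_vecI index_zero_vec)
    ultimately show ?thesis by (metis (no_types, lifting) finite_lessThan lessThan_iff not_real_square_gt_zero sum_pos2 zero_le_square)
  qed
  have u: "u \<in> carrier_vec n" using v by (simp add: u_def)
  have uu: "u \<bullet> u = 1" using v vv by (simp add: u_def)
  have Mu: "M *\<^sub>v u = e \<cdot>\<^sub>v u" using M v Mv
    by (simp add: u_def mult_mat_vec smult_smult_assoc mult.commute)
  define W where "W = householder n u"
  have W: "W \<in> carrier_mat n n" and Wt: "transpose_mat W = W"
    by (simp_all add: W_def transpose_householder)
  have WW: "W * W = 1\<^sub>m n" and Wu: "W *\<^sub>v u = unit_vec n 0"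
    using householder_involution[OF u _ uu] householder_maps_to_unit[OF u _ uu] n
    by (simp_all add: W_def)
  have We: "W *\<^sub>v unit_vec n 0 = u"
  proof -
    have "W *\<^sub>v (W *\<^sub>v u) = (W * W) *\<^sub>v u"
      by (rule assoc_mult_mat_vec[symmetric, OF W W u])
    then show ?thesis using u by (simp add: WW Wu)
  qed
  define B where "B = W * M * W"
  have B: "B \<in> carrier_mat n n"
    unfolding B_def by (rule mult_carrier_mat[OF mult_carrier_mat[OF W M] W])
  have Bt: "transpose_mat B = B"
    unfolding B_def transpose_mult[OF mult_carrier_mat[OF W M] W] transpose_mult[OF W M] sym Wt
    by (rule assoc_mult_mat[OF W M W, symmetric])
  have Be: "B *\<^sub>v unit_vec n 0 = e \<cdot>\<^sub>v unit_vec n 0"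
  proof -
    have "B *\<^sub>v unit_vec n 0 = W *\<^sub>v (M *\<^sub>v (W *\<^sub>v unit_vec n 0))"
      unfolding B_def assoc_mult_mat_vec[OF mult_carrier_mat[OF W M] W unit_vec_carrier]
      by (rule assoc_mult_mat_vec[OF W M mult_mat_vec_carrier[OF W unit_vec_carrier]])
    then show ?thesis using u by (simp add: We Mu mult_mat_vec[OF W u] Wu)
  qed
  have col0: "B $$ (i, 0) = (if i = 0 then e else 0)" if "i < n" for i
  proof -
    have "(B *\<^sub>v unit_vec n 0) $ i = B $$ (i, 0)"
      using that n B by (simp add: scalar_prod_right_unit)
    then have "B $$ (i, 0) = e * (if i = 0 then 1 else 0)" using Be that by simp
    then show ?thesis by auto
  qed
  have row0: "B $$ (0, i) = (if i = 0 then e else 0)" if "i < n" for i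
    using col0[OF that] Bt B that n by (metis carrier_matD index_transpose_mat(1) zero_less_Suc)
  define M3 where "M3 = mat m m (\<lambda>(i, j). B $$ (Suc i, Suc j))"
  define E where "E = mat 1 1 (\<lambda>_. e)"
  have M3: "M3 \<in> carrier_mat m m" and E: "E \<in> carrier_mat 1 1" by (simp_all add: M3_def E_def)
  have Bblock: "B = four_block_mat E (0\<^sub>m 1 m) (0\<^sub>m m 1) M3"
    using B n by (intro eq_matI) (auto simp: E_def M3_def col0 row0)
  have "similar_mat B M"
    unfolding similar_mat_def similar_mat_wit_def
    by (rule exI[of _ W], rule exI[of _ W]) (use M B WW carrier_matD[OF W] in \<open>auto simp: B_def Let_def\<close>)
  then have "char_poly M = char_poly B" by (simp add: char_poly_similar)
  also have "\<dots> = char_poly E * char_poly M3"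
    unfolding Bblock by (rule char_poly_four_block_zeros_col[OF E _ M3]) auto
  also have "char_poly E = [:- e, 1:]"
    by (simp add: char_poly_defs E_def det_single)
  finally have "[:- e, 1:] * char_poly M3 = [:- e, 1:] * (\<Prod>e\<leftarrow>es. [:- e, 1:])"
    unfolding cp ..
  then have cp3: "char_poly M3 = (\<Prod>e\<leftarrow>es. [:- e, 1:])"
    unfolding mult_cancel_left by simp
  have t3: "transpose_mat M3 = M3"
  proof (rule eq_matI)
    fix i j assume "i < dim_row M3" "j < dim_col M3"
    then have "Suc i < n" "Suc j < n" by (auto simp: M3_def n)
    then have "B $$ (Suc j, Suc i) = B $$ (Suc i, Suc j)"
      using Bt B by (metis carrier_matD index_transpose_mat(1))
    then show "transpose_mat M3 $$ (i, j) = M3 $$ (i, j)"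
      using \<open>Suc i < n\<close> \<open>Suc j < n\<close> by (simp add: M3_def n)
  qed (auto simp: M3_def)
  from Cons.IH[OF M3 t3 cp3] obtain R where R: "R \<in> carrier_mat m m"
    and RtR: "transpose_mat R * R = 1\<^sub>m m" and RRt: "R * transpose_mat R = 1\<^sub>m m"
    and RMR: "transpose_mat R * M3 * R = mat m m (\<lambda>(i, j). if i = j then es ! i else 0)" by auto
  define S where "S = four_block_mat (1\<^sub>m 1) (0\<^sub>m 1 m) (0\<^sub>m m 1) R"
  define P where "P = W * S"
  have St: "transpose_mat S = four_block_mat (1\<^sub>m 1) (0\<^sub>m 1 m) (0\<^sub>m m 1) (transpose_mat R)"
    unfolding S_def by (subst transpose_four_block_mat) (use R in auto)
  have S: "S \<in> carrier_mat n n" and Stc: "transpose_mat S \<in> carrier_mat n n"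
    using R n by (auto simp: S_def)
  have Pt: "transpose_mat P = transpose_mat S * W"
    unfolding P_def by (simp add: transpose_mult[OF W S] Wt)
  have one: "four_block_mat (1\<^sub>m 1) (0\<^sub>m 1 m) (0\<^sub>m m 1) (1\<^sub>m m) = (1\<^sub>m n :: real mat)"
    using n by (intro eq_matI) auto
  have StS: "transpose_mat S * S = 1\<^sub>m n"
    unfolding St unfolding S_def
    by (subst mult_four_block_mat) (use R RtR one in auto)
  have SSt: "S * transpose_mat S = 1\<^sub>m n"
    unfolding St unfolding S_def
    by (subst mult_four_block_mat) (use R RRt one in auto)
  have "transpose_mat P * P = transpose_mat S * (W * W) * S"
    unfolding Pt unfolding P_def using S W transpose_carrier_mat[of S n n] by (simp add: assoc_mult_mat[of _ n n _ n _ n])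
  then have PtP: "transpose_mat P * P = 1\<^sub>m n" using WW StS S Stc by simp
  have "P * transpose_mat P = W * (S * transpose_mat S) * W"
    unfolding Pt unfolding P_def using S W transpose_carrier_mat[of S n n] by (simp add: assoc_mult_mat[of _ n n _ n _ n])
  then have PPt: "P * transpose_mat P = 1\<^sub>m n" using WW SSt W by simp
  have "transpose_mat P * M * P = transpose_mat S * B * S"
    unfolding Pt B_def unfolding P_def using S Stc W M by (simp add: assoc_mult_mat[of _ n n _ n _ n])
  also have "\<dots> = four_block_mat E (0\<^sub>m 1 m) (0\<^sub>m m 1) (transpose_mat R * M3 * R)"
  proof -
    have 1: "transpose_mat S * B = four_block_mat E (0\<^sub>m 1 m) (0\<^sub>m m 1) (transpose_mat R * M3)"
      unfolding St Bblock by (subst mult_four_block_mat) (use R E M3 in auto)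
    show ?thesis unfolding 1 unfolding S_def
      by (subst mult_four_block_mat) (use R E M3 in auto)
  qed
  also have "\<dots> = mat n n (\<lambda>(i, j). if i = j then (e # es) ! i else 0)"
    unfolding RMR using n by (intro eq_matI) (auto simp: E_def nth_Cons')
  finally show ?case using PtP PPt S W by (intro bexI[of _ P]) (auto simp: P_def)
qed


text \<open>The number \<open>S\<close>, the Hermitian form of \<open>M\<close> at \<open>v\<close>,
  equals its own conjugate and also equals \<open>a\<close> times the squared norm
  \<open>R > 0\<close>.\<close>

lemma symmetric_real_mat_eigenvalue_real:
  fixes M :: "real mat" and a :: complex
  assumes M: "M \<in> carrier_mat n n" and sym: "transpose_mat M = M"
    and "eigenvalue (map_mat of_real M) a"
  shows "a \<in> \<real>"
proof -
  obtain v where v: "v \<in> carrier_vec n" "v \<noteq> 0\<^sub>v n"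
    and Mv: "map_mat of_real M *\<^sub>v v = a \<cdot>\<^sub>v v"
    using assms unfolding eigenvalue_def eigenvector_def by auto
  have row: "(\<Sum>j<n. of_real (M $$ (i, j)) * v $ j) = a * v $ i" if "i < n" for i
  proof -
    have "(map_mat of_real M *\<^sub>v v) $ i = (\<Sum>j<n. of_real (M $$ (i, j)) * v $ j)"
      using that M v by (simp add: scalar_prod_def atLeast0LessThan)
    then show ?thesis using Mv that v by simp
  qed
  define S where "S = (\<Sum>i<n. \<Sum>j<n. cnj (v $ i) * (of_real (M $$ (i, j)) * v $ j))"
  define R where "R = (\<Sum>i<n. (cmod (v $ i))\<^sup>2)"
  have symE: "M $$ (i, j) = M $$ (j, i)" if "i < n" "j < n" for i j
    using sym M that by (metis carrier_matD index_transpose_mat(1))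
  have "cnj S = (\<Sum>i<n. \<Sum>j<n. cnj (v $ j) * (of_real (M $$ (j, i)) * v $ i))"
    unfolding S_def cnj_sum by (intro sum.cong refl) (auto simp: symE mult_ac)
  also have "\<dots> = S" unfolding S_def by (rule sum.swap)
  finally have "S \<in> \<real>" by (simp add: Reals_cnj_iff)
  have "S = (\<Sum>i<n. cnj (v $ i) * (a * v $ i))"
    unfolding S_def by (simp add: sum_distrib_left[symmetric] row)
  also have "\<dots> = a * of_real R"
    unfolding R_def of_real_sum sum_distrib_left
    by (intro sum.cong refl) (simp add: complex_norm_square[symmetric] mult.left_commute mult.commute)
  finally have "S = a * of_real R" .
  moreover have "R > 0"
  proof -
    obtain i where "i < n" "v $ i \<noteq> 0" using v by (metis carrier_vecD eq_vecI index_zero_vec)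
    then show ?thesis unfolding R_def by (intro sum_pos2[of _ i]) auto
  qed
  ultimately have "a = S / of_real R" by simp
  then show ?thesis using \<open>S \<in> \<real>\<close> by simp
qed

lemma symmetric_real_mat_char_poly_splits:
  fixes M :: "real mat"
  assumes M: "M \<in> carrier_mat n n" and sym: "transpose_mat M = M"
  shows "\<exists>es. char_poly M = (\<Prod>e\<leftarrow>es. [:- e, 1:])"
proof -
  interpret h: map_poly_inj_comm_ring_hom "of_real :: real \<Rightarrow> complex" ..
  let ?C = "map_mat of_real M :: complex mat"
  have C: "?C \<in> carrier_mat n n" using M by simp
  obtain as where as: "char_poly ?C = (\<Prod>a\<leftarrow>as. [:- a, 1:])"
    using char_poly_factorized[OF C] by blast
  have "a \<in> \<real>" if "a \<in> set as" for a
  proof (rule symmetric_real_mat_eigenvalue_real[OF M sym])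
    have "poly (char_poly ?C) a = 0" unfolding as using that by (simp add: poly_prod_list prod_list_zero_iff image_iff)
    then show "eigenvalue ?C a" by (simp add: eigenvalue_root_char_poly[OF C])
  qed
  then have re: "map (\<lambda>a. of_real (Re a)) as = as" by (intro map_idI) auto
  have "map_poly of_real (char_poly M) = char_poly ?C"
    by (simp add: of_real_hom.char_poly_hom[OF M])
  also have "\<dots> = (\<Prod>e\<leftarrow>map Re as. [:- of_real e, 1:])"
    unfolding as by (subst (1) re[symmetric]) (simp add: o_def)
  also have "\<dots> = map_poly of_real (\<Prod>e\<leftarrow>map Re as. [:- e, 1:])"
    by (induction as) (simp_all add: hom_distribs)
  finally have "char_poly M = (\<Prod>e\<leftarrow>map Re as. [:- e, 1:])" by simp
  then show ?thesis by blast
qed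

section \<open>Orthogonal similarity of cospectral signless Laplacians\<close>

definition adj :: "(nat \<Rightarrow> nat \<Rightarrow> bool) \<Rightarrow> nat \<Rightarrow> nat \<Rightarrow> real" where
  "adj E i j = (if E i j then 1 else 0)"

definition qent :: "nat \<Rightarrow> (nat \<Rightarrow> nat \<Rightarrow> bool) \<Rightarrow> nat \<Rightarrow> nat \<Rightarrow> real" where
  "qent n E i j = adj E i j + (if i = j then real (vdeg n E i) else 0)"

lemma qent_sym: "simple_graph n E \<Longrightarrow> qent n E i j = qent n E j i"
  unfolding qent_def adj_def simple_graph_def by auto

lemma signless_laplacian_qent:
  "signless_laplacian n E = map_mat of_real (mat n n (\<lambda>(i, j). qent n E i j))"
  by (rule eq_matI) (auto simp: signless_laplacian_def adj_mat_def deg_mat_def qent_def adj_def)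

lemma Q_cospectral_order:
  assumes "Q_cospectral m F n E"
  shows "m = n"
proof -
  have d: "degree (char_poly (signless_laplacian k G)) = k" for k G
    using degree_monic_char_poly[of "signless_laplacian k G" k]
    by (simp add: signless_laplacian_qent)
  show ?thesis
    using assms unfolding Q_cospectral_def Q_spectrum_def by (metis d size_proots_complex)
qed

text \<open>Equal root multisets give equal monic characteristic polynomials, which split over one
  common list \<open>es\<close>. Both matrices are therefore orthogonally similar to the same
  diagonal matrix, and \<open>W\<close> composes the two similarities. Stating the result for plain
  functions frees the later arguments from carrier conditions.\<close>

lemma Q_cospectral_orthogonally_similar:
  assumes F: "simple_graph n F" and E: "simple_graph n E" and cosp: "Q_cospectral n F n E"
  shows "\<exists>W :: nat \<Rightarrow> nat \<Rightarrow> real.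
    (\<forall>i<n. \<forall>j<n. (\<Sum>k<n. W k i * W k j) = of_bool (i = j)) \<and>
    (\<forall>i<n. \<forall>j<n. (\<Sum>k<n. W i k * W j k) = of_bool (i = j)) \<and>
    (\<forall>i<n. \<forall>j<n. (\<Sum>k<n. W i k * qent n F k j) = (\<Sum>k<n. qent n E i k * W k j))"
proof -
  define A where "A = mat n n (\<lambda>(i, j). qent n F i j)"
  define B where "B = mat n n (\<lambda>(i, j). qent n E i j)"
  have A: "A \<in> carrier_mat n n" and B: "B \<in> carrier_mat n n" by (simp_all add: A_def B_def)
  have At: "transpose_mat A = A" unfolding A_def using qent_sym[OF F] by (intro eq_matI) auto
  have Bt: "transpose_mat B = B" unfolding B_def using qent_sym[OF E] by (intro eq_matI) auto
  interpret h: map_poly_inj_comm_ring_hom "of_real :: real \<Rightarrow> complex" ..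
  have "char_poly (signless_laplacian n F) = char_poly (signless_laplacian n E)"
  proof -
    have m: "lead_coeff (char_poly (signless_laplacian n G)) = 1" for G
      using degree_monic_char_poly[of "signless_laplacian n G" n]
      by (simp add: signless_laplacian_qent)
    show ?thesis
      using cosp complex_poly_decompose_multiset[of "char_poly (signless_laplacian n F)"]
        complex_poly_decompose_multiset[of "char_poly (signless_laplacian n E)"]
      unfolding Q_cospectral_def Q_spectrum_def m by simp
  qed
  then have "map_poly of_real (char_poly A) = (map_poly of_real (char_poly B) :: complex poly)"
    unfolding signless_laplacian_qent A_def[symmetric] B_def[symmetric]
    by (simp add: of_real_hom.char_poly_hom[OF A] of_real_hom.char_poly_hom[OF B])
  then have AB: "char_poly A = char_poly B" by simp
  obtain es where es: "char_poly A = (\<Prod>e\<leftarrow>es. [:- e, 1:])"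
    using symmetric_real_mat_char_poly_splits[OF A At] by blast
  obtain P where P: "P \<in> carrier_mat n n"
    and PP: "transpose_mat P * P = 1\<^sub>m n" "P * transpose_mat P = 1\<^sub>m n"
    and PAP: "transpose_mat P * A * P = mat n n (\<lambda>(i, j). if i = j then es ! i else 0)"
    using symmetric_mat_orthogonally_diagonalizable[OF A At es] by blast
  obtain R where R: "R \<in> carrier_mat n n"
    and RR: "transpose_mat R * R = 1\<^sub>m n" "R * transpose_mat R = 1\<^sub>m n"
    and RBR: "transpose_mat R * B * R = mat n n (\<lambda>(i, j). if i = j then es ! i else 0)"
    using symmetric_mat_orthogonally_diagonalizable[OF B Bt es[unfolded AB]] by blast
  let ?Pt = "transpose_mat P" and ?Rt = "transpose_mat R"
  have Pt: "?Pt \<in> carrier_mat n n" and Rt: "?Rt \<in> carrier_mat n n" using P R by auto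
  define W where "W = R * ?Pt"
  have W: "W \<in> carrier_mat n n" using R Pt by (simp add: W_def)
  have Wt: "transpose_mat W = P * ?Rt"
    unfolding W_def by (simp add: transpose_mult[OF R Pt])
  note asc = assoc_mult_mat[of _ n n _ n _ n]
  have "transpose_mat W * W = P * (?Rt * R) * ?Pt"
    unfolding Wt unfolding W_def using P R Pt Rt by (simp add: asc)
  then have WtW: "transpose_mat W * W = 1\<^sub>m n" using P PP RR by simp
  have "W * transpose_mat W = R * (?Pt * P) * ?Rt"
    unfolding Wt unfolding W_def using P R Pt Rt by (simp add: asc)
  then have WWt: "W * transpose_mat W = 1\<^sub>m n" using R PP RR by simp
  have "W * A = R * (?Pt * A * P) * ?Pt"
  proof -
    have "R * (?Pt * A * P) * ?Pt = R * ?Pt * A * (P * ?Pt)"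
      using P R Pt A by (simp add: asc)
    then show ?thesis using PP A R Pt by (simp add: W_def)
  qed
  also have "\<dots> = R * (?Rt * B * R) * ?Pt" unfolding PAP RBR ..
  also have "\<dots> = (R * ?Rt) * B * W"
    unfolding W_def using P R Pt Rt B by (simp add: asc)
  finally have WA: "W * A = B * W" using RR B by simp
  have 1: "(\<Sum>k<n. W $$ (k, i) * W $$ (k, j)) = of_bool (i = j)" if "i < n" "j < n" for i j
    using arg_cong[OF WtW, of "\<lambda>M. M $$ (i, j)"] that W
    by (simp add: scalar_prod_def atLeast0LessThan)
  have 2: "(\<Sum>k<n. W $$ (i, k) * W $$ (j, k)) = of_bool (i = j)" if "i < n" "j < n" for i j
    using arg_cong[OF WWt, of "\<lambda>M. M $$ (i, j)"] that W
    by (simp add: scalar_prod_def atLeast0LessThan)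
  have 3: "(\<Sum>k<n. W $$ (i, k) * qent n F k j) = (\<Sum>k<n. qent n E i k * W $$ (k, j))"
    if "i < n" "j < n" for i j
    using arg_cong[OF WA, of "\<lambda>M. M $$ (i, j)"] that W A B
    by (simp add: scalar_prod_def atLeast0LessThan A_def B_def)
  show ?thesis by (rule exI[of _ "\<lambda>i j. W $$ (i, j)"]) (use 1 2 3 in auto)
qed

section \<open>The quadratic form of the signless Laplacian\<close>

definition sq :: "nat \<Rightarrow> (nat \<Rightarrow> real) \<Rightarrow> real" where
  "sq n x = (\<Sum>i<n. (x i)\<^sup>2)"

definition qop :: "nat \<Rightarrow> (nat \<Rightarrow> nat \<Rightarrow> bool) \<Rightarrow> (nat \<Rightarrow> real) \<Rightarrow> nat \<Rightarrow> real" where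
  "qop n E x i = (\<Sum>j<n. qent n E i j * x j)"

definition qform :: "nat \<Rightarrow> (nat \<Rightarrow> nat \<Rightarrow> bool) \<Rightarrow> (nat \<Rightarrow> real) \<Rightarrow> real" where
  "qform n E x = (\<Sum>i<n. x i * qop n E x i)"

text \<open>The trace of the cube of the adjacency matrix, that is, six times the number of
  triangles of a simple graph.\<close>

definition tri :: "nat \<Rightarrow> (nat \<Rightarrow> nat \<Rightarrow> bool) \<Rightarrow> real" where
  "tri n E = (\<Sum>i<n. \<Sum>j<n. \<Sum>k<n. adj E i j * adj E j k * adj E k i)"

lemma sq_eq_0_iff: "sq n x = 0 \<longleftrightarrow> (\<forall>i<n. x i = 0)"
  unfolding sq_def by (subst sum_nonneg_eq_0_iff) auto

lemma simple_graphD: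
  assumes "simple_graph n E"
  shows "E i j \<Longrightarrow> i < n" "E i j \<Longrightarrow> j < n" "E i j \<Longrightarrow> E j i" "\<not> E i i" "E i j = E j i"
  using assms unfolding simple_graph_def by blast+

lemma adj_sym: "simple_graph n E \<Longrightarrow> adj E i j = adj E j i"
  unfolding adj_def simple_graph_def by auto

lemma vdeg_sum: "real (vdeg n E i) = (\<Sum>j<n. adj E i j)"
proof -
  have "(\<Sum>j<n. adj E i j) = real (card {j \<in> {..<n}. E i j})"
    by (simp add: adj_def sum.If_cases Int_def)
  then show ?thesis by (simp add: vdeg_def lessThan_def conj_commute)
qed

lemma qop_eq:
  assumes "i < n"
  shows "qop n E x i = real (vdeg n E i) * x i + (\<Sum>j<n. adj E i j * x j)"
proof -
  have "qop n E x i = (\<Sum>j<n. adj E i j * x j + (if i = j then real (vdeg n E i) * x i else 0))"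
    unfolding qop_def qent_def by (intro sum.cong) (auto simp: algebra_simps)
  then show ?thesis using assms by (simp add: sum.distrib sum.delta')
qed

lemma qform_eq:
  "qform n E x = (\<Sum>i<n. real (vdeg n E i) * (x i)\<^sup>2) + (\<Sum>i<n. \<Sum>j<n. adj E i j * (x i * x j))"
  unfolding qform_def sum.distrib[symmetric]
  by (intro sum.cong refl) (simp add: qop_eq algebra_simps power2_eq_square sum_distrib_left)

text \<open>The double sum visits every edge twice, hence the division by two.\<close>

lemma qform_edges:
  assumes "simple_graph n E"
  shows "qform n E x = (\<Sum>i<n. \<Sum>j<n. adj E i j * (x i + x j)\<^sup>2) / 2"
proof -
  have "(\<Sum>i<n. \<Sum>j<n. adj E i j * (x j)\<^sup>2) = (\<Sum>i<n. \<Sum>j<n. adj E i j * (x i)\<^sup>2)"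
    by (subst sum.swap) (simp add: adj_sym[OF assms])
  moreover have "(\<Sum>i<n. \<Sum>j<n. adj E i j * (x i)\<^sup>2) = (\<Sum>i<n. real (vdeg n E i) * (x i)\<^sup>2)"
    by (simp add: vdeg_sum sum_distrib_right)
  moreover have "(\<Sum>i<n. \<Sum>j<n. adj E i j * (x i + x j)\<^sup>2) =
      (\<Sum>i<n. \<Sum>j<n. adj E i j * (x i)\<^sup>2) + (\<Sum>i<n. \<Sum>j<n. adj E i j * (x j)\<^sup>2)
      + 2 * (\<Sum>i<n. \<Sum>j<n. adj E i j * (x i * x j))"
    unfolding sum_distrib_left sum.distrib[symmetric]
    by (intro sum.cong refl) (simp add: power2_sum algebra_simps)
  ultimately show ?thesis by (simp add: qform_eq)
qed

text \<open>A sum of squares vanishes termwise, so kernel vectors change sign along every edge.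
  Isolated vertices and bipartite components are thereby visible in the spectrum.\<close>

lemma qform_eq_0_iff:
  assumes "simple_graph n E"
  shows "qform n E x = 0 \<longleftrightarrow> (\<forall>i j. E i j \<longrightarrow> x i + x j = 0)"
proof -
  have "qform n E x = 0 \<longleftrightarrow> (\<forall>i<n. \<forall>j<n. adj E i j * (x i + x j)\<^sup>2 = 0)"
    unfolding qform_edges[OF assms]
    by (simp add: sum_nonneg_eq_0_iff sum_nonneg Ball_def adj_def)
  then show ?thesis using simple_graphD(1,2)[OF assms] by (auto simp: adj_def)
qed

section \<open>Dimension counting and transfer of vectors between the two graphs\<close>

text \<open>Gaussian elimination, one equation at a time. This is the only dimension argument of the
  development; every eigenvalue count below reduces to it.\<close>

lemma homogeneous_system_nontrivial:
  fixes c :: "'k \<Rightarrow> 'i \<Rightarrow> real"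
  assumes "finite K" and "finite I" and "card K < card I"
  shows "\<exists>a. (\<exists>i\<in>I. a i \<noteq> 0) \<and> (\<forall>i. i \<notin> I \<longrightarrow> a i = 0) \<and> (\<forall>k\<in>K. (\<Sum>i\<in>I. c k i * a i) = 0)"
  using assms
proof (induction arbitrary: c I rule: finite_induct)
  case empty
  then have "I \<noteq> {}" by auto
  then obtain i where "i \<in> I" by blast
  then show ?case by (intro exI[of _ "\<lambda>j. of_bool (j = i)"]) auto
next
  case (insert k K)
  show ?case
  proof (cases "\<forall>i\<in>I. c k i = 0")
    case True
    have "card K < card I" using insert.prems insert.hyps by simp
    from insert.IH[OF insert.prems(1) this, of c] True show ?thesis by (auto intro!: exI)
  next
    case False
    then obtain i where i: "i \<in> I" "c k i \<noteq> 0" by blast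
    define J where "J = I - {i}"
    have J: "finite J" "I = insert i J" "i \<notin> J" using i insert.prems by (auto simp: J_def)
    have "card K < card J" using insert.prems insert.hyps J by simp
    from insert.IH[OF J(1) this, of "\<lambda>l j. c l j - c l i * c k j / c k i"]
    obtain a where a: "\<exists>j\<in>J. a j \<noteq> 0" "\<And>j. j \<notin> J \<Longrightarrow> a j = 0"
      and eq: "\<And>l. l \<in> K \<Longrightarrow> (\<Sum>j\<in>J. (c l j - c l i * c k j / c k i) * a j) = 0" by blast
    define s where "s = (\<Sum>j\<in>J. c k j * a j)"
    define b where "b = a(i := - s / c k i)"
    have bsum: "(\<Sum>j\<in>I. c l j * b j) = (\<Sum>j\<in>J. c l j * a j) - c l i * s / c k i" for l
    proof -
      have "(\<Sum>j\<in>J. c l j * b j) = (\<Sum>j\<in>J. c l j * a j)"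
        using J by (intro sum.cong) (auto simp: b_def)
      then show ?thesis using J by (simp add: b_def)
    qed
    have "(\<Sum>j\<in>I. c l j * b j) = 0" if "l \<in> K" for l
    proof -
      have "(\<Sum>j\<in>J. (c l j - c l i * c k j / c k i) * a j) = (\<Sum>j\<in>J. c l j * a j) - c l i / c k i * s"
        unfolding s_def sum_distrib_left sum_subtractf[symmetric]
        by (intro sum.cong) (auto simp: algebra_simps)
      then show ?thesis using eq[OF that] by (simp add: bsum)
    qed
    moreover have "(\<Sum>j\<in>I. c k j * b j) = 0" using i by (simp add: bsum s_def[symmetric])
    moreover have "\<exists>j\<in>I. b j \<noteq> 0" using a(1) J by (auto simp: b_def)
    moreover have "\<forall>j. j \<notin> I \<longrightarrow> b j = 0" using a(2) J by (auto simp: b_def)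
    ultimately show ?thesis by blast
  qed
qed

text \<open>\<open>W\<close> is orthogonal with \<open>W Q(F) = Q(E) W\<close>. Estimates for the
  known graph \<open>E\<close> are pulled back to \<open>F\<close> along the isometry
  \<open>T\<close>.\<close>

locale Q_isospectral =
  fixes n :: nat and F E :: "nat \<Rightarrow> nat \<Rightarrow> bool" and W :: "nat \<Rightarrow> nat \<Rightarrow> real"
  assumes F: "simple_graph n F" and E: "simple_graph n E"
    and col_orthonormal: "i < n \<Longrightarrow> j < n \<Longrightarrow> (\<Sum>k<n. W k i * W k j) = of_bool (i = j)"
    and row_orthonormal: "i < n \<Longrightarrow> j < n \<Longrightarrow> (\<Sum>k<n. W i k * W j k) = of_bool (i = j)"
    and intertwine: "i < n \<Longrightarrow> j < n \<Longrightarrow>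
      (\<Sum>k<n. W i k * qent n F k j) = (\<Sum>k<n. qent n E i k * W k j)"
begin

definition T :: "(nat \<Rightarrow> real) \<Rightarrow> nat \<Rightarrow> real" where
  "T x i = (\<Sum>j<n. W i j * x j)"

lemma T_inner: "(\<Sum>i<n. T x i * T y i) = (\<Sum>i<n. x i * y i)"
proof -
  have "(\<Sum>i<n. T x i * T y i) = (\<Sum>i<n. \<Sum>j<n. \<Sum>k<n. x j * y k * (W i j * W i k))"
    unfolding T_def sum_product by (intro sum.cong refl) (simp add: mult_ac)
  also have "\<dots> = (\<Sum>j<n. \<Sum>i<n. \<Sum>k<n. x j * y k * (W i j * W i k))" by (rule sum.swap)
  also have "\<dots> = (\<Sum>j<n. \<Sum>k<n. \<Sum>i<n. x j * y k * (W i j * W i k))"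
    by (intro sum.cong refl sum.swap)
  also have "\<dots> = (\<Sum>j<n. \<Sum>k<n. x j * y k * of_bool (j = k))"
    by (intro sum.cong refl) (simp add: sum_distrib_left[symmetric] col_orthonormal)
  also have "\<dots> = (\<Sum>j<n. x j * y j)"
    by (intro sum.cong refl) (simp add: of_bool_def if_distrib[of "\<lambda>c. _ * c"] cong: if_cong)
  finally show ?thesis .
qed

lemma T_sq: "sq n (T x) = sq n x"
  using T_inner[of x x] by (simp add: sq_def power2_eq_square)

lemma T_diff: "T (\<lambda>i. x i - y i) i = T x i - T y i"
  by (simp add: T_def algebra_simps sum_subtractf)

lemma T_scale: "T (\<lambda>i. c * x i) i = c * T x i"
  by (simp add: T_def sum_distrib_left mult_ac)

lemma T_eq_0:
  assumes "\<And>i. i < n \<Longrightarrow> T x i = 0" and "i < n"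
  shows "x i = 0"
proof -
  have "sq n (T x) = 0" using assms(1) by (simp add: sq_eq_0_iff)
  then show ?thesis using assms(2) by (simp add: T_sq sq_eq_0_iff)
qed

lemma T_qop:
  assumes "i < n"
  shows "qop n E (T x) i = T (qop n F x) i"
proof -
  have "qop n E (T x) i = (\<Sum>k<n. \<Sum>j<n. qent n E i k * (W k j * x j))"
    by (simp add: qop_def T_def sum_distrib_left)
  also have "\<dots> = (\<Sum>j<n. \<Sum>k<n. qent n E i k * (W k j * x j))" by (rule sum.swap)
  also have "\<dots> = (\<Sum>j<n. (\<Sum>k<n. W i k * qent n F k j) * x j)"
    using assms by (intro sum.cong refl) (simp add: intertwine sum_distrib_right mult.assoc)
  also have "\<dots> = (\<Sum>k<n. \<Sum>j<n. W i k * qent n F k j * x j)"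
    unfolding sum_distrib_right by (rule sum.swap)
  also have "\<dots> = T (qop n F x) i" by (simp add: T_def qop_def sum_distrib_left mult_ac)
  finally show ?thesis .
qed

lemma T_qform: "qform n E (T x) = qform n F x"
  unfolding qform_def using T_inner[of x "qop n F x"] by (simp add: T_qop)

text \<open>Dimension count: a linear family of dimension \<open>card I\<close> on the \<open>F\<close>-side contains a nonzero
  member whose image satisfies fewer than \<open>card I\<close> linear equations on the \<open>E\<close>-side.\<close>

lemma common_vector:
  fixes G :: "nat \<Rightarrow> 'i \<Rightarrow> real" and L :: "'k \<Rightarrow> nat \<Rightarrow> real" and D :: "'d \<Rightarrow> 'i \<Rightarrow> real"
  assumes I: "finite I" and K: "finite K" and Dx: "finite Dx" and card: "card K + card Dx < card I"
  obtains a where "\<exists>j\<in>I. a j \<noteq> 0" and "\<And>j. j \<notin> I \<Longrightarrow> a j = 0"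
    and "\<And>k. k \<in> K \<Longrightarrow> (\<Sum>i<n. L k i * T (\<lambda>i. \<Sum>j\<in>I. G i j * a j) i) = 0"
    and "\<And>d. d \<in> Dx \<Longrightarrow> (\<Sum>j\<in>I. D d j * a j) = 0"
proof -
  \<comment> \<open>Conditions on the image and conditions on the coefficients are merged into one
    homogeneous system, indexed by the disjoint sum.\<close>
  define c :: "'k + 'd \<Rightarrow> 'i \<Rightarrow> real" where
    "c s j = (case s of Inl k \<Rightarrow> (\<Sum>i<n. L k i * T (\<lambda>i. G i j) i) | Inr d \<Rightarrow> D d j)" for s j
  have T_sum: "T (\<lambda>i. \<Sum>j\<in>I. G i j * a j) i = (\<Sum>j\<in>I. T (\<lambda>i. G i j) i * a j)" for a i
    unfolding T_def sum_distrib_left sum_distrib_right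
    by (subst sum.swap) (simp add: mult.assoc)
  have "card (K <+> Dx) < card I" using card K Dx by (simp add: card_Plus)
  then obtain a where a: "\<exists>j\<in>I. a j \<noteq> 0" "\<And>j. j \<notin> I \<Longrightarrow> a j = 0"
    and eq: "\<And>s. s \<in> K <+> Dx \<Longrightarrow> (\<Sum>j\<in>I. c s j * a j) = 0"
    using homogeneous_system_nontrivial[of "K <+> Dx" I c] K Dx I by (auto simp del: Plus_def)
  have "(\<Sum>i<n. L k i * T (\<lambda>i. \<Sum>j\<in>I. G i j * a j) i) = 0" if "k \<in> K" for k
  proof -
    have "(\<Sum>i<n. L k i * T (\<lambda>i. \<Sum>j\<in>I. G i j * a j) i) = (\<Sum>j\<in>I. c (Inl k) j * a j)"
      unfolding T_sum c_def by (simp add: sum_distrib_left sum_distrib_right mult.assoc sum.swap[of _ I])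
    then show ?thesis using eq[of "Inl k"] that by auto
  qed
  moreover have "(\<Sum>j\<in>I. D d j * a j) = 0" if "d \<in> Dx" for d
    using eq[of "Inr d"] that by (auto simp: c_def)
  ultimately show ?thesis using a that by blast
qed

end

section \<open>Traces of powers and degree sums\<close>

definition mat_trace :: "real mat \<Rightarrow> real" where
  "mat_trace M = (\<Sum>i<dim_row M. M $$ (i, i))"

lemma mat_trace_commute:
  assumes "X \<in> carrier_mat n n" "Y \<in> carrier_mat n n"
  shows "mat_trace (X * Y) = mat_trace (Y * X)"
proof -
  have "mat_trace (X * Y) = (\<Sum>i<n. \<Sum>j<n. X $$ (i, j) * Y $$ (j, i))"
    using assms by (simp add: mat_trace_def scalar_prod_def atLeast0LessThan)
  also have "\<dots> = (\<Sum>j<n. \<Sum>i<n. X $$ (i, j) * Y $$ (j, i))" by (rule sum.swap)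
  also have "\<dots> = mat_trace (Y * X)"
    using assms by (simp add: mat_trace_def scalar_prod_def atLeast0LessThan mult.commute)
  finally show ?thesis .
qed

context Q_isospectral
begin

text \<open>The relation \<open>X * A = B * X\<close> passes to squares and cubes, and the trace is
  invariant under conjugation by the orthogonal matrix \<open>X\<close>.\<close>

lemma trace_powers:
  shows "(\<Sum>i<n. qent n F i i) = (\<Sum>i<n. qent n E i i)"
    and "(\<Sum>i<n. \<Sum>j<n. qent n F i j * qent n F j i) = (\<Sum>i<n. \<Sum>j<n. qent n E i j * qent n E j i)"
    and "(\<Sum>i<n. \<Sum>j<n. \<Sum>k<n. qent n F i j * qent n F j k * qent n F k i) =
      (\<Sum>i<n. \<Sum>j<n. \<Sum>k<n. qent n E i j * qent n E j k * qent n E k i)"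
proof -
  define A where "A = mat n n (\<lambda>(i, j). qent n F i j)"
  define B where "B = mat n n (\<lambda>(i, j). qent n E i j)"
  define X where "X = mat n n (\<lambda>(i, j). W i j)"
  have A: "A \<in> carrier_mat n n" and B: "B \<in> carrier_mat n n" and X: "X \<in> carrier_mat n n"
    by (simp_all add: A_def B_def X_def)
  let ?Y = "transpose_mat X"
  have Y: "?Y \<in> carrier_mat n n" using X by simp
  have YX: "?Y * X = 1\<^sub>m n"
    by (rule eq_matI) (auto simp: X_def scalar_prod_def atLeast0LessThan col_orthonormal)
  have XY: "X * ?Y = 1\<^sub>m n"
    by (rule eq_matI) (auto simp: X_def scalar_prod_def atLeast0LessThan row_orthonormal)
  have XA: "X * A = B * X"
    by (rule eq_matI) (auto simp: X_def A_def B_def scalar_prod_def atLeast0LessThan intertwine)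
  have key: "mat_trace M = mat_trace N"
    if M: "M \<in> carrier_mat n n" and N: "N \<in> carrier_mat n n" and "X * M = N * X" for M N
  proof -
    have "N = N * (X * ?Y)" using N XY by simp
    also have "\<dots> = (N * X) * ?Y" by (rule assoc_mult_mat[OF N X Y, symmetric])
    also have "\<dots> = X * M * ?Y" using that by simp
    finally have "mat_trace N = mat_trace (?Y * (X * M))"
      using mat_trace_commute[OF mult_carrier_mat[OF X M] Y] by simp
    also have "?Y * (X * M) = (?Y * X) * M" by (rule assoc_mult_mat[OF Y X M, symmetric])
    finally show ?thesis using YX M by simp
  qed
  have AA: "A * A \<in> carrier_mat n n" and BB: "B * B \<in> carrier_mat n n" using A B by auto
  have X2: "X * (A * A) = (B * B) * X"
  proof -
    have "X * (A * A) = (X * A) * A" by (rule assoc_mult_mat[OF X A A, symmetric])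
    also have "\<dots> = B * (X * A)" by (subst XA) (rule assoc_mult_mat[OF B X A])
    also have "\<dots> = (B * B) * X" unfolding XA by (rule assoc_mult_mat[OF B B X, symmetric])
    finally show ?thesis .
  qed
  have X3: "X * (A * A * A) = (B * B * B) * X"
  proof -
    have "X * (A * A * A) = (X * (A * A)) * A" by (rule assoc_mult_mat[OF X AA A, symmetric])
    also have "\<dots> = (B * B) * (X * A)" unfolding X2 by (rule assoc_mult_mat[OF BB X A])
    also have "\<dots> = (B * B * B) * X" unfolding XA by (rule assoc_mult_mat[OF BB B X, symmetric])
    finally show ?thesis .
  qed
  show "(\<Sum>i<n. qent n F i i) = (\<Sum>i<n. qent n E i i)"
    using key[OF A B XA] by (simp add: mat_trace_def A_def B_def)
  show "(\<Sum>i<n. \<Sum>j<n. qent n F i j * qent n F j i) = (\<Sum>i<n. \<Sum>j<n. qent n E i j * qent n E j i)"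
    using key[OF AA BB X2]
    by (simp add: mat_trace_def A_def B_def scalar_prod_def atLeast0LessThan)
  have "mat_trace (mat n n f * mat n n f * mat n n f) =
      (\<Sum>i<n. \<Sum>j<n. \<Sum>k<n. f (i, j) * f (j, k) * f (k, i))" for f
  proof -
    have "mat_trace (mat n n f * mat n n f * mat n n f) =
      (\<Sum>i<n. \<Sum>k<n. \<Sum>j<n. f (i, j) * f (j, k) * f (k, i))"
      by (simp add: mat_trace_def scalar_prod_def atLeast0LessThan sum_distrib_right)
    also have "\<dots> = (\<Sum>i<n. \<Sum>j<n. \<Sum>k<n. f (i, j) * f (j, k) * f (k, i))"
      by (intro sum.cong refl sum.swap)
    finally show ?thesis .
  qed
  from this[of "\<lambda>(i, j). qent n F i j"] this[of "\<lambda>(i, j). qent n E i j"]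
  show "(\<Sum>i<n. \<Sum>j<n. \<Sum>k<n. qent n F i j * qent n F j k * qent n F k i) =
      (\<Sum>i<n. \<Sum>j<n. \<Sum>k<n. qent n E i j * qent n E j k * qent n E k i)"
    using key[OF mult_carrier_mat[OF AA A] mult_carrier_mat[OF BB B] X3]
    by (simp add: A_def B_def)
qed

end

lemma trace_qent:
  assumes G: "simple_graph n G"
  shows "(\<Sum>i<n. qent n G i i) = (\<Sum>i<n. real (vdeg n G i))"
    and "(\<Sum>i<n. \<Sum>j<n. qent n G i j * qent n G j i) =
      (\<Sum>i<n. (real (vdeg n G i))\<^sup>2) + (\<Sum>i<n. real (vdeg n G i))"
    and "(\<Sum>i<n. \<Sum>j<n. \<Sum>k<n. qent n G i j * qent n G j k * qent n G k i) =
      (\<Sum>i<n. (real (vdeg n G i))^3) + 3 * (\<Sum>i<n. (real (vdeg n G i))\<^sup>2) + tri n G"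
proof -
  let ?a = "\<lambda>i j. adj G i j" and ?d = "\<lambda>i. real (vdeg n G i)"
  note irr = simple_graphD(4)[OF G] and sym = simple_graphD(5)[OF G]
  show "(\<Sum>i<n. qent n G i i) = (\<Sum>i<n. ?d i)" by (simp add: qent_def irr adj_def)
  have row: "(\<Sum>j<n. ?a i j) = ?d i" for i by (simp add: vdeg_sum)
  have col: "(\<Sum>j<n. ?a j i) = ?d i" for i by (simp add: vdeg_sum adj_def sym[of _ i])
  have "(\<Sum>i<n. \<Sum>j<n. qent n G i j * qent n G j i) =
      (\<Sum>i<n. \<Sum>j<n. ?a i j + (if i = j then (?d i)\<^sup>2 else 0))"
    by (intro sum.cong refl) (auto simp: qent_def irr sym power2_eq_square adj_def)
  then show "(\<Sum>i<n. \<Sum>j<n. qent n G i j * qent n G j i) = (\<Sum>i<n. (?d i)\<^sup>2) + (\<Sum>i<n. ?d i)"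
    by (simp add: sum.distrib row sum.delta')
  \<comment> \<open>Expansion of the cube of \<open>A + D\<close>: products with exactly two
    diagonal factors vanish because there are no loops. The three middle terms carry one diagonal
    factor, and each sums to the squared degrees.\<close>
  have "(\<Sum>i<n. \<Sum>j<n. \<Sum>k<n. qent n G i j * qent n G j k * qent n G k i) =
     (\<Sum>i<n. \<Sum>j<n. \<Sum>k<n. ?a i j * ?a j k * ?a k i + (if i = j then ?d i * ?a j k else 0)
       + (if j = k then ?d j * ?a i j else 0) + (if k = i then ?d i * ?a i j else 0)
       + (if k = i then if i = j then (?d i)^3 else 0 else 0))"
    by (intro sum.cong refl)
      (auto simp: qent_def irr sym power3_eq_cube adj_def)
  also have "\<dots> = tri n G + (\<Sum>i<n. ?d i * ?d i) + (\<Sum>i<n. \<Sum>j<n. ?d j * ?a i j)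
       + (\<Sum>i<n. ?d i * ?d i) + (\<Sum>i<n. (?d i)^3)"
  proof -
    have 1: "(\<Sum>i<n. \<Sum>j<n. \<Sum>k<n. if i = j then ?d i * ?a j k else 0) = (\<Sum>i<n. ?d i * ?d i)"
    proof (intro sum.cong refl)
      fix i assume "i \<in> {..<n}"
      have "(\<Sum>j<n. \<Sum>k<n. if i = j then ?d i * ?a j k else 0) =
        (\<Sum>j<n. if i = j then \<Sum>k<n. ?d i * ?a j k else 0)" by (intro sum.cong) auto
      then show "(\<Sum>j<n. \<Sum>k<n. if i = j then ?d i * ?a j k else 0) = ?d i * ?d i"
        using \<open>i \<in> {..<n}\<close> by (simp add: sum.delta' sum_distrib_left[symmetric] row)
    qed
    have 3: "(\<Sum>i<n. \<Sum>j<n. \<Sum>k<n. if k = i then ?d i * ?a i j else 0) = (\<Sum>i<n. ?d i * ?d i)"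
      by (intro sum.cong refl) (simp add: sum.delta sum_distrib_left[symmetric] row)
    have 4: "(\<Sum>i<n. \<Sum>j<n. \<Sum>k<n. if k = i then if i = j then (?d i)^3 else 0 else 0) = (\<Sum>i<n. (?d i)^3)"
      by (intro sum.cong refl) (simp add: sum.delta sum.delta')
    have 2: "(\<Sum>i<n. \<Sum>j<n. \<Sum>k<n. if j = k then ?d j * ?a i j else 0) = (\<Sum>i<n. \<Sum>j<n. ?d j * ?a i j)"
      by (intro sum.cong refl) (simp add: sum.delta')
    show ?thesis unfolding sum.distrib 1 2 3 4 tri_def by simp
  qed
  also have "(\<Sum>i<n. \<Sum>j<n. ?d j * ?a i j) = (\<Sum>j<n. ?d j * ?d j)"
    by (subst sum.swap) (simp add: sum_distrib_left[symmetric] col)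
  finally show "(\<Sum>i<n. \<Sum>j<n. \<Sum>k<n. qent n G i j * qent n G j k * qent n G k i) =
      (\<Sum>i<n. (?d i)^3) + 3 * (\<Sum>i<n. (?d i)\<^sup>2) + tri n G"
    by (simp add: power2_eq_square)
qed

lemma tri_nonneg: "0 \<le> tri n G"
  by (simp add: tri_def sum_nonneg adj_def)

section \<open>The spectral radius of the jellyfish graph\<close>

definition lam :: "nat \<Rightarrow> real" where
  "lam p = (real p + 5 + sqrt ((real p + 5)\<^sup>2 - 16)) / 2"

definition pend :: "nat \<Rightarrow> real" where
  "pend p = 1 / (lam p - 1)"

lemma lam_quadratic: "(lam p)\<^sup>2 = (real p + 5) * lam p - 4"
proof -
  have "(sqrt ((real p + 5)\<^sup>2 - 16))\<^sup>2 = (real p + 5)\<^sup>2 - 16"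
    by (rule real_sqrt_pow2) (simp add: power2_eq_square algebra_simps)
  then show ?thesis by (simp add: lam_def power2_eq_square field_simps)
qed

lemma lam_bounds:
  assumes "p \<ge> 1"
  shows "real p + 4 < lam p" "lam p < real p + 5"
proof -
  have "real p + 3 < sqrt ((real p + 5)\<^sup>2 - 16)"
    by (rule real_less_rsqrt) (use assms in \<open>simp add: power2_eq_square algebra_simps\<close>)
  then show "real p + 4 < lam p" by (simp add: lam_def)
  have "sqrt ((real p + 5)\<^sup>2 - 16) < real p + 5"
    by (rule real_less_lsqrt) auto
  then show "lam p < real p + 5" by (simp add: lam_def)
qed

lemma pend_bounds:
  assumes "p \<ge> 1"
  shows "0 < pend p" "pend p < 1" "pend p * (lam p - 1) = 1"
  using lam_bounds[OF assms] by (auto simp: pend_def field_simps)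

text \<open>This is the eigenvalue equation at a cycle vertex: degree \<open>p + 2\<close>, two
  cycle neighbours of value \<open>1\<close>, and \<open>p\<close> leaves of value
  \<open>pend p\<close>. The third part of \<open>pend_bounds\<close> is the equation at a
  leaf.\<close>

lemma lam_pend:
  assumes "p \<ge> 1"
  shows "4 + real p * (1 + pend p) = lam p"
proof -
  have nz: "lam p - 1 \<noteq> 0" using lam_bounds[OF assms] by simp
  have "(4 + real p * (1 + pend p) - lam p) * (lam p - 1) =
      (4 - lam p) * (lam p - 1) + real p * (lam p - 1 + pend p * (lam p - 1))"
    by (simp add: algebra_simps)
  also have "\<dots> = (4 - lam p) * (lam p - 1) + real p * lam p"
    using pend_bounds(3)[OF assms] by simp
  also have "\<dots> = 0" using lam_quadratic[of p] by (simp add: power2_eq_square algebra_simps)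
  finally show ?thesis using nz by simp
qed

lemma cyclic_differences: "b - a + (c - b) + (a - c) = 0" for a b c :: real
  by simp

text \<open>Along a cycle edge the vertex number changes by \<open>1\<close> or by
  \<open>Q = q - 1\<close>, up to sign, and a triangle would be three such changes with sum zero.
  For \<open>Q = 2\<close> the sum \<open>1 + 1 - 2\<close> is the triangle \<open>q = 3\<close>
  itself.\<close>

lemma three_steps_nonzero:
  fixes x y z Q :: real
  assumes "x \<in> {1, -1, Q, - Q}" and "y \<in> {1, -1, Q, - Q}" and "z \<in> {1, -1, Q, - Q}" and "Q \<ge> 3"
  shows "x + y + z \<noteq> 0"
  using assms by auto

section \<open>Adjacency, kernel, top eigenvector and eigenvalue bounds of the jellyfish
  graph\<close>

locale jellyfish =
  fixes p q :: nat
  assumes p: "1 \<le> p" and q: "3 \<le> q"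
begin

abbreviation "n \<equiv> jfg_n p q"
abbreviation "J \<equiv> jfg_E p q"

definition leaf :: "nat \<Rightarrow> nat \<Rightarrow> nat" where "leaf i k = q + i * p + k"

lemma leaf_lt: "i < q \<Longrightarrow> k < p \<Longrightarrow> leaf i k < n"
proof -
  assume "i < q" "k < p"
  then have "i * p + k < Suc i * p" by simp
  also have "\<dots> \<le> q * p" using \<open>i < q\<close> by (intro mult_right_mono) auto
  finally show ?thesis by (simp add: leaf_def jfg_n_def)
qed

lemma leaf_not_core: "\<not> leaf i k < q" "u < q \<Longrightarrow> leaf i k \<noteq> u" "u < q \<Longrightarrow> u \<noteq> leaf i k"
  by (auto simp: leaf_def)

lemma leaf_inj: "k < p \<Longrightarrow> l < p \<Longrightarrow> leaf i k = leaf j l \<longleftrightarrow> i = j \<and> k = l"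
proof
  assume kl: "k < p" "l < p" and eq: "leaf i k = leaf j l"
  then have "i * p + k = j * p + l" by (simp add: leaf_def)
  then have "(i * p + k) div p = (j * p + l) div p" "(i * p + k) mod p = (j * p + l) mod p" by simp_all
  then show "i = j \<and> k = l" using kl by simp
qed simp

lemma vertex_cases:
  assumes "v < n"
  obtains "v < q" | i k where "i < q" "k < p" "v = leaf i k"
proof (cases "v < q")
  case False
  define w where "w = v - q"
  have w: "v = q + w" "w < q * p" using False assms by (auto simp: w_def jfg_n_def)
  have "w div p < q" using w by (simp add: less_mult_imp_div_less)
  moreover have "w mod p < p" using p by simp
  moreover have "v = leaf (w div p) (w mod p)" using w by (simp add: leaf_def)
  ultimately show ?thesis using that by blast
qed (use that in blast)

lemma sum_vertices: "(\<Sum>v<n. f v) = (\<Sum>i<q. f i) + (\<Sum>i<q. \<Sum>k<p. f (leaf i k))" for f :: "nat \<Rightarrow> real"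
proof -
  have shift: "(\<Sum>v=a..<a + b. f v) = (\<Sum>k<b. f (a + k))" for a b :: nat and f :: "nat \<Rightarrow> real"
    using sum.shift_bounds_nat_ivl[of f 0 a b] by (simp add: atLeast0LessThan add.commute)
  have "(\<Sum>v<n. f v) = (\<Sum>v<q. f v) + (\<Sum>v=q..<q + q * p. f v)"
    by (simp add: jfg_n_def sum.atLeastLessThan_concat lessThan_atLeast0)
  also have "(\<Sum>v=q..<q + q * p. f v) = (\<Sum>w<q * p. f (q + w))" by (rule shift)
  also have "\<dots> = (\<Sum>i<q. \<Sum>w=i * p..<i * p + p. f (q + w))" by (rule sum.nat_group[symmetric])
  also have "\<dots> = (\<Sum>i<q. \<Sum>k<p. f (leaf i k))"
    unfolding shift by (simp add: leaf_def add.assoc)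
  finally show ?thesis .
qed

definition nxt :: "nat \<Rightarrow> nat" where "nxt u = (if Suc u = q then 0 else Suc u)"

definition prv :: "nat \<Rightarrow> nat" where "prv u = (if u = 0 then q - 1 else u - 1)"

lemma nxt_mod: "u < q \<Longrightarrow> Suc u mod q = nxt u"
  by (cases "Suc u = q") (simp_all add: nxt_def)

lemma nxt_lt: "u < q \<Longrightarrow> nxt u < q"
  using q by (simp add: nxt_def)

lemma nxt_inj: "nxt u = nxt v \<Longrightarrow> u = v"
  by (simp add: nxt_def split: if_splits)

lemma prv_lt: "u < q \<Longrightarrow> prv u < q"
  by (cases u) (simp_all add: prv_def)

lemma nxt_prv: "u < q \<Longrightarrow> nxt (prv u) = u"
  using q by (simp add: nxt_def prv_def)

lemma nxt_eq_iff: "u < q \<Longrightarrow> u = nxt v \<longleftrightarrow> v = prv u"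
  using nxt_prv nxt_inj by metis

lemma sum_nxt: "(\<Sum>i<q. f (nxt i)) = (\<Sum>i<q. f i)" for f :: "nat \<Rightarrow> real"
proof (rule sum.reindex_bij_betw)
  show "bij_betw nxt {..<q} {..<q}"
    by (rule bij_betwI[of _ _ _ prv]) (use nxt_lt prv_lt nxt_prv nxt_inj in auto)
qed

lemma edge0_iff: "jfg_edge0 p q u v \<longleftrightarrow> u < q \<and> (v = nxt u \<or> (\<exists>k<p. v = leaf u k))"
  by (cases "u < q") (simp_all add: jfg_edge0_def leaf_def nxt_mod)

lemma edge0_core: "v < q \<Longrightarrow> jfg_edge0 p q u v \<longleftrightarrow> u < q \<and> v = nxt u"
  using edge0_iff leaf_not_core(3) by metis

lemma edge0_leaf: "k < p \<Longrightarrow> jfg_edge0 p q u (leaf i k) \<longleftrightarrow> u < q \<and> u = i"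
  using edge0_iff leaf_not_core(2) nxt_lt leaf_inj by metis

lemma edge0_from_leaf: "\<not> jfg_edge0 p q (leaf i k) v"
  using edge0_iff leaf_not_core(1) by metis

lemma edge0_asym: "jfg_edge0 p q u v \<Longrightarrow> \<not> jfg_edge0 p q v u"
proof
  assume uv: "jfg_edge0 p q u v" and vu: "jfg_edge0 p q v u"
  then have "u < q" "v < q" by (simp_all add: edge0_iff)
  then have "v = nxt u" "u = nxt v" using edge0_core uv vu by blast+
  then show False using q unfolding nxt_def by presburger
qed

lemma simple_graph_jfg: "simple_graph n J"
proof -
  have "u < n \<and> v < n" if "jfg_edge0 p q u v" for u v
  proof -
    have "u < q" using that by (simp add: edge0_iff)
    then show ?thesis
      using that leaf_lt[of u] trans_less_add1[OF nxt_lt[of u], of "q * p"]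
      by (auto simp: edge0_iff jfg_n_def)
  qed
  then show ?thesis
    unfolding simple_graph_def jfg_E_def using edge0_asym by blast
qed

text \<open>One orientation of each edge, around the cycle and from centre to leaf. Since no edge is
  oriented both ways, the adjacency matrix is \<open>e0\<close> plus its transpose.\<close>

definition e0 :: "nat \<Rightarrow> nat \<Rightarrow> real" where "e0 u v = (if jfg_edge0 p q u v then 1 else 0)"

lemma adj_e0: "adj J u v = e0 u v + e0 v u"
  using edge0_asym[of u v] by (auto simp: adj_def e0_def jfg_E_def)

lemma sum_e0_out:
  assumes "u < q"
  shows "(\<Sum>v<n. e0 u v * f v) = f (nxt u) + (\<Sum>k<p. f (leaf u k))"
proof -
  have "(\<Sum>i<q. e0 u i * f i) = (\<Sum>i<q. if i = nxt u then f i else 0)"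
    using assms by (intro sum.cong) (simp_all add: e0_def edge0_core)
  also have "\<dots> = f (nxt u)" using nxt_lt[OF assms] by (simp add: sum.delta)
  finally have 1: "(\<Sum>i<q. e0 u i * f i) = f (nxt u)" .
  have "(\<Sum>i<q. \<Sum>k<p. e0 u (leaf i k) * f (leaf i k)) = (\<Sum>i<q. if i = u then (\<Sum>k<p. f (leaf i k)) else 0)"
  proof (intro sum.cong refl)
    fix i assume "i \<in> {..<q}"
    have "e0 u (leaf i k) = (if i = u then 1 else 0)" if "k < p" for k
      using that assms by (auto simp: e0_def edge0_leaf)
    then show "(\<Sum>k<p. e0 u (leaf i k) * f (leaf i k)) = (if i = u then (\<Sum>k<p. f (leaf i k)) else 0)"
      by simp
  qed
  then show ?thesis using assms by (simp add: sum_vertices 1 sum.delta)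
qed

lemma sum_e0_in_core:
  assumes "u < q"
  shows "(\<Sum>v<n. e0 v u * f v) = f (prv u)"
proof -
  have "(\<Sum>i<q. e0 i u * f i) = (\<Sum>i<q. if i = prv u then f i else 0)"
  proof (intro sum.cong refl)
    fix i assume "i \<in> {..<q}"
    then have "jfg_edge0 p q i u \<longleftrightarrow> i = prv u"
      using nxt_eq_iff[OF assms, of i] edge0_core[OF assms] by blast
    then show "e0 i u * f i = (if i = prv u then f i else 0)" by (simp add: e0_def)
  qed
  also have "\<dots> = f (prv u)" using prv_lt[OF assms] by (simp add: sum.delta)
  finally have 1: "(\<Sum>i<q. e0 i u * f i) = f (prv u)" .
  have "e0 (leaf i k) u = 0" for i k by (simp add: e0_def edge0_from_leaf)
  then show ?thesis by (simp add: sum_vertices 1)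
qed

lemma sum_e0_in_leaf:
  assumes "i < q" "k < p"
  shows "(\<Sum>v<n. e0 v (leaf i k) * f v) = f i"
proof -
  have "(\<Sum>j<q. e0 j (leaf i k) * f j) = (\<Sum>j<q. if j = i then f j else 0)"
  proof (intro sum.cong refl)
    fix j assume "j \<in> {..<q}"
    then show "e0 j (leaf i k) * f j = (if j = i then f j else 0)"
      using assms by (auto simp: e0_def edge0_leaf)
  qed
  also have "\<dots> = f i" using assms by (simp add: sum.delta)
  finally have 1: "(\<Sum>j<q. e0 j (leaf i k) * f j) = f i" .
  have "e0 (leaf j l) u = 0" for j l u by (simp add: e0_def edge0_from_leaf)
  then show ?thesis by (simp add: sum_vertices 1)
qed

lemma e0_leaf_out: "e0 (leaf i k) v = 0"
  by (simp add: e0_def edge0_from_leaf)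

lemma sum_adj_core:
  "u < q \<Longrightarrow> (\<Sum>v<n. adj J u v * f v) = f (nxt u) + f (prv u) + (\<Sum>k<p. f (leaf u k))"
  by (simp add: adj_e0 distrib_right sum.distrib sum_e0_out sum_e0_in_core)

lemma sum_adj_leaf:
  "i < q \<Longrightarrow> k < p \<Longrightarrow> (\<Sum>v<n. adj J (leaf i k) v * f v) = f i"
  by (simp add: adj_e0 distrib_right sum.distrib e0_leaf_out sum_e0_in_leaf)

lemma vdeg_core: "u < q \<Longrightarrow> real (vdeg n J u) = real p + 2"
  using sum_adj_core[of u "\<lambda>_. 1"] by (simp add: vdeg_sum)

lemma vdeg_leaf: "i < q \<Longrightarrow> k < p \<Longrightarrow> real (vdeg n J (leaf i k)) = 1"
  using sum_adj_leaf[of i k "\<lambda>_. 1"] by (simp add: vdeg_sum)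

lemma qop_core: "u < q \<Longrightarrow> qop n J x u = (real p + 2) * x u + x (nxt u) + x (prv u) + (\<Sum>k<p. x (leaf u k))"
  using qop_eq[of u n J x] by (simp add: jfg_n_def[of p q] vdeg_core[unfolded jfg_n_def] sum_adj_core[unfolded jfg_n_def])

lemma qop_leaf: "i < q \<Longrightarrow> k < p \<Longrightarrow> qop n J x (leaf i k) = x (leaf i k) + x i"
  using qop_eq[OF leaf_lt, of i k J x] by (simp add: vdeg_leaf sum_adj_leaf)

lemma qform_jfg:
  "qform n J x = (\<Sum>i<q. (x i + x (nxt i))\<^sup>2) + (\<Sum>i<q. \<Sum>k<p. (x i + x (leaf i k))\<^sup>2)"
proof -
  have "(\<Sum>u<n. \<Sum>v<n. adj J u v * (x u + x v)\<^sup>2) =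
      (\<Sum>u<n. \<Sum>v<n. e0 u v * (x u + x v)\<^sup>2) + (\<Sum>u<n. \<Sum>v<n. e0 v u * (x u + x v)\<^sup>2)"
    by (simp add: adj_e0 distrib_right sum.distrib)
  also have "(\<Sum>u<n. \<Sum>v<n. e0 v u * (x u + x v)\<^sup>2) = (\<Sum>u<n. \<Sum>v<n. e0 u v * (x u + x v)\<^sup>2)"
    by (subst sum.swap) (simp add: add.commute)
  finally have "qform n J x = (\<Sum>u<n. \<Sum>v<n. e0 u v * (x u + x v)\<^sup>2)"
    by (simp add: qform_edges[OF simple_graph_jfg])
  then show ?thesis by (simp add: sum_vertices[of "\<lambda>u. \<Sum>v<n. e0 u v * (x u + x v)\<^sup>2"] sum_e0_out
      e0_leaf_out sum.distrib)
qed

lemma sq_jfg: "sq n x = (\<Sum>i<q. (x i)\<^sup>2) + (\<Sum>i<q. \<Sum>k<p. (x (leaf i k))\<^sup>2)"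
  unfolding sq_def by (rule sum_vertices)

abbreviation "\<mu> \<equiv> lam p"
abbreviation "\<rho> \<equiv> pend p"

lemma sum_sq_cycle:
  "(\<Sum>i<q. (x i + x (nxt i))\<^sup>2) = 4 * (\<Sum>i<q. (x i)\<^sup>2) - (\<Sum>i<q. (x i - x (nxt i))\<^sup>2)"
  for x :: "nat \<Rightarrow> real"
proof -
  have "(\<Sum>i<q. (x i + x (nxt i))\<^sup>2) + (\<Sum>i<q. (x i - x (nxt i))\<^sup>2) =
      2 * (\<Sum>i<q. (x i)\<^sup>2) + 2 * (\<Sum>i<q. (x (nxt i))\<^sup>2)"
    unfolding sum.distrib[symmetric] sum_distrib_left
    by (intro sum.cong) (auto simp: power2_eq_square algebra_simps)
  then show ?thesis using sum_nxt[of "\<lambda>i. (x i)\<^sup>2"] by simp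
qed

text \<open>A certificate by sums of squares: it shows at once that \<open>\<mu>\<close> bounds the
  form and which vectors attain the bound.\<close>

lemma lam_defect:
  "\<mu> * sq n x - qform n J x =
    (\<Sum>i<q. (x i - x (nxt i))\<^sup>2) + (\<mu> - 1) * (\<Sum>i<q. \<Sum>k<p. (x (leaf i k) - \<rho> * x i)\<^sup>2)"
proof -
  \<comment> \<open>Completing the square in the leaf value \<open>y\<close>, with
    \<open>\<rho> * (\<mu> - 1) = 1\<close>. The rest \<open>(1 + \<rho>) * z\<^sup>2\<close>,
    collected over \<open>p\<close> leaves, is the part of \<open>\<mu>\<close> beyond
    \<open>4\<close> by \<open>lam_pend\<close>.\<close>
  have pt: "\<mu> * y\<^sup>2 - (z + y)\<^sup>2 = (\<mu> - 1) * (y - \<rho> * z)\<^sup>2 - (1 + \<rho>) * z\<^sup>2" for y z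
  proof -
    have "(\<mu> - 1) * (y - \<rho> * z)\<^sup>2 =
      (\<mu> - 1) * y\<^sup>2 - 2 * (\<rho> * (\<mu> - 1)) * y * z + (\<rho> * (\<mu> - 1)) * \<rho> * z\<^sup>2"
      by (simp add: power2_eq_square algebra_simps)
    then show ?thesis unfolding pend_bounds(3)[OF p] by (simp add: power2_eq_square algebra_simps)
  qed
  have "\<mu> * (\<Sum>i<q. \<Sum>k<p. (x (leaf i k))\<^sup>2) - (\<Sum>i<q. \<Sum>k<p. (x i + x (leaf i k))\<^sup>2) =
      (\<Sum>i<q. \<Sum>k<p. (\<mu> - 1) * (x (leaf i k) - \<rho> * x i)\<^sup>2 - (1 + \<rho>) * (x i)\<^sup>2)"
    by (simp add: sum_distrib_left sum_subtractf[symmetric] pt)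
  also have "\<dots> = (\<mu> - 1) * (\<Sum>i<q. \<Sum>k<p. (x (leaf i k) - \<rho> * x i)\<^sup>2) - real p * (1 + \<rho>) * (\<Sum>i<q. (x i)\<^sup>2)"
    by (simp add: sum_subtractf sum_distrib_left mult.assoc)
  finally have "\<mu> * sq n x - qform n J x = (\<mu> - 4 - real p * (1 + \<rho>)) * (\<Sum>i<q. (x i)\<^sup>2)
     + (\<Sum>i<q. (x i - x (nxt i))\<^sup>2) + (\<mu> - 1) * (\<Sum>i<q. \<Sum>k<p. (x (leaf i k) - \<rho> * x i)\<^sup>2)"
    by (simp add: qform_jfg sq_jfg sum_sq_cycle algebra_simps)
  then show ?thesis using lam_pend[OF p] by simp
qed

lemma qform_jfg_le: "qform n J x \<le> \<mu> * sq n x"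
proof -
  have "0 \<le> \<mu> * sq n x - qform n J x"
    unfolding lam_defect using lam_bounds[OF p] by (intro add_nonneg_nonneg mult_nonneg_nonneg sum_nonneg) auto
  then show ?thesis by simp
qed

lemma cycle_constant:
  assumes "\<And>i. i < q \<Longrightarrow> x (nxt i) = x i" and "i < q"
  shows "x i = x 0"
  using assms(2)
proof (induction i)
  case (Suc i)
  then have "x (nxt i) = x i" using assms(1) by simp
  then show ?case using Suc by (simp add: nxt_def)
qed simp

text \<open>Equality makes both sums of squares in \<open>lam_defect\<close> vanish. Such a vector
  is determined by its value at vertex \<open>0\<close>, so \<open>\<mu>\<close> is a simple
  eigenvalue.\<close>

lemma qform_jfg_top:
  assumes "qform n J x = \<mu> * sq n x"
  shows "i < q \<Longrightarrow> x i = x 0" "i < q \<Longrightarrow> k < p \<Longrightarrow> x (leaf i k) = \<rho> * x 0"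
proof -
  have l: "\<mu> - 1 > 0" using lam_bounds[OF p] by simp
  have a: "0 \<le> (\<Sum>i<q. (x i - x (nxt i))\<^sup>2)" by (simp add: sum_nonneg)
  have b: "0 \<le> (\<mu> - 1) * (\<Sum>i<q. \<Sum>k<p. (x (leaf i k) - \<rho> * x i)\<^sup>2)"
    using l by (intro mult_nonneg_nonneg sum_nonneg) auto
  have "(\<Sum>i<q. (x i - x (nxt i))\<^sup>2) = 0"
    and "(\<mu> - 1) * (\<Sum>i<q. \<Sum>k<p. (x (leaf i k) - \<rho> * x i)\<^sup>2) = 0"
    using lam_defect[of x] assms a b by linarith+
  then have 1: "\<forall>i\<in>{..<q}. (x i - x (nxt i))\<^sup>2 = 0"
    and 2: "\<forall>i\<in>{..<q}. \<forall>k\<in>{..<p}. (x (leaf i k) - \<rho> * x i)\<^sup>2 = 0"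
    using l by (simp_all add: sum_nonneg_eq_0_iff sum_nonneg)
  have *: "x i = x 0" if "i < q" for i
    by (rule cycle_constant[OF _ that]) (use 1 in auto)
  then show "i < q \<Longrightarrow> x i = x 0" by blast
  show "i < q \<Longrightarrow> k < p \<Longrightarrow> x (leaf i k) = \<rho> * x 0"
  proof -
    assume ik: "i < q" "k < p"
    then have "x (leaf i k) = \<rho> * x i" using 2 by auto
    then show ?thesis using *[OF ik(1)] by (simp only:)
  qed
qed

lemma qop_top:
  assumes "qform n J x = \<mu> * sq n x" and "v < n"
  shows "qop n J x v = \<mu> * x v"
  using assms(2)
proof (cases rule: vertex_cases)
  case 1
  note top = qform_jfg_top[OF assms(1)]
  have "x v = x 0" "x (nxt v) = x 0" "x (prv v) = x 0"
    using top(1)[OF 1] top(1)[OF nxt_lt[OF 1]] top(1)[OF prv_lt[OF 1]] .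
  moreover have "(\<Sum>k<p. x (leaf v k)) = real p * (\<rho> * x 0)"
    using top(2)[OF 1] by simp
  ultimately have "qop n J x v = (real p + 2) * x 0 + x 0 + x 0 + real p * (\<rho> * x 0)"
    unfolding qop_core[OF 1] by (simp only:)
  also have "\<dots> = (4 + real p * (1 + \<rho>)) * x 0" by (simp add: algebra_simps)
  finally show ?thesis unfolding lam_pend[OF p] \<open>x v = x 0\<close> .
next
  case (2 i k)
  note top = qform_jfg_top[OF assms(1)]
  have "qop n J x v = \<rho> * x 0 + x 0"
    unfolding 2(3) qop_leaf[OF 2(1,2)] top(2)[OF 2(1,2)] top(1)[OF 2(1)] ..
  also have "\<dots> = (\<rho> + \<rho> * (\<mu> - 1)) * x 0"
    unfolding pend_bounds(3)[OF p] by (simp add: algebra_simps)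
  also have "\<dots> = \<mu> * (\<rho> * x 0)" by (simp add: algebra_simps)
  finally show ?thesis unfolding 2(3) top(2)[OF 2(1,2)] .
qed

lemma jfg_kernel:
  assumes "qform n J x = 0"
  shows "i < q \<Longrightarrow> x (nxt i) = - x i" "i < q \<Longrightarrow> k < p \<Longrightarrow> x (leaf i k) = - x i"
proof -
  have "\<forall>i\<in>{..<q}. (x i + x (nxt i))\<^sup>2 = 0" "\<forall>i\<in>{..<q}. \<forall>k\<in>{..<p}. (x i + x (leaf i k))\<^sup>2 = 0"
  proof -
    have "(\<Sum>i<q. (x i + x (nxt i))\<^sup>2) = 0" "(\<Sum>i<q. \<Sum>k<p. (x i + x (leaf i k))\<^sup>2) = 0"
      using assms sum_nonneg[of "{..<q}" "\<lambda>i. (x i + x (nxt i))\<^sup>2"]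
        sum_nonneg[of "{..<q}" "\<lambda>i. \<Sum>k<p. (x i + x (leaf i k))\<^sup>2"]
      unfolding qform_jfg by (simp_all add: sum_nonneg add_nonneg_eq_0_iff)
    then show "\<forall>i\<in>{..<q}. (x i + x (nxt i))\<^sup>2 = 0" "\<forall>i\<in>{..<q}. \<forall>k\<in>{..<p}. (x i + x (leaf i k))\<^sup>2 = 0"
      by (simp_all add: sum_nonneg_eq_0_iff sum_nonneg)
  qed
  then show "i < q \<Longrightarrow> x (nxt i) = - x i" "i < q \<Longrightarrow> k < p \<Longrightarrow> x (leaf i k) = - x i"
    by (auto simp: add_eq_0_iff2)
qed

text \<open>Kernel vectors change sign along edges of a connected graph, so one value determines
  them and the kernel has dimension at most one.\<close>

lemma jfg_kernel_zero:
  assumes "qform n J x = 0" and "x 0 = 0" and "v < n"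
  shows "x v = 0"
proof -
  have c: "x i = 0" if "i < q" for i
    using that
  proof (induction i)
    case (Suc i)
    then show ?case using jfg_kernel(1)[OF assms(1), of i] by (simp add: nxt_def)
  qed (simp add: assms)
  show ?thesis using assms(3)
    by (cases rule: vertex_cases) (use c jfg_kernel(2)[OF assms(1)] in auto)
qed

text \<open>Three sign changes around the triangle send a value to its negative.\<close>

lemma jfg_kernel_trivial_triangle:
  assumes "q = 3" and "qform n J x = 0"
  shows "x 0 = 0"
proof -
  have "nxt 0 = 1" "nxt 1 = 2" "nxt 2 = 0" unfolding nxt_def using assms(1) by simp_all
  then show ?thesis
    using jfg_kernel(1)[OF assms(2), of 0] jfg_kernel(1)[OF assms(2), of 1]
      jfg_kernel(1)[OF assms(2), of 2] assms(1) by simp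
qed

text \<open>Only the leaf terms survive. The assumption costs \<open>q\<close> linear conditions, so
  at most \<open>q\<close> eigenvalues exceed \<open>1\<close>.\<close>

lemma qform_le_sq_if_core_zero:
  assumes "\<And>i. i < q \<Longrightarrow> x i = 0"
  shows "qform n J x \<le> sq n x"
  using assms nxt_lt by (simp add: qform_jfg sq_jfg)

text \<open>These vectors form a space of dimension \<open>q\<close> on which \<open>Q < 1\<close>,
  so at most \<open>p * q\<close> eigenvalues are at least \<open>1\<close>. Any factor below
  \<open>-2\<close> would serve here; with \<open>-4\<close> the same space also yields the quotient
  \<open>13 / 17\<close> for \<open>p = 1\<close>.\<close>

lemma qform_less_sq:
  assumes leaf: "\<And>i k. i < q \<Longrightarrow> k < p \<Longrightarrow> x (leaf i k) = - 4 * x i" and nz: "sq n x \<noteq> 0"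
  shows "qform n J x < sq n x"
proof -
  let ?S = "\<Sum>i<q. (x i)\<^sup>2"
  have sq: "sq n x = (1 + 16 * real p) * ?S"
    by (simp add: sq_jfg leaf power_mult_distrib sum_distrib_left algebra_simps)
  have "?S \<noteq> 0" using nz sq by auto
  moreover have "0 \<le> ?S" by (simp add: sum_nonneg)
  ultimately have S: "?S > 0" by simp
  have "(\<Sum>i<q. \<Sum>k<p. (x i + x (leaf i k))\<^sup>2) = 9 * real p * ?S"
    by (simp add: leaf power_mult_distrib sum_distrib_left algebra_simps)
  moreover have "(\<Sum>i<q. (x i + x (nxt i))\<^sup>2) \<le> 4 * ?S"
    unfolding sum_sq_cycle by (simp add: sum_nonneg)
  ultimately have "qform n J x \<le> (4 + 9 * real p) * ?S" by (simp add: qform_jfg algebra_simps)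
  also have "\<dots> < (1 + 16 * real p) * ?S" using S p by (intro mult_strict_right_mono) auto
  finally show ?thesis using sq by simp
qed

text \<open>The Rayleigh quotient is at most \<open>13 / 17\<close>. The rounder bound
  \<open>4 / 5\<close> turns degrees \<open>2\<close> and \<open>3\<close> into diagonal entries
  \<open>6 / 5\<close> and \<open>11 / 5\<close>.\<close>

lemma qform_le_four_fifths:
  assumes "p = 1" and leaf: "\<And>i. i < q \<Longrightarrow> x (leaf i 0) = - 4 * x i"
  shows "qform n J x \<le> 4 / 5 * sq n x"
proof -
  let ?S = "\<Sum>i<q. (x i)\<^sup>2"
  have S: "?S \<ge> 0" by (simp add: sum_nonneg)
  have one: "(\<Sum>k<p. f k) = f 0" for f :: "nat \<Rightarrow> real" using \<open>p = 1\<close> by simp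
  have sq: "sq n x = 17 * ?S"
    unfolding sq_jfg one by (simp add: leaf power_mult_distrib sum_distrib_left[symmetric])
  have "(\<Sum>i<q. \<Sum>k<p. (x i + x (leaf i k))\<^sup>2) = 9 * ?S"
    unfolding one by (simp add: leaf power_mult_distrib sum_distrib_left)
  moreover have "(\<Sum>i<q. (x i + x (nxt i))\<^sup>2) \<le> 4 * ?S"
    unfolding sum_sq_cycle by (simp add: sum_nonneg)
  ultimately have "qform n J x \<le> 13 * ?S" by (simp add: qform_jfg)
  then show ?thesis using sq S by simp
qed

text \<open>The equation at a leaf forces its centre to vanish, and the equation at the centre then
  kills the single leaf. Two pendant vertices with a common neighbour would produce this eigenvalue,
  so a mate for \<open>p = 1\<close> has none.\<close>

lemma no_eigenvalue_one:
  assumes "p = 1" and ev: "\<And>v. v < n \<Longrightarrow> qop n J x v = x v" and "v < n"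
  shows "x v = 0"
proof -
  have core: "x i = 0" if "i < q" for i
    using ev[OF leaf_lt[of i 0]] qop_leaf[of i 0 x] that \<open>p = 1\<close> by simp
  have leaf0: "x (leaf i 0) = 0" if "i < q" for i
  proof -
    have "(\<Sum>k<p. x (leaf i k)) = x (leaf i 0)" using \<open>p = 1\<close> by simp
    moreover have "i < n" using that by (simp add: jfg_n_def)
    ultimately show ?thesis
      using ev[of i] qop_core[OF that, of x] core[OF that] core[OF nxt_lt[OF that]] core[OF prv_lt[OF that]]
      by simp
  qed
  show ?thesis using assms(3)
  proof (cases rule: vertex_cases)
    case (2 i k)
    then show ?thesis using leaf0 \<open>p = 1\<close> by simp
  qed (rule core)
qed

text \<open>A leaf has a single neighbour and lies on no triangle.\<close>

lemma tri_core:
  assumes "J i j" "J j k" "J k i"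
  shows "i < q \<and> j < q \<and> k < q"
proof -
  have *: "a < q" if "J a b" "J b c" "J c a" for a b c
  proof (rule ccontr)
    assume "\<not> a < q"
    moreover have "a < n" using that simple_graph_jfg by (auto simp: simple_graph_def)
    ultimately obtain i k where a: "i < q" "k < p" "a = leaf i k" by (meson vertex_cases)
    have "z = i" if "J (leaf i k) z" for z
      using that a by (simp add: jfg_E_def edge0_leaf edge0_from_leaf)
    then have "b = i" "c = i"
      using that a simple_graphD(3)[OF simple_graph_jfg, of c a] by blast+
    then show False using that simple_graph_jfg by (auto simp: simple_graph_def)
  qed
  show ?thesis using *[of i j k] *[of j k i] *[of k i j] assms by blast
qed

lemma tri_zero:
  assumes "q \<noteq> 3"
  shows "tri n J = 0"
proof -
  have none: "\<not> (J i j \<and> J j k \<and> J k i)" for i j k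
  proof
    assume t: "J i j \<and> J j k \<and> J k i"
    then have l: "i < q" "j < q" "k < q" using tri_core by blast+
    \<comment> \<open>The jump of the vertex number on the edge that closes the cycle.\<close>
    define Q where "Q = real q - 1"
    have Q: "Q \<ge> 3" using q assms by (simp add: Q_def)
    have nxt_diff: "real (nxt a) - real a = 1 \<or> real (nxt a) - real a = - Q" for a
    proof (cases "Suc a = q")
      case True
      then have "real q = real a + 1" by linarith
      then show ?thesis using True by (simp add: nxt_def Q_def)
    qed (simp add: nxt_def)
    have step: "real b - real a \<in> {1, -1, Q, - Q}" if "a < q" "b < q" "J a b" for a b
    proof -
      consider "b = nxt a" | "a = nxt b" 
        using \<open>J a b\<close> edge0_core[OF \<open>a < q\<close>, of b] edge0_core[OF \<open>b < q\<close>, of a]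
        unfolding jfg_E_def by blast
      then show ?thesis
      proof cases
        case 1
        show ?thesis unfolding 1 using nxt_diff[of a] by blast
      next
        case 2
        have "real b - real (nxt b) = -1 \<or> real b - real (nxt b) = Q" using nxt_diff[of b] by linarith
        then show ?thesis unfolding 2 by blast
      qed
    qed
    have J: "J i j" "J j k" "J k i" using t by blast+
    show False
      by (rule notE[OF three_steps_nonzero[OF step[OF l(1,2) J(1)] step[OF l(2,3) J(2)] step[OF l(3,1) J(3)] Q]
          cyclic_differences])
  qed
  have "adj J i j * adj J j k * adj J k i = 0" for i j k
    using none[of i j k] unfolding adj_def by (cases "J i j"; cases "J j k"; cases "J k i"; simp)
  then show ?thesis unfolding tri_def by (simp only: sum.neutral_const)
qed

lemma tri_triangle_le:
  assumes "q = 3"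
  shows "tri n J \<le> 6"
proof -
  let ?t = "\<lambda>i j k. adj J i j * adj J j k * adj J k i"
  have z: "?t i j k = 0" if "\<not> (i < q \<and> j < q \<and> k < q)" for i j k
    using that tri_core[of i j k] by (auto simp: adj_def)
  have le: "?t i j k \<le> (if i \<noteq> j \<and> j \<noteq> k \<and> k \<noteq> i then 1 else 0)" for i j k
    using simple_graphD(4)[OF simple_graph_jfg] by (auto simp: adj_def)
  have sub: "{..<q} \<subseteq> {..<n}" by (auto simp: jfg_n_def)
  have "tri n J = (\<Sum>i<q. \<Sum>j<n. \<Sum>k<n. ?t i j k)"
    unfolding tri_def by (rule sum.mono_neutral_right) (use sub z in \<open>auto intro!: sum.neutral\<close>)
  also have "\<dots> = (\<Sum>i<q. \<Sum>j<q. \<Sum>k<n. ?t i j k)"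
    by (intro sum.cong refl sum.mono_neutral_right) (use sub z in \<open>auto intro!: sum.neutral\<close>)
  also have "\<dots> = (\<Sum>i<q. \<Sum>j<q. \<Sum>k<q. ?t i j k)"
    by (intro sum.cong refl sum.mono_neutral_right) (use sub z in \<open>auto intro!: sum.neutral\<close>)
  also have "\<dots> \<le> (\<Sum>i<q. \<Sum>j<q. \<Sum>k<q. (if i \<noteq> j \<and> j \<noteq> k \<and> k \<noteq> i then 1 else 0))"
    by (intro sum_mono le)
  also have "\<dots> = 6" using assms by (simp add: eval_nat_numeral)
  finally show ?thesis .
qed

end

section \<open>Transfer to the mate: eigenvectors, eigenvalue counts, degree identities\<close>

locale jellyfish_mate = jellyfish p q + Q_isospectral "jfg_n p q" F "jfg_E p q" W
  for p q :: nat and F :: "nat \<Rightarrow> nat \<Rightarrow> bool" and W :: "nat \<Rightarrow> nat \<Rightarrow> real"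
begin

abbreviation deg :: "nat \<Rightarrow> nat" where "deg \<equiv> vdeg n F"

lemma n_eq: "n = q + q * p" by (simp add: jfg_n_def)

lemma F_lt: "F i j \<Longrightarrow> i < n" "F i j \<Longrightarrow> j < n" using simple_graphD[OF F] by blast+

lemma F_sym: "F i j \<Longrightarrow> F j i" using simple_graphD[OF F] by blast

lemma F_irrefl: "\<not> F i i" using simple_graphD[OF F] by blast

lemma adj_F_sym: "adj F i j = adj F j i" by (rule adj_sym[OF F])

lemma adj_F_irrefl: "adj F i i = 0" using F_irrefl by (simp add: adj_def)

lemma deg_sum: "real (deg i) = (\<Sum>j<n. adj F i j)" by (rule vdeg_sum)

lemma deg_card: "deg i = card {j. F i j}"
  using F_lt by (auto simp: vdeg_def intro!: arg_cong[of _ _ card])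

lemma finite_nbrs: "finite {j. F i j}"
  by (rule finite_subset[of _ "{..<n}"]) (use F_lt in auto)

lemma qform_le: "qform n F x \<le> \<mu> * sq n x"
  using qform_jfg_le[of "T x"] by (simp add: T_qform T_sq)

lemma top_T: "qform n F x = \<mu> * sq n x \<Longrightarrow> qform n J (T x) = \<mu> * sq n (T x)"
  by (simp add: T_qform T_sq)

lemma top_eigenvector:
  assumes "qform n F x = \<mu> * sq n x" and "v < n"
  shows "qop n F x v = \<mu> * x v"
proof -
  let ?y = "\<lambda>i. qop n F x i - \<mu> * x i"
  have "T ?y i = 0" if "i < n" for i
    using T_qop[OF that, of x] qop_top[OF top_T[OF assms(1)] that]
    by (simp add: T_diff T_scale)
  from T_eq_0[of ?y, OF this assms(2)] show ?thesis by simp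
qed

text \<open>The combination of \<open>x\<close> and \<open>y\<close> whose image vanishes at vertex
  \<open>0\<close> has zero image, because images of top vectors are determined by that
  coordinate.\<close>

lemma top_proportional:
  assumes "qform n F x = \<mu> * sq n x" and "qform n F y = \<mu> * sq n y" and "v < n"
  shows "T y 0 * x v = T x 0 * y v"
proof -
  let ?z = "\<lambda>i. T y 0 * x i - T x 0 * y i"
  note X = qform_jfg_top[OF top_T[OF assms(1)]] and Y = qform_jfg_top[OF top_T[OF assms(2)]]
  have "T ?z i = 0" if "i < n" for i
  proof -
    have "T ?z i = T y 0 * T x i - T x 0 * T y i" by (simp add: T_diff T_scale)
    also have "\<dots> = 0" using that
    proof (cases rule: vertex_cases)
      case 1
      show ?thesis unfolding X(1)[OF 1] Y(1)[OF 1] by simp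
    next
      case (2 j k)
      show ?thesis unfolding 2(3) X(2)[OF 2(1,2)] Y(2)[OF 2(1,2)] by simp
    qed
    finally show ?thesis .
  qed
  from T_eq_0[of ?z, OF this assms(3)] show ?thesis by simp
qed

lemma top_nonzero:
  assumes "qform n F x = \<mu> * sq n x" and "v < n" and "x v \<noteq> 0"
  shows "T x 0 \<noteq> 0"
proof
  assume z: "T x 0 = 0"
  note X = qform_jfg_top[OF top_T[OF assms(1)]]
  have "T x i = 0" if "i < n" for i
    using that
  proof (cases rule: vertex_cases)
    case 1
    show ?thesis unfolding X(1)[OF 1] by (rule z)
  next
    case (2 j k)
    show ?thesis unfolding 2(3) X(2)[OF 2(1,2)] z by simp
  qed
  from T_eq_0[OF this assms(2)] assms(3) show False by simp
qed

lemma kernel_zero: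
  assumes "qform n F x = 0" and "T x 0 = 0" and "v < n"
  shows "x v = 0"
proof (rule T_eq_0[OF _ assms(3)])
  fix i assume "i < n"
  then show "T x i = 0" using jfg_kernel_zero[of "T x" i] assms by (simp add: T_qform)
qed

text \<open>The listed values make \<open>x\<close> and \<open>y\<close> linearly independent, and
  the same cancellation at vertex \<open>0\<close> as for top vectors applies.\<close>

lemma kernel_unique:
  assumes x: "qform n F x = 0" and y: "qform n F y = 0" and "i < n" "w < n"
    and "x i \<noteq> 0" "x w = 0" "y w \<noteq> 0"
  shows False
proof -
  let ?z = "\<lambda>v. T y 0 * x v - T x 0 * y v"
  have e: "F a b \<Longrightarrow> x a + x b = 0" "F a b \<Longrightarrow> y a + y b = 0" for a b
    using x y qform_eq_0_iff[OF F] by blast+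
  have "qform n F ?z = 0"
  proof (subst qform_eq_0_iff[OF F], intro allI impI)
    fix a b assume "F a b"
    have "?z a + ?z b = T y 0 * (x a + x b) - T x 0 * (y a + y b)" by (simp add: algebra_simps)
    then show "?z a + ?z b = 0" using e[OF \<open>F a b\<close>] by simp
  qed
  moreover have "T ?z 0 = 0" by (simp add: T_diff T_scale)
  ultimately have "?z w = 0" by (rule kernel_zero[OF _ _ \<open>w < n\<close>])
  then have "T x 0 = 0" using assms by simp
  from kernel_zero[OF x this \<open>i < n\<close>] assms show False by simp
qed

lemma kernel_trivial_triangle:
  assumes "q = 3" and "qform n F x = 0" and "v < n"
  shows "x v = 0"
  using kernel_zero[OF assms(2) _ assms(3)] jfg_kernel_trivial_triangle[OF assms(1), of "T x"] assms(2)
  by (simp add: T_qform)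

text \<open>Vanishing of the image on the cycle costs \<open>q\<close> equations. The form of the
  family is left free through \<open>G\<close>, and \<open>Dx\<close> reserves room for further
  conditions on the coefficients.\<close>

lemma count_above_one:
  fixes G :: "nat \<Rightarrow> 'i \<Rightarrow> real" and D :: "'d \<Rightarrow> 'i \<Rightarrow> real"
  assumes "finite I" "finite Dx" "q + card Dx < card I"
  obtains a where "\<exists>j\<in>I. a j \<noteq> 0" and "\<And>j. j \<notin> I \<Longrightarrow> a j = 0"
    and "qform n F (\<lambda>i. \<Sum>j\<in>I. G i j * a j) \<le> sq n (\<lambda>i. \<Sum>j\<in>I. G i j * a j)"
    and "\<And>d. d \<in> Dx \<Longrightarrow> (\<Sum>j\<in>I. D d j * a j) = 0"
proof -
  let ?L = "\<lambda>k i :: nat. of_bool (i = k) :: real"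
  obtain a where a: "\<exists>j\<in>I. a j \<noteq> 0" "\<And>j. j \<notin> I \<Longrightarrow> a j = 0"
    and L: "\<And>k. k \<in> {..<q} \<Longrightarrow> (\<Sum>i<n. ?L k i * T (\<lambda>i. \<Sum>j\<in>I. G i j * a j) i) = 0"
    and D: "\<And>d. d \<in> Dx \<Longrightarrow> (\<Sum>j\<in>I. D d j * a j) = 0"
    using common_vector[OF assms(1) finite_lessThan assms(2), of q ?L G D] assms(3) by auto
  let ?x = "\<lambda>i. \<Sum>j\<in>I. G i j * a j"
  have "T ?x k = 0" if "k < q" for k
    using L[of k] that by (simp add: n_eq of_bool_def if_distrib[of "\<lambda>c. c * _"] sum.delta cong: if_cong)
  then have "qform n J (T ?x) \<le> sq n (T ?x)" by (rule qform_le_sq_if_core_zero)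
  then show ?thesis using that a D by (simp add: T_qform T_sq)
qed

lemma sum_leaf_equation:
  fixes f :: "nat \<Rightarrow> real"
  assumes "l < n" "k < n"
  shows "(\<Sum>i<n. (of_bool (i = l) + 4 * of_bool (i = k)) * f i) = f l + 4 * f k"
proof -
  have "(\<Sum>i<n. (of_bool (i = l) + 4 * of_bool (i = k)) * f i) =
      (\<Sum>i<n. (if i = l then f i else 0) + (if i = k then 4 * f i else 0))"
    by (intro sum.cong) auto
  also have "\<dots> = f l + 4 * f k" using assms by (simp add: sum.distrib sum.delta)
  finally show ?thesis .
qed

text \<open>The \<open>p * q\<close> equations require each leaf value of the image to be
  \<open>- 4\<close> times its centre value. The strict inequality is conditional because
  \<open>G\<close> may send nonzero coefficients to the zero vector.\<close>

lemma count_at_least_one: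
  fixes G :: "nat \<Rightarrow> 'i \<Rightarrow> real" and D :: "'d \<Rightarrow> 'i \<Rightarrow> real"
  assumes "finite I" "finite Dx" "p * q + card Dx < card I"
  obtains a where "\<exists>j\<in>I. a j \<noteq> 0" and "\<And>j. j \<notin> I \<Longrightarrow> a j = 0"
    and "sq n (\<lambda>i. \<Sum>j\<in>I. G i j * a j) \<noteq> 0 \<Longrightarrow>
      qform n F (\<lambda>i. \<Sum>j\<in>I. G i j * a j) < sq n (\<lambda>i. \<Sum>j\<in>I. G i j * a j)"
    and "\<And>d. d \<in> Dx \<Longrightarrow> (\<Sum>j\<in>I. D d j * a j) = 0"
proof -
  let ?K = "{..<q} \<times> {..<p}"
  let ?L = "\<lambda>s i. of_bool (i = leaf (fst s) (snd s)) + 4 * of_bool (i = fst s) :: real"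
  have "card ?K + card Dx < card I" using assms by (simp add: mult.commute)
  then obtain a where a: "\<exists>j\<in>I. a j \<noteq> 0" "\<And>j. j \<notin> I \<Longrightarrow> a j = 0"
    and L: "\<And>s. s \<in> ?K \<Longrightarrow> (\<Sum>i<n. ?L s i * T (\<lambda>i. \<Sum>j\<in>I. G i j * a j) i) = 0"
    and D: "\<And>d. d \<in> Dx \<Longrightarrow> (\<Sum>j\<in>I. D d j * a j) = 0"
    using common_vector[OF assms(1) _ assms(2), of ?K ?L G D] by auto
  let ?x = "\<lambda>i. \<Sum>j\<in>I. G i j * a j"
  have "T ?x (leaf i k) = - 4 * T ?x i" if "i < q" "k < p" for i k
  proof -
    have "i < n" using that by (simp add: n_eq)
    have "(i, k) \<in> ?K" using that by simp
    from L[of "(i, k)", OF this] sum_leaf_equation[OF leaf_lt[OF that] \<open>i < n\<close>, where f = "T ?x"]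
    show ?thesis unfolding fst_conv snd_conv by linarith
  qed
  from qform_less_sq[of "T ?x", OF this] have "sq n (T ?x) \<noteq> 0 \<Longrightarrow> qform n J (T ?x) < sq n (T ?x)" .
  then show ?thesis using that a D by (simp add: T_qform T_sq)
qed

text \<open>For \<open>p = 1\<close> there is one leaf per centre, so the conditions relating leaf
  and centre values number only \<open>q\<close>.\<close>

lemma count_above_four_fifths:
  fixes G :: "nat \<Rightarrow> 'i \<Rightarrow> real" and D :: "'d \<Rightarrow> 'i \<Rightarrow> real"
  assumes "p = 1" and "finite I" "finite Dx" "q + card Dx < card I"
  obtains a where "\<exists>j\<in>I. a j \<noteq> 0" and "\<And>j. j \<notin> I \<Longrightarrow> a j = 0"
    and "qform n F (\<lambda>i. \<Sum>j\<in>I. G i j * a j) \<le> 4 / 5 * sq n (\<lambda>i. \<Sum>j\<in>I. G i j * a j)"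
    and "\<And>d. d \<in> Dx \<Longrightarrow> (\<Sum>j\<in>I. D d j * a j) = 0"
proof -
  let ?L = "\<lambda>k i. of_bool (i = leaf k 0) + 4 * of_bool (i = k) :: real"
  obtain a where a: "\<exists>j\<in>I. a j \<noteq> 0" "\<And>j. j \<notin> I \<Longrightarrow> a j = 0"
    and L: "\<And>k. k \<in> {..<q} \<Longrightarrow> (\<Sum>i<n. ?L k i * T (\<lambda>i. \<Sum>j\<in>I. G i j * a j) i) = 0"
    and D: "\<And>d. d \<in> Dx \<Longrightarrow> (\<Sum>j\<in>I. D d j * a j) = 0"
    using common_vector[OF assms(2) finite_lessThan assms(3), of q ?L G D] assms(4) by auto
  let ?x = "\<lambda>i. \<Sum>j\<in>I. G i j * a j"
  have "T ?x (leaf i 0) = - 4 * T ?x i" if "i < q" for i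
  proof -
    have i: "i < n" and l: "leaf i 0 < n" using that leaf_lt[of i 0] p by (simp_all add: n_eq)
    have "i \<in> {..<q}" using that by simp
    from L[of i, OF this] sum_leaf_equation[OF l i, where f = "T ?x"] show ?thesis by linarith
  qed
  from qform_le_four_fifths[of "T ?x", OF assms(1) this] have "qform n J (T ?x) \<le> 4 / 5 * sq n (T ?x)" .
  then show ?thesis using that a D by (simp add: T_qform T_sq)
qed

lemma no_eigenvalue_one_mate:
  assumes "p = 1" and ev: "\<And>v. v < n \<Longrightarrow> qop n F x v = x v" and "v < n"
  shows "x v = 0"
proof (rule T_eq_0[OF _ assms(3)])
  fix i assume i: "i < n"
  have "T (qop n F x) w = T x w" for w
    unfolding T_def using ev by (intro sum.cong) auto
  then have "qop n J (T x) w = T x w" if "w < n" for w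
    using T_qop[OF that, of x] by simp
  from no_eigenvalue_one[OF assms(1) this i] show "T x i = 0" .
qed

text \<open>The polynomials vanish at \<open>1\<close> and \<open>p + 2\<close>, the only degrees of
  the jellyfish graph, so its side of the trace identities leaves nothing but the triangle count.
  The first sum expresses that there are as many edges as vertices.\<close>

lemma degree_moments:
  shows "(\<Sum>i<n. real (deg i)) = 2 * real n"
    and "(\<Sum>i<n. (real (deg i) - 1) * (real (deg i) - real p - 2)) = 0"
    and "(\<Sum>i<n. real (deg i) * (real (deg i) - 1) * (real (deg i) - real p - 2)) = tri n J - tri n F"
proof -
  let ?d = "\<lambda>i. real (deg i)" and ?e = "\<lambda>i. real (vdeg n J i)"
  note tr = trace_powers[unfolded trace_qent[OF F] trace_qent[OF E]]
  have Jsum: "(\<Sum>i<n. g (?e i)) = real q * g (real p + 2) + real q * real p * g 1" for g :: "real \<Rightarrow> real"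
    unfolding sum_vertices by (simp add: vdeg_core vdeg_leaf)
  have rn: "real n = real q + real q * real p" by (simp add: n_eq)
  have s1: "(\<Sum>i<n. ?d i) = real q * (real p + 2) + real q * real p"
    using tr(1) Jsum[of "\<lambda>x. x"] by simp
  have s2: "(\<Sum>i<n. (?d i)\<^sup>2) = real q * (real p + 2)\<^sup>2 + real q * real p"
    using tr(1,2) Jsum[of "\<lambda>x. x\<^sup>2"] by simp
  have s3: "(\<Sum>i<n. (?d i)^3) = real q * (real p + 2)^3 + real q * real p + tri n J - tri n F"
    using tr(3) Jsum[of "\<lambda>x. x^3"] Jsum[of "\<lambda>x. x\<^sup>2"] s2 by (simp add: algebra_simps)
  show "(\<Sum>i<n. ?d i) = 2 * real n" unfolding s1 rn by (simp add: algebra_simps)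
  have "(\<Sum>i<n. (?d i - 1) * (?d i - real p - 2)) =
      (\<Sum>i<n. (?d i)\<^sup>2 - (real p + 3) * ?d i + (real p + 2))"
    by (intro sum.cong refl) (simp add: power2_eq_square algebra_simps)
  also have "\<dots> = (\<Sum>i<n. (?d i)\<^sup>2) - (real p + 3) * (\<Sum>i<n. ?d i) + (real p + 2) * real n"
    by (simp add: sum.distrib sum_subtractf sum_distrib_left)
  also have "\<dots> = 0" unfolding s1 s2 rn by (simp add: power2_eq_square algebra_simps)
  finally show "(\<Sum>i<n. (?d i - 1) * (?d i - real p - 2)) = 0" .
  have "(\<Sum>i<n. ?d i * (?d i - 1) * (?d i - real p - 2)) =
      (\<Sum>i<n. (?d i)^3 - (real p + 3) * (?d i)\<^sup>2 + (real p + 2) * ?d i)"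
    by (intro sum.cong refl) (simp add: power2_eq_square power3_eq_cube algebra_simps)
  also have "\<dots> = (\<Sum>i<n. (?d i)^3) - (real p + 3) * (\<Sum>i<n. (?d i)\<^sup>2) + (real p + 2) * (\<Sum>i<n. ?d i)"
    by (simp add: sum.distrib sum_subtractf sum_distrib_left)
  also have "\<dots> = tri n J - tri n F"
    unfolding s1 s2 s3 by (simp add: power2_eq_square power3_eq_cube algebra_simps)
  finally show "(\<Sum>i<n. ?d i * (?d i - 1) * (?d i - real p - 2)) = tri n J - tri n F" .
qed

lemma sum_sum_support:
  fixes f :: "nat \<Rightarrow> nat \<Rightarrow> real"
  assumes "S \<subseteq> {..<n}" and "\<And>i j. i \<notin> S \<or> j \<notin> S \<Longrightarrow> f i j = 0"
  shows "(\<Sum>i<n. \<Sum>j<n. f i j) = (\<Sum>i\<in>S. \<Sum>j\<in>S. f i j)"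
proof -
  have "(\<Sum>i<n. \<Sum>j<n. f i j) = (\<Sum>i<n. \<Sum>j\<in>S. f i j)"
    by (intro sum.cong refl sum.mono_neutral_right) (use assms in auto)
  also have "\<dots> = (\<Sum>i\<in>S. \<Sum>j\<in>S. f i j)"
    by (intro sum.mono_neutral_right) (use assms in \<open>auto intro!: sum.neutral\<close>)
  finally show ?thesis .
qed

lemma sum_support:
  fixes f :: "nat \<Rightarrow> real"
  assumes "S \<subseteq> {..<n}" and "\<And>i. i \<notin> S \<Longrightarrow> f i = 0"
  shows "(\<Sum>i<n. f i) = (\<Sum>i\<in>S. f i)"
  by (rule sum.mono_neutral_right) (use assms in auto)

text \<open>The star at \<open>w\<close> already gives a Rayleigh quotient of at least
  \<open>deg w + 1\<close>, while \<open>\<mu> < p + 5\<close>.\<close>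

lemma max_degree: "deg w \<le> p + 3"
proof (cases "w < n")
  case False
  then have "{j. F w j} = {}" using F_lt by auto
  then show ?thesis by (simp add: deg_card)
next
  case True
  \<comment> \<open>The top eigenvector of the star with \<open>deg w\<close> leaves, whose
    eigenvalue is \<open>deg w + 1\<close>; further edges of the graph only add squares to the
    form.\<close>
  define x where "x i = (if i = w then real (deg w) else if F w i then 1 else 0)" for i
  have N: "(\<Sum>j<n. of_bool (F w j)) = real (deg w)" by (simp add: deg_sum adj_def of_bool_def)
  have sq: "sq n x = real (deg w) * (real (deg w) + 1)"
  proof -
    have "sq n x = (\<Sum>i<n. (if i = w then (real (deg w))\<^sup>2 else 0) + adj F w i)"
      unfolding sq_def by (intro sum.cong refl) (auto simp: x_def adj_def F_irrefl)
    also have "\<dots> = (real (deg w))\<^sup>2 + real (deg w)"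
      using True by (simp add: sum.distrib sum.delta deg_sum[symmetric])
    finally show ?thesis by (simp add: power2_eq_square algebra_simps)
  qed
  have "real (deg w) * (real (deg w) + 1)\<^sup>2 \<le> qform n F x"
  proof -
    have "2 * (real (deg w) * (real (deg w) + 1)\<^sup>2) =
      (\<Sum>i<n. \<Sum>j<n. (if i = w then adj F w j * (real (deg w) + 1)\<^sup>2 else 0)
        + (if j = w then adj F w i * (real (deg w) + 1)\<^sup>2 else 0))"
    proof -
      have "(\<Sum>i<n. \<Sum>j<n. (if i = w then adj F w j * (real (deg w) + 1)\<^sup>2 else 0)) =
        (\<Sum>i<n. if i = w then \<Sum>j<n. adj F w j * (real (deg w) + 1)\<^sup>2 else 0)"
        by (intro sum.cong) auto
      moreover have "\<dots> = real (deg w) * (real (deg w) + 1)\<^sup>2"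
        using True by (simp add: sum.delta sum_distrib_right[symmetric] deg_sum[symmetric])
      moreover have "(\<Sum>i<n. \<Sum>j<n. (if j = w then adj F w i * (real (deg w) + 1)\<^sup>2 else 0)) =
        real (deg w) * (real (deg w) + 1)\<^sup>2"
        using True by (simp add: sum.delta sum_distrib_right[symmetric] deg_sum[symmetric])
      ultimately show ?thesis by (simp add: sum.distrib)
    qed
    also have "\<dots> \<le> (\<Sum>i<n. \<Sum>j<n. adj F i j * (x i + x j)\<^sup>2)"
    proof (intro sum_mono)
      fix i j
      show "(if i = w then adj F w j * (real (deg w) + 1)\<^sup>2 else 0)
        + (if j = w then adj F w i * (real (deg w) + 1)\<^sup>2 else 0) \<le> adj F i j * (x i + x j)\<^sup>2"
      proof (cases "i = w")
        case True
        then show ?thesis by (cases "j = w") (simp_all add: F_irrefl x_def adj_def)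
      next
        case False
        then show ?thesis
        proof (cases "j = w")
          case True
          show ?thesis
            unfolding True adj_F_sym[of i w] using False
            by (cases "F w i") (simp_all add: x_def adj_def add.commute[of 1])
        qed (simp add: adj_def)
      qed
    qed
    also have "\<dots> = 2 * qform n F x" by (simp add: qform_edges[OF F])
    finally show ?thesis by simp
  qed
  also have "\<dots> \<le> \<mu> * (real (deg w) * (real (deg w) + 1))"
    using qform_le[of x] sq by simp
  finally have "real (deg w) * (real (deg w) + 1) * (real (deg w) + 1) \<le>
      real (deg w) * (real (deg w) + 1) * \<mu>" by (simp add: power2_eq_square algebra_simps)
  then have le: "real (deg w) + 1 \<le> \<mu>" if "real (deg w) * (real (deg w) + 1) > 0"
    by (rule mult_left_le_imp_le[OF _ that])
  show ?thesis
  proof (cases "deg w = 0")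
    case False
    then have "real (deg w) * (real (deg w) + 1) > 0" by simp
    from le[OF this] lam_bounds(2)[OF p] show ?thesis by linarith
  qed simp
qed

definition Iso :: "nat set" where "Iso = {v. v < n \<and> deg v = 0}"
definition Pend :: "nat set" where "Pend = {v. v < n \<and> deg v = 1}"
definition Core :: "nat set" where "Core = {v. v < n \<and> 2 \<le> deg v}"

lemma class_finite: "finite Iso" "finite Pend" "finite Core"
  by (simp_all add: Iso_def Pend_def Core_def)

lemma sum_classes:
  "(\<Sum>i<n. f i) = (\<Sum>i\<in>Iso. f i) + (\<Sum>i\<in>Pend. f i) + (\<Sum>i\<in>Core. f i)" for f :: "nat \<Rightarrow> real"
proof -
  have "{..<n} = Iso \<union> Pend \<union> Core" by (auto simp: Iso_def Pend_def Core_def)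
  moreover have "Iso \<inter> Pend = {}" "(Iso \<union> Pend) \<inter> Core = {}"
    by (auto simp: Iso_def Pend_def Core_def)
  ultimately show ?thesis by (simp add: sum.union_disjoint class_finite)
qed

lemma isolated_kernel:
  assumes "v \<in> Iso"
  shows "qform n F (\<lambda>i. of_bool (i = v)) = 0"
proof (subst qform_eq_0_iff[OF F], intro allI impI)
  fix a b assume ab: "F a b"
  have "{j. F v j} = {}" using assms finite_nbrs[of v] by (simp add: Iso_def deg_card)
  then have "a \<noteq> v" "b \<noteq> v" using ab F_sym by auto
  then show "of_bool (a = v) + of_bool (b = v) = (0::real)" by simp
qed

lemma isolated_unique:
  assumes "v \<in> Iso" "w \<in> Iso"
  shows "v = w"
proof (rule ccontr)
  assume "v \<noteq> w"
  then show False
    using kernel_unique[OF isolated_kernel[OF assms(1)] isolated_kernel[OF assms(2)], of v w] assms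
    by (simp add: Iso_def)
qed

text \<open>An isolated vertex uses up the only kernel direction, so no other component can be
  bipartite. This excludes single edges and trees below.\<close>

lemma isolated_excludes_kernel:
  assumes "v \<in> Iso" and "qform n F y = 0" and "w < n" and "w \<noteq> v"
  shows "y w = 0"
proof (rule ccontr)
  assume "y w \<noteq> 0"
  then show False
    using kernel_unique[OF isolated_kernel[OF assms(1)] assms(2), of v w] assms by (simp add: Iso_def)
qed

lemma pendant_nbr:
  assumes "v \<in> Pend"
  obtains u where "F v u" "\<And>w. F v w \<longleftrightarrow> w = u"
proof -
  have "card {j. F v j} = 1" using assms by (simp add: Pend_def deg_card)
  then obtain u where "{j. F v j} = {u}" by (rule card_1_singletonE)
  then show ?thesis using that[of u] by auto
qed

end

section \<open>Connected two-regular graphs\<close>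

text \<open>A walk that never turns back must revisit a vertex, and by two-regularity the first one
  revisited is its start; the closed walk is then closed under adjacency. Connectedness is assumed
  as the absence of proper nonempty closed subsets, the form in which simplicity of
  \<open>\<mu>\<close> provides it.\<close>

lemma two_regular_connected_is_cycle:
  fixes R :: "'a \<Rightarrow> 'a \<Rightarrow> bool"
  assumes fin: "finite B" and ne: "B \<noteq> {}"
    and sym: "\<And>u w. R u w \<Longrightarrow> R w u" and irr: "\<And>u. \<not> R u u"
    and two: "\<And>u. u \<in> B \<Longrightarrow> card {w \<in> B. R u w} = 2"
    and conn: "\<And>S. S \<subseteq> B \<Longrightarrow> S \<noteq> {} \<Longrightarrow> (\<And>u w. u \<in> S \<Longrightarrow> w \<in> B \<Longrightarrow> R u w \<Longrightarrow> w \<in> S) \<Longrightarrow> S = B"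
  obtains s where "bij_betw s {..<card B} B"
    and "\<And>i. 0 < i \<Longrightarrow> i < card B \<Longrightarrow>
      {w \<in> B. R (s i) w} = {s (i - 1), s (if Suc i = card B then 0 else Suc i)}"
    and "{w \<in> B. R (s 0) w} = {s (card B - 1), s (if Suc 0 = card B then 0 else Suc 0)}"
proof -
  define nb where "nb u = {w \<in> B. R u w}" for u
  have other: "\<exists>w. nb u = {v, w} \<and> w \<noteq> v" if "u \<in> B" "v \<in> nb u" for u v
  proof -
    have "card (nb u) = 2" using two[OF that(1)] by (simp add: nb_def)
    then obtain x y where xy: "nb u = {x, y}" "x \<noteq> y" by (auto simp: card_2_iff)
    show ?thesis
    proof (cases "v = x")
      case True then show ?thesis using xy by auto
    next
      case False then show ?thesis using xy that by auto
    qed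
  qed
  \<comment> \<open>The state is a directed edge: the walk leaves its head towards the neighbour
    different from the tail.\<close>
  define step where "step e = (snd e, SOME w. nb (snd e) = {fst e, w} \<and> w \<noteq> fst e)" for e
  obtain b0 where b0: "b0 \<in> B" using ne by blast
  have "card (nb b0) = 2" using two[OF b0] by (simp add: nb_def)
  then have "nb b0 \<noteq> {}" by auto
  then obtain b1 where b1: "b1 \<in> nb b0" by blast
  define st where "st k = (step ^^ k) (b0, b1)" for k
  define s where "s k = fst (st k)" for k
  have snd_st: "snd (st k) = s (Suc k)" for k by (simp add: s_def st_def step_def)
  have ind: "s k \<in> B \<and> s (Suc k) \<in> nb (s k)" for k
  proof (induction k)
    case 0
    then show ?case using b0 b1 snd_st[of 0] by (simp add: s_def st_def)
  next
    case (Suc k)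
    then have 1: "s (Suc k) \<in> B" "R (s k) (s (Suc k))" by (auto simp: nb_def)
    then have "s k \<in> nb (s (Suc k))" using Suc sym by (auto simp: nb_def)
    from someI_ex[OF other[OF 1(1) this]] have "nb (s (Suc k)) = {s k, s (Suc (Suc k))}"
      unfolding snd_st[symmetric] by (simp add: st_def step_def s_def)
    then show ?case using 1 by auto
  qed
  have step: "nb (s (Suc k)) = {s k, s (Suc (Suc k))} \<and> s (Suc (Suc k)) \<noteq> s k" for k
  proof -
    have 1: "s (Suc k) \<in> B" "R (s k) (s (Suc k))" "s k \<in> B" using ind[of k] by (auto simp: nb_def)
    then have "s k \<in> nb (s (Suc k))" using sym by (auto simp: nb_def)
    from someI_ex[OF other[OF 1(1) this]] show ?thesis
      unfolding snd_st[symmetric] by (simp add: st_def step_def s_def)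
  qed
  have sB: "s k \<in> B" for k using ind by blast
  have sR: "R (s k) (s (Suc k))" for k using ind[of k] by (simp add: nb_def)
  have sR': "s k \<in> nb (s (Suc k))" for k using sR[of k] sB sym by (auto simp: nb_def)
  have "\<not> inj s" using fin sB by (meson finite_imageD finite_subset image_subsetI infinite_UNIV_nat)
  then obtain x y where "s x = s y" "x < y" by (metis injI linorder_neqE_nat)
  then have ex: "\<exists>k. s k \<in> s ` {..<k}" by (intro exI[of _ y]) (metis imageI lessThan_iff)
  \<comment> \<open>The first time at which the walk meets a vertex again.\<close>
  define m where "m = (LEAST k. s k \<in> s ` {..<k})"
  have m: "s m \<in> s ` {..<m}" unfolding m_def by (rule LeastI_ex[OF ex])
  have fresh: "s k \<notin> s ` {..<k}" if "k < m" for k using that not_less_Least unfolding m_def by blast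
  have inj: "inj_on s {..<m}"
  proof (rule inj_onI)
    fix x y assume xy: "x \<in> {..<m}" "y \<in> {..<m}" "s x = s y"
    show "x = y"
    proof (rule ccontr)
      assume "x \<noteq> y"
      then consider "x < y" | "y < x" by linarith
      then show False
      proof cases
        case 1
        then show False using fresh[of y] imageI[of x "{..<y}" s] xy by simp
      next
        case 2
        then show False using fresh[of x] imageI[of y "{..<x}" s] xy by simp
      qed
    qed
  qed
  have injD: "x = y" if "s x = s y" "x < m" "y < m" for x y
    using inj_onD[OF inj that(1)] that by simp
  obtain i where i: "i < m" "s m = s i" using m by auto
  then obtain m' where m': "m = Suc m'" by (cases m) auto
  \<comment> \<open>At an index \<open>i > 0\<close> both neighbours of \<open>s i\<close> are
    already \<open>s (i - 1)\<close> and \<open>s (i + 1)\<close>, so the new predecessor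
    \<open>s m'\<close> would contradict injectivity or the rule of not turning back.\<close>
  have i0: "i = 0"
  proof (rule ccontr)
    assume "i \<noteq> 0"
    then obtain j where j: "i = Suc j" by (cases i) auto
    have "s m' \<in> nb (s i)" using sR'[of m'] i m' by simp
    then have "s m' = s j \<or> s m' = s (Suc i)" using step[of j] j by simp
    then show False
    proof
      assume "s m' = s j"
      then show False using injD[of m' j] i j m' by simp
    next
      assume e: "s m' = s (Suc i)"
      show False
      proof (cases "Suc i = m")
        case True
        then show False using e irr sR[of i] m' by simp
      next
        case False
        then have "m' = Suc i" using injD[OF e] i m' by simp
        then show False using step[of i] i m' by simp
      qed
    qed
  qed
  have m3: "m \<ge> 3"
  proof (rule ccontr)
    assume "\<not> m \<ge> 3"
    then have "m = 1 \<or> m = 2" using i by linarith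
    then show False
    proof
      assume "m = 1"
      then show False using i i0 sR[of 0] irr by simp
    next
      assume "m = 2"
      then show False using i i0 step[of 0] by (simp add: numeral_2_eq_2)
    qed
  qed
  have nb0: "nb (s 0) = {s m', s 1}"
  proof -
    have "s m' \<in> nb (s 0)" using sR'[of m'] i i0 m' by simp
    moreover have "s 1 \<in> nb (s 0)" using ind[of 0] by simp
    moreover have "s m' \<noteq> s 1" using injD[of m' 1] m3 m' by auto
    moreover have "card (nb (s 0)) = 2" using two[OF sB] by (simp add: nb_def)
    ultimately show ?thesis by (auto simp: card_2_iff)
  qed
  have clos: "w \<in> s ` {..<m}" if "u \<in> s ` {..<m}" "w \<in> B" "R u w" for u w
  proof -
    have "\<exists>k. k < m \<and> u = s k" using that(1) by blast
    then obtain k where k: "k < m" "u = s k" by blast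
    have w: "w \<in> nb (s k)" using that k by (simp add: nb_def)
    show ?thesis
    proof (cases k)
      case 0
      then show ?thesis using w nb0 m3 m' by auto
    next
      case (Suc l)
      then have "w = s l \<or> w = s (Suc k)" using w step[of l] by simp
      then show ?thesis
      proof
        assume "w = s (Suc k)"
        then show ?thesis using k i i0 Suc by (cases "Suc k = m") auto
      qed (use k Suc in auto)
    qed
  qed
  have img: "s ` {..<m} = B"
    by (rule conn) (use sB clos m3 in \<open>auto simp: lessThan_empty_iff\<close>)
  then have card: "card B = m" using card_image[OF inj] by simp
  show ?thesis
  proof (rule that[of s])
    show "bij_betw s {..<card B} B" unfolding card bij_betw_def using inj img by simp
    show "{w \<in> B. R (s k) w} = {s (k - 1), s (if Suc k = card B then 0 else Suc k)}"
      if k: "0 < k" "k < card B" for k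
    proof -
      obtain l where l: "k = Suc l" using k by (cases k) auto
      have "s (if Suc k = card B then 0 else Suc k) = s (Suc k)" using i i0 card by auto
      then show ?thesis using step[of l] l by (simp add: nb_def)
    qed
    show "{w \<in> B. R (s 0) w} = {s (card B - 1), s (if Suc 0 = card B then 0 else Suc 0)}"
      using nb0 card m' m3 by (simp add: nb_def)
  qed
qed

section \<open>The mate without isolated vertices\<close>

context jellyfish_mate
begin

lemma no_triangle:
  assumes "tri n F = 0"
  shows "\<not> (F i j \<and> F j k \<and> F k i)"
proof
  assume t: "F i j \<and> F j k \<and> F k i"
  let ?f = "\<lambda>i j k. adj F i j * adj F j k * adj F k i"
  have nn: "0 \<le> ?f i j k" for i j k by (simp add: adj_def)
  have nn2: "0 \<le> (\<Sum>k<n. ?f i j k)" for i j by (intro sum_nonneg nn)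
  have nn3: "0 \<le> (\<Sum>j<n. \<Sum>k<n. ?f i j k)" for i by (intro sum_nonneg nn)
  have lt: "i < n" "j < n" "k < n" using t F_lt by blast+
  have "1 = ?f i j k" using t by (simp add: adj_def)
  also have "\<dots> \<le> (\<Sum>k<n. ?f i j k)" by (rule member_le_sum) (use nn lt in auto)
  also have "\<dots> \<le> (\<Sum>j<n. \<Sum>k<n. ?f i j k)"
    by (rule member_le_sum[of j "{..<n}" "\<lambda>j. \<Sum>k<n. ?f i j k"]) (use nn2 lt in auto)
  also have "\<dots> \<le> (\<Sum>i<n. \<Sum>j<n. \<Sum>k<n. ?f i j k)"
    by (rule member_le_sum[of i "{..<n}" "\<lambda>i. \<Sum>j<n. \<Sum>k<n. ?f i j k"]) (use nn3 lt in auto)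
  finally show False using assms by (simp add: tri_def)
qed

text \<open>The last two factors are consecutive integers. The cubic is the combination of the
  degree identities that vanishes at \<open>1\<close>, \<open>p + 1\<close> and \<open>p + 2\<close>
  and so detects degree \<open>p + 3\<close>.\<close>

lemma degree_cubic_nonneg:
  fixes d :: nat
  assumes "1 \<le> d"
  shows "0 \<le> (real d - 1) * (real d - real p - 1) * (real d - real p - 2)"
proof -
  consider "d \<le> p" | "d = p + 1" | "d \<ge> p + 2" by linarith
  then show ?thesis
  proof cases
    case 1
    then have "real d - real p - 1 \<le> 0" "real d - real p - 2 \<le> 0" "0 \<le> real d - 1" using assms by auto
    then show ?thesis by (simp add: mult.assoc mult_nonpos_nonpos)
  next
    case 3
    then have "0 \<le> real d - real p - 2" by linarith
    then show ?thesis using assms by simp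
  qed simp
qed

text \<open>The cubic sums to \<open>tri n J - tri n F\<close> and is \<open>2 * (p + 2)\<close> at
  degree \<open>p + 3\<close>. Hence the jellyfish has a triangle, \<open>q = 3\<close> and
  \<open>p = 1\<close>, and the mate is triangle-free. With six vertices, one of degree four, it is
  bipartite, whereas the kernel is trivial for \<open>q = 3\<close>.\<close>

lemma top_degree_excluded:
  assumes iso: "Iso = {}" and w: "w < n"
  shows "deg w \<noteq> p + 3"
proof
  assume dw: "deg w = p + 3"
  have d1: "1 \<le> deg v" if "v < n" for v
    using iso that by (auto simp: Iso_def)
  let ?f = "\<lambda>v. (real (deg v) - 1) * (real (deg v) - real p - 1) * (real (deg v) - real p - 2)"
  have "?f w = 2 * (real p + 2)" by (simp add: dw algebra_simps)
  moreover have "?f w \<le> (\<Sum>v<n. ?f v)"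
    by (rule member_le_sum) (use w degree_cubic_nonneg d1 in auto)
  moreover have "(\<Sum>v<n. ?f v) = tri n J - tri n F"
  proof -
    have "(\<Sum>v<n. ?f v) = (\<Sum>v<n. real (deg v) * (real (deg v) - 1) * (real (deg v) - real p - 2)
        - (real p + 1) * ((real (deg v) - 1) * (real (deg v) - real p - 2)))"
      by (intro sum.cong refl) (simp add: algebra_simps)
    then show ?thesis by (simp add: sum_subtractf sum_distrib_left[symmetric] degree_moments)
  qed
  ultimately have le: "2 * (real p + 2) \<le> tri n J - tri n F" by linarith
  have q3: "q = 3"
  proof (rule ccontr)
    assume "q \<noteq> 3"
    have "2 * (real p + 2) \<le> - tri n F" using le by (simp only: tri_zero[OF \<open>q \<noteq> 3\<close>] diff_0)
    also have "- tri n F \<le> 0" using tri_nonneg[of n F] by simp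
    finally show False by simp
  qed
  have "2 * (real p + 2) \<le> 6" using le tri_triangle_le[OF q3] tri_nonneg[of n F] by linarith
  then have p1: "p = 1" using p by simp
  then have "6 \<le> tri n J - tri n F" using le by simp
  then have t0: "tri n F = 0" using tri_triangle_le[OF q3] tri_nonneg[of n F] by linarith
  have n6: "n = 6" using n_eq unfolding p1 q3 by simp
  let ?N = "{j. F w j}"
  have cN: "card ?N = 4" using dw deg_card[of w] p1 by linarith
  have wN: "w \<notin> ?N" using F_irrefl by simp
  have sub: "insert w ?N \<subseteq> {..<n}" using F_lt w by auto
  have "card ({..<n} - insert w ?N) = 1"
    using card_Diff_subset[OF _ sub] finite_nbrs wN cN n6 by simp
  then obtain y where y: "{..<n} - insert w ?N = {y}" by (rule card_1_singletonE)
  \<comment> \<open>The sides are the neighbours of \<open>w\<close> and the pair formed by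
    \<open>w\<close> and the one remaining vertex \<open>y\<close>.\<close>
  define x :: "nat \<Rightarrow> real" where "x v = (if F w v then -1 else 1)" for v
  have "qform n F x = 0"
  proof (subst qform_eq_0_iff[OF F], intro allI impI)
    fix a b assume ab: "F a b"
    have "\<not> (F w a \<and> F w b)" using no_triangle[OF t0, of w a b] ab F_sym by blast
    moreover have "F w a \<or> F w b"
    proof (rule ccontr)
      assume no: "\<not> (F w a \<or> F w b)"
      then have "a \<noteq> w" "b \<noteq> w" using ab F_sym by blast+
      then have "a \<in> {y}" "b \<in> {y}" unfolding y[symmetric] using no F_lt[OF ab] by auto
      then show False using ab F_irrefl by blast
    qed
    ultimately show "x a + x b = 0" by (auto simp: x_def)
  qed
  from kernel_trivial_triangle[OF q3 this w] show False by (simp add: x_def F_irrefl)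
qed

text \<open>Once all degrees lie between \<open>1\<close> and \<open>p + 2\<close>, the terms of the
  quadratic degree identity have one sign, and their sum is zero.\<close>

lemma degrees_without_isolated:
  assumes iso: "Iso = {}" and v: "v < n"
  shows "deg v = 1 \<or> deg v = p + 2"
proof -
  let ?f = "\<lambda>v. - ((real (deg v) - 1) * (real (deg v) - real p - 2))"
  have b: "1 \<le> deg v \<and> deg v \<le> p + 2" if "v < n" for v
    using iso that top_degree_excluded[OF iso that] max_degree[of v] by (force simp: Iso_def)
  have nn: "0 \<le> ?f v" if "v < n" for v
  proof -
    have "0 \<le> (real (deg v) - 1) * (real p + 2 - real (deg v))"
      using b[OF that] by (intro mult_nonneg_nonneg) linarith+
    then show ?thesis by (simp add: algebra_simps)
  qed
  have "(\<Sum>v<n. ?f v) = 0" using degree_moments(2) by (simp add: sum_negf)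
  then have "?f v = 0" using nn v by (subst (asm) sum_nonneg_eq_0_iff) auto
  then have "real (deg v) = 1 \<or> real (deg v) = real p + 2" by auto
  then show ?thesis by linarith
qed

text \<open>On a union of components the eigenvalue equation survives restriction. Together with
  \<open>top_proportional\<close> this turns simplicity of \<open>\<mu>\<close> into
  connectedness.\<close>

lemma top_restrict:
  assumes top: "qform n F x = \<mu> * sq n x" and closed: "\<And>i j. i \<in> C \<Longrightarrow> F i j \<Longrightarrow> j \<in> C"
  defines "y \<equiv> \<lambda>i. if i \<in> C then x i else 0"
  shows "qform n F y = \<mu> * sq n y"
proof -
  have "y i * qop n F y i = \<mu> * (y i)\<^sup>2" if i: "i < n" for i
  proof (cases "i \<in> C")
    case True
    have "(\<Sum>j<n. adj F i j * y j) = (\<Sum>j<n. adj F i j * x j)"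
      by (intro sum.cong refl) (use closed[OF True] in \<open>auto simp: adj_def y_def\<close>)
    then have "qop n F y i = qop n F x i" using True i by (simp add: qop_eq y_def)
    then show ?thesis using top_eigenvector[OF top i] True by (simp add: y_def power2_eq_square)
  qed (simp add: y_def)
  then show ?thesis by (simp add: qform_def sq_def sum_distrib_left)
qed

lemma iso_without_isolated:
  assumes iso: "Iso = {}"
  shows "graph_iso n F n J"
proof -
  note degs = degrees_without_isolated[OF iso]
  have "2 \<le> deg v \<longleftrightarrow> deg v = p + 2" if "v < n" for v using degs[OF that] p by auto
  then have Core: "Core = {v. v < n \<and> deg v = p + 2}" unfolding Core_def by blast
  have PC: "{..<n} = Pend \<union> Core" "Pend \<inter> Core = {}" using degs by (auto simp: Core Pend_def)
  have split: "(\<Sum>v<n. f v) = (\<Sum>v\<in>Pend. f v) + (\<Sum>v\<in>Core. f v)" for f :: "nat \<Rightarrow> real"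
    using sum_classes[of f] iso by simp
  have cards: "card Core = q" "card Pend = p * q"
  proof -
    have 1: "real n = real (card Pend) + real (card Core)" using split[of "\<lambda>_. 1"] by simp
    have 2: "2 * real n = real (card Pend) + (real p + 2) * real (card Core)"
    proof -
      have "(\<Sum>v\<in>Pend. real (deg v)) = real (card Pend)" by (simp add: Pend_def)
      moreover have "(\<Sum>v\<in>Core. real (deg v)) = (\<Sum>v\<in>Core. real p + 2)"
        by (intro sum.cong refl) (simp add: Core)
      ultimately show ?thesis using degree_moments(1) unfolding split by (simp add: mult.commute)
    qed
    have "(real p + 1) * real (card Core) = (real p + 1) * real q"
      using 1 2 by (simp add: n_eq algebra_simps)
    then have c: "card Core = q" by simp
    then show "card Core = q" .
    have "real (card Pend) = real (p * q)" using 1 by (simp add: n_eq c mult.commute)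
    then show "card Pend = p * q" by linarith
  qed
  define x where "x v = (if deg v = 1 then \<rho> else 1)" for v
  have xP: "v \<in> Pend \<Longrightarrow> x v = \<rho>" and xC: "v \<in> Core \<Longrightarrow> x v = 1" for v
    using p by (auto simp: x_def Pend_def Core)
  \<comment> \<open>Ordered adjacent pairs inside the core, from core to pendant, and inside the
    pendant set. The degree sums express the first two through \<open>\<kappa>\<close>.\<close>
  define \<beta> where "\<beta> = (\<Sum>i\<in>Core. \<Sum>j\<in>Core. adj F i j)"
  define \<gamma> where "\<gamma> = (\<Sum>i\<in>Core. \<Sum>j\<in>Pend. adj F i j)"
  define \<kappa> where "\<kappa> = (\<Sum>i\<in>Pend. \<Sum>j\<in>Pend. adj F i j)"
  have \<gamma>': "(\<Sum>i\<in>Pend. \<Sum>j\<in>Core. adj F i j) = \<gamma>"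
    unfolding \<gamma>_def by (subst sum.swap) (simp add: adj_F_sym)
  have "\<gamma> + \<beta> = (\<Sum>i\<in>Core. real (deg i))"
    unfolding deg_sum split \<beta>_def \<gamma>_def by (simp add: sum.distrib)
  also have "\<dots> = (\<Sum>i\<in>Core. real p + 2)" by (intro sum.cong refl) (simp add: Core)
  finally have e1: "\<gamma> + \<beta> = (real p + 2) * real q" by (simp add: cards(1) mult.commute)
  have "\<kappa> + \<gamma> = (\<Sum>i\<in>Pend. real (deg i))"
    unfolding deg_sum split \<gamma>'[symmetric] \<kappa>_def by (simp add: sum.distrib)
  also have "\<dots> = (\<Sum>i\<in>Pend. 1)" by (intro sum.cong refl) (simp add: Pend_def)
  finally have e2: "\<kappa> + \<gamma> = real p * real q" by (simp add: cards(2))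
  have \<kappa>0: "\<kappa> \<ge> 0" by (simp add: \<kappa>_def adj_def sum_nonneg)
  have sq: "sq n x = real p * real q * \<rho>\<^sup>2 + real q"
    unfolding sq_def split using cards by (simp add: xP xC)
  have "2 * qform n F x = 4 * \<rho>\<^sup>2 * \<kappa> + (1 + \<rho>)\<^sup>2 * \<gamma> + ((1 + \<rho>)\<^sup>2 * \<gamma> + 4 * \<beta>)"
  proof -
    have "2 * qform n F x = (\<Sum>i<n. \<Sum>j<n. adj F i j * (x i + x j)\<^sup>2)" by (simp add: qform_edges[OF F])
    also have "\<dots> = (\<Sum>i\<in>Pend. \<Sum>j\<in>Pend. adj F i j * (x i + x j)\<^sup>2) + (\<Sum>i\<in>Pend. \<Sum>j\<in>Core. adj F i j * (x i + x j)\<^sup>2)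
      + ((\<Sum>i\<in>Core. \<Sum>j\<in>Pend. adj F i j * (x i + x j)\<^sup>2) + (\<Sum>i\<in>Core. \<Sum>j\<in>Core. adj F i j * (x i + x j)\<^sup>2))"
      unfolding split sum.distrib by (simp only: add.assoc add.left_commute)
    also have "(\<Sum>i\<in>Pend. \<Sum>j\<in>Pend. adj F i j * (x i + x j)\<^sup>2) = 4 * \<rho>\<^sup>2 * \<kappa>"
      unfolding \<kappa>_def sum_distrib_left by (intro sum.cong refl) (simp add: xP power2_eq_square)
    also have "(\<Sum>i\<in>Pend. \<Sum>j\<in>Core. adj F i j * (x i + x j)\<^sup>2) = (1 + \<rho>)\<^sup>2 * \<gamma>"
      unfolding \<gamma>'[symmetric] sum_distrib_left by (intro sum.cong refl) (simp add: xP xC add.commute)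
    also have "(\<Sum>i\<in>Core. \<Sum>j\<in>Pend. adj F i j * (x i + x j)\<^sup>2) = (1 + \<rho>)\<^sup>2 * \<gamma>"
      unfolding \<gamma>_def sum_distrib_left by (intro sum.cong refl) (simp add: xP xC)
    also have "(\<Sum>i\<in>Core. \<Sum>j\<in>Core. adj F i j * (x i + x j)\<^sup>2) = 4 * \<beta>"
      unfolding \<beta>_def sum_distrib_left by (intro sum.cong refl) (simp add: xC)
    finally show ?thesis .
  qed
  moreover have "\<gamma> = real p * real q - \<kappa>" "\<beta> = 2 * real q + \<kappa>" using e1 e2 by (simp_all add: algebra_simps)
  ultimately have "qform n F x = 4 * real q + (1 + \<rho>)\<^sup>2 * (real p * real q) + \<kappa> * (1 - \<rho>)\<^sup>2"
    by (simp add: power2_eq_square algebra_simps)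
  moreover have "\<mu> * sq n x = 4 * real q + (1 + \<rho>)\<^sup>2 * (real p * real q)"
  proof -
    have "\<mu> * \<rho>\<^sup>2 = (\<rho> * (\<mu> - 1)) * \<rho> + \<rho>\<^sup>2" by (simp add: power2_eq_square algebra_simps)
    also have "\<dots> = \<rho> + \<rho>\<^sup>2" unfolding pend_bounds(3)[OF p] by simp
    finally have \<rho>: "\<mu> * \<rho>\<^sup>2 = \<rho> + \<rho>\<^sup>2" .
    have "\<mu> * sq n x = (\<mu> * \<rho>\<^sup>2) * (real p * real q) + \<mu> * real q"
      unfolding sq by (simp add: algebra_simps)
    also have "\<dots> = (\<rho> + \<rho>\<^sup>2) * (real p * real q) + (4 + real p * (1 + \<rho>)) * real q"
      unfolding \<rho> lam_pend[OF p] ..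
    finally show ?thesis by (simp add: power2_eq_square algebra_simps)
  qed
  \<comment> \<open>Edges between pendant vertices push the Rayleigh quotient above
    \<open>\<mu>\<close>, so there are none, and then \<open>x\<close> attains the bound.\<close>
  ultimately have qx: "qform n F x = \<mu> * sq n x + \<kappa> * (1 - \<rho>)\<^sup>2" by simp
  have "(1 - \<rho>)\<^sup>2 > 0" using pend_bounds(2)[OF p] by simp
  moreover have "\<kappa> * (1 - \<rho>)\<^sup>2 \<le> 0" using qx qform_le[of x] by linarith
  ultimately have "\<kappa> = 0" using \<kappa>0 by (simp add: mult_le_0_iff)
  then have top: "qform n F x = \<mu> * sq n x" using qx by simp
  have noPP: "\<not> F i j" if "i \<in> Pend" "j \<in> Pend" for i j
  proof -
    have "\<forall>i\<in>Pend. (\<Sum>j\<in>Pend. adj F i j) = 0"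
      using \<open>\<kappa> = 0\<close> unfolding \<kappa>_def
      by (subst (asm) sum_nonneg_eq_0_iff) (auto simp: class_finite adj_def sum_nonneg)
    then have "(\<Sum>j\<in>Pend. adj F i j) = 0" using that by blast
    then have "\<forall>j\<in>Pend. adj F i j = 0"
      by (subst (asm) sum_nonneg_eq_0_iff) (auto simp: class_finite adj_def)
    then show ?thesis using that by (auto simp: adj_def)
  qed
  have core_lt: "u \<in> Core \<Longrightarrow> u < n" for u by (simp add: Core)
  \<comment> \<open>The degree fixes the number of neighbours of \<open>u\<close>, and the
    eigenvalue equation fixes their total weight. Core and pendant neighbours weigh \<open>1\<close>
    and \<open>\<rho> \<noteq> 1\<close>, so both numbers are determined.\<close>
  have nbrs_core: "card {w \<in> Core. F u w} = 2" "card {w \<in> Pend. F u w} = p" if u: "u \<in> Core" for u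
  proof -
    let ?b = "real (card {w \<in> Core. F u w})" and ?l = "real (card {w \<in> Pend. F u w})"
    have b: "(\<Sum>j\<in>Core. adj F u j) = ?b" and l: "(\<Sum>j\<in>Pend. adj F u j) = ?l"
      by (simp_all add: adj_def sum.If_cases class_finite Int_def)
    have d: "real (deg u) = real p + 2" using u by (simp add: Core)
    have 1: "?l + ?b = real p + 2" using deg_sum[of u] unfolding split b l d by simp
    have "(\<Sum>j<n. adj F u j * x j) = \<rho> * ?l + ?b"
      unfolding split b[symmetric] l[symmetric] sum_distrib_left
      by (intro arg_cong2[of _ _ _ _ "(+)"] sum.cong refl) (simp_all add: xP xC)
    then have "\<mu> = real p + 2 + \<rho> * ?l + ?b"
      using top_eigenvector[OF top core_lt[OF u]] qop_eq[OF core_lt[OF u], of F x] xC[OF u] d by simp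
    moreover have l': "?l = real p + 2 - ?b" using 1 by linarith
    ultimately have "4 + real p * (1 + \<rho>) = real p + 2 + \<rho> * (real p + 2 - ?b) + ?b"
      unfolding lam_pend[OF p] l' by linarith
    then have "(1 - \<rho>) * ?b = (1 - \<rho>) * 2" by (simp add: algebra_simps)
    moreover have "1 - \<rho> \<noteq> 0" using pend_bounds(2)[OF p] by simp
    ultimately have "?b = 2" by (simp only: mult_cancel_left) simp
    then show "card {w \<in> Core. F u w} = 2" by linarith
    show "card {w \<in> Pend. F u w} = p" using 1 \<open>?b = 2\<close> by linarith
  qed
  have conn: "S = Core"
    if S: "S \<subseteq> Core" "S \<noteq> {}" and cl: "\<And>u w. u \<in> S \<Longrightarrow> w \<in> Core \<Longrightarrow> F u w \<Longrightarrow> w \<in> S" for S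
  proof (rule ccontr)
    assume "S \<noteq> Core"
    then obtain v where v: "v \<in> Core" "v \<notin> S" using S by blast
    obtain u where u: "u \<in> S" using S by blast
    \<comment> \<open>A closed set of core vertices with its pendant vertices is a union of
      components. The restriction of \<open>x\<close> to it would be a top vector vanishing at
      \<open>v\<close> but not at \<open>u\<close>, hence not proportional to
      \<open>x\<close>.\<close>
    let ?C = "S \<union> {w \<in> Pend. \<exists>u\<in>S. F w u}"
    have closed: "j \<in> ?C" if "i \<in> ?C" "F i j" for i j
    proof (cases "i \<in> S")
      case True
      have "j \<in> Pend \<union> Core" using F_lt(2)[OF that(2)] PC(1) by blast
      then show ?thesis using cl[OF True _ that(2)] True F_sym[OF that(2)] by blast
    next
      case False
      then have i: "i \<in> Pend" and "\<exists>u\<in>S. F i u" using that by blast+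
      then show ?thesis using pendant_nbr[OF i] that(2) by (metis UnI1)
    qed
    let ?y = "\<lambda>i. if i \<in> ?C then x i else 0"
    have ytop: "qform n F ?y = \<mu> * sq n ?y" by (rule top_restrict[OF top closed])
    have uC: "u \<in> Core" "u \<in> ?C" using u S by auto
    have vC: "v \<notin> ?C" using v PC(2) by blast
    have "T ?y 0 * x v = T x 0 * ?y v"
      by (rule top_proportional[OF top ytop core_lt[OF v(1)]])
    then have y0: "T ?y 0 = 0"
      unfolding if_not_P[OF vC] xC[OF v(1)] mult_1_right mult_zero_right .
    have "T ?y 0 * x u = T x 0 * ?y u"
      by (rule top_proportional[OF top ytop core_lt[OF uC(1)]])
    then have "T x 0 = 0"
      unfolding if_P[OF uC(2)] xC[OF uC(1)] mult_1_right y0 by (rule sym)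
    moreover have "T x 0 \<noteq> 0" by (rule top_nonzero[OF top core_lt[OF uC(1)]]) (simp add: xC[OF uC(1)])
    ultimately show False by blast
  qed
  have Cne: "Core \<noteq> {}" using cards(1) q by auto
  obtain s where s: "bij_betw s {..<q} Core"
    and s1: "\<And>i. 0 < i \<Longrightarrow> i < q \<Longrightarrow> {w \<in> Core. F (s i) w} = {s (i - 1), s (if Suc i = q then 0 else Suc i)}"
    and s0: "{w \<in> Core. F (s 0) w} = {s (q - 1), s (if Suc 0 = q then 0 else Suc 0)}"
    using two_regular_connected_is_cycle[of Core F, OF class_finite(3) Cne F_sym F_irrefl nbrs_core(1) conn]
    unfolding cards(1) by blast
  have snb: "{w \<in> Core. F (s i) w} = {s (prv i), s (nxt i)}" if "i < q" for i
  proof (cases "i = 0")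
    case True
    show ?thesis unfolding True s0 prv_def nxt_def by simp
  next
    case False
    then show ?thesis using s1[of i] that by (simp add: prv_def nxt_def)
  qed
  have sC: "i < q \<Longrightarrow> s i \<in> Core" for i using s by (auto simp: bij_betw_def)
  have sinj: "s i = s j \<Longrightarrow> i < q \<Longrightarrow> j < q \<Longrightarrow> i = j" for i j
    using s by (auto simp: bij_betw_def inj_on_def)
  have "\<exists>h. bij_betw h {..<p} {w \<in> Pend. F (s i) w}" if "i < q" for i
    using nbrs_core(2)[OF sC[OF that]] class_finite(2) ex_bij_betw_nat_finite[of "{w \<in> Pend. F (s i) w}"]
    by (simp add: lessThan_atLeast0)
  then obtain h where h: "\<And>i. i < q \<Longrightarrow> bij_betw (h i) {..<p} {w \<in> Pend. F (s i) w}" by metis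
  have hP: "h i k \<in> Pend \<and> F (s i) (h i k)" if "i < q" "k < p" for i k
    using h[OF that(1)] that(2) by (auto simp: bij_betw_def)
  have hinj: "k = l" if "i < q" "k < p" "l < p" "h i k = h i l" for i k l
    using h[OF that(1)] that by (auto simp: bij_betw_def inj_on_def)
  have uniq: "i = j" if ij: "i < q" "j < q" and k: "k < p" and adj: "F (s j) (h i k)" for i j k
  proof -
    obtain u where "\<And>w. F (h i k) w \<longleftrightarrow> w = u" using pendant_nbr hP[OF ij(1) k] by metis
    then have "s i = s j" using hP[OF ij(1) k] adj F_sym by metis
    then show ?thesis using sinj ij by blast
  qed
  \<comment> \<open>The map goes from the jellyfish to the mate, where the numbering of leaves can
    be decoded by division; \<open>graph_iso\<close> asks for its inverse.\<close>
  define \<phi> where "\<phi> v = (if v < q then s v else h ((v - q) div p) ((v - q) mod p))" for v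
  have \<phi>c: "\<phi> i = s i" if "i < q" for i using that by (simp add: \<phi>_def)
  have \<phi>l: "\<phi> (leaf i k) = h i k" if "k < p" for i k
    using that leaf_not_core(1)[of i k] by (simp add: \<phi>_def leaf_def)
  have \<phi>_inj: "inj_on \<phi> {..<n}"
  proof (rule inj_onI)
    fix a b assume ab: "a \<in> {..<n}" "b \<in> {..<n}" and eq: "\<phi> a = \<phi> b"
    have a: "a < n" and b: "b < n" using ab by auto
    show "a = b" using a
    proof (cases rule: vertex_cases)
      case a1: 1
      show ?thesis using b
      proof (cases rule: vertex_cases)
        case 1
        show ?thesis using sinj[OF _ a1 1] eq \<phi>c[OF a1] \<phi>c[OF 1] by simp
      next
        case (2 i k)
        then have "s a = h i k" using eq \<phi>c[OF a1] \<phi>l[of k i] by simp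
        then show ?thesis using sC[OF a1] hP[OF 2(1,2)] PC(2) by auto
      qed
    next
      case a2: (2 i k)
      show ?thesis using b
      proof (cases rule: vertex_cases)
        case 1
        then have "s b = h i k" using eq a2 \<phi>c[OF 1] \<phi>l[of k i] by simp
        then show ?thesis using sC[OF 1] hP[OF a2(1,2)] PC(2) by auto
      next
        case (2 j l)
        then have e: "h i k = h j l" using eq a2 \<phi>l[of k i] \<phi>l[of l j] by simp
        have "F (s j) (h i k)" using hP[OF 2(1,2)] e by simp
        then have "i = j" using uniq[OF a2(1) 2(1) a2(2)] by blast
        then show ?thesis using hinj[OF a2(1,2) 2(2)] e a2(3) 2(3) by simp
      qed
    qed
  qed
  have \<phi>_im: "\<phi> a < n" if "a < n" for a
    using that
  proof (cases rule: vertex_cases)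
    case 1
    then show ?thesis using \<phi>c sC core_lt by simp
  next
    case (2 i k)
    then show ?thesis using \<phi>l[of k i] hP[of i k] by (simp add: Pend_def)
  qed
  have "\<phi> ` {..<n} = {..<n}"
    by (rule endo_inj_surj) (use \<phi>_inj \<phi>_im in auto)
  then have \<phi>_bij: "bij_betw \<phi> {..<n} {..<n}" using \<phi>_inj by (simp add: bij_betw_def)
  have cc: "F (s i) (s j) \<longleftrightarrow> J i j" if i: "i < q" and j: "j < q" for i j
  proof -
    have "F (s i) (s j) \<longleftrightarrow> s j \<in> {s (prv i), s (nxt i)}"
      unfolding snb[OF i, symmetric] using sC[OF j] by simp
    also have "\<dots> \<longleftrightarrow> j = prv i \<or> j = nxt i"
      using sinj[OF _ j prv_lt[OF i]] sinj[OF _ j nxt_lt[OF i]] by auto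
    also have "\<dots> \<longleftrightarrow> i = nxt j \<or> j = nxt i" using nxt_eq_iff[OF i, of j] by blast
    also have "\<dots> \<longleftrightarrow> J i j" unfolding jfg_E_def edge0_core[OF j] edge0_core[OF i] using i j by blast
    finally show ?thesis .
  qed
  have cl: "F (s i) (h j l) \<longleftrightarrow> J i (leaf j l)" if i: "i < q" and j: "j < q" and l: "l < p" for i j l
  proof -
    have "F (s i) (h j l) \<longleftrightarrow> i = j" using uniq[OF j i l] hP[OF j l] by blast
    moreover have "J i (leaf j l) \<longleftrightarrow> i = j"
      unfolding jfg_E_def edge0_leaf[OF l] using edge0_from_leaf i by blast
    ultimately show ?thesis by blast
  qed
  have edge: "F (\<phi> a) (\<phi> b) \<longleftrightarrow> J a b" if a: "a < n" and b: "b < n" for a b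
    using a
  proof (cases rule: vertex_cases)
    case a1: 1
    show ?thesis using b
    proof (cases rule: vertex_cases)
      case 1
      show ?thesis unfolding \<phi>c[OF a1] \<phi>c[OF 1] by (rule cc[OF a1 1])
    next
      case (2 j l)
      show ?thesis unfolding 2(3) \<phi>c[OF a1] \<phi>l[OF 2(2)] by (rule cl[OF a1 2(1,2)])
    qed
  next
    case a2: (2 i k)
    show ?thesis using b
    proof (cases rule: vertex_cases)
      case 1
      have "F (h i k) (s b) \<longleftrightarrow> J (leaf i k) b"
        using cl[OF 1 a2(1,2)] F_sym simple_graphD(3)[OF E] by blast
      then show ?thesis unfolding a2(3) \<phi>c[OF 1] \<phi>l[OF a2(2)] .
    next
      case (2 j l)
      have "\<not> F (h i k) (h j l)" using noPP hP[OF a2(1,2)] hP[OF 2(1,2)] by blast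
      moreover have "\<not> J (leaf i k) (leaf j l)" unfolding jfg_E_def using edge0_from_leaf by blast
      ultimately show ?thesis unfolding a2(3) 2(3) \<phi>l[OF a2(2)] \<phi>l[OF 2(2)] by blast
    qed
  qed
  let ?f = "the_inv_into {..<n} \<phi>"
  have "bij_betw ?f {..<n} {..<n}" by (rule bij_betw_the_inv_into[OF \<phi>_bij])
  moreover have "F i j \<longleftrightarrow> J (?f i) (?f j)" if "i < n" "j < n" for i j
  proof -
    have "\<phi> (?f i) = i" "\<phi> (?f j) = j"
      using f_the_inv_into_f_bij_betw[OF \<phi>_bij] that by auto
    moreover have "?f i < n" "?f j < n"
      using bij_betwE[OF \<open>bij_betw ?f {..<n} {..<n}\<close>] that by auto
    ultimately show ?thesis using edge by metis
  qed
  ultimately show ?thesis unfolding graph_iso_def lessThan_atLeast0 by blast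
qed

end

section \<open>Eigenvalue counts on pendant and core vertices\<close>

context jellyfish_mate
begin

definition Zc :: "nat set" where "Zc = {z \<in> Core. \<forall>v\<in>Pend. \<not> F z v}"
definition Uc :: "nat set" where "Uc = {u \<in> Core. \<exists>v\<in>Pend. F u v}"

text \<open>The quadratic form of \<open>Q - t\<close> on vectors supported on \<open>S\<close>; the
  degrees are those in the whole graph, not in the induced subgraph.\<close>

definition zform :: "real \<Rightarrow> nat set \<Rightarrow> (nat \<Rightarrow> real) \<Rightarrow> real" where
  "zform t S a = (\<Sum>z\<in>S. (real (deg z) - t) * (a z)\<^sup>2) + (\<Sum>z\<in>S. \<Sum>w\<in>S. adj F z w * (a z * a w))"

lemma Core_split: "Core = Uc \<union> Zc" "Uc \<inter> Zc = {}"
  by (auto simp: Uc_def Zc_def)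

lemma finite_UZ: "finite Uc" "finite Zc"
  using class_finite(3) by (simp_all add: Uc_def Zc_def)

text \<open>Diagonal dominance: each product is at least minus the mean of two squares, and a vertex
  has at most \<open>card S - 1\<close> neighbours in \<open>S\<close>.\<close>

lemma zform_lower:
  assumes "finite S"
  shows "(\<Sum>z\<in>S. (real (deg z) - t - (real (card S) - 1)) * (a z)\<^sup>2) \<le> zform t S a"
proof -
  have pt: "- (((a z)\<^sup>2 + (a w)\<^sup>2) / 2 - (if z = w then (a z)\<^sup>2 else 0)) \<le> adj F z w * (a z * a w)" for z w
  proof (cases "F z w")
    case True
    then have "z \<noteq> w" using F_irrefl by blast
    moreover have "- (((a z)\<^sup>2 + (a w)\<^sup>2) / 2) \<le> a z * a w"
      using sum_squares_bound[of "- a z" "a w"] by (simp add: field_simps)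
    ultimately show ?thesis using True by (simp add: adj_def)
  next
    case False
    have "0 \<le> ((a z)\<^sup>2 + (a w)\<^sup>2) / 2" by simp
    then show ?thesis using False by (cases "z = w") (simp_all add: adj_def)
  qed
  have "(\<Sum>z\<in>S. \<Sum>w\<in>S. - (((a z)\<^sup>2 + (a w)\<^sup>2) / 2 - (if z = w then (a z)\<^sup>2 else 0))) =
      (\<Sum>z\<in>S. - (real (card S) - 1) * (a z)\<^sup>2)"
  proof -
    have "(\<Sum>z\<in>S. \<Sum>w\<in>S. (a w)\<^sup>2) = real (card S) * (\<Sum>z\<in>S. (a z)\<^sup>2)" by simp
    moreover have "(\<Sum>z\<in>S. \<Sum>w\<in>S. (a z)\<^sup>2) = real (card S) * (\<Sum>z\<in>S. (a z)\<^sup>2)"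
      by (simp add: sum_distrib_left)
    moreover have "(\<Sum>z\<in>S. \<Sum>w\<in>S. if z = w then (a z)\<^sup>2 else 0) = (\<Sum>z\<in>S. (a z)\<^sup>2)"
      using assms by (simp add: sum.delta')
    ultimately show ?thesis
      by (simp add: sum_negf sum_subtractf sum.distrib sum_divide_distrib[symmetric]
          sum_distrib_left[symmetric] algebra_simps)
  qed
  moreover have "\<dots> \<le> (\<Sum>z\<in>S. \<Sum>w\<in>S. adj F z w * (a z * a w)) \<Longrightarrow> ?thesis"
    unfolding zform_def by (simp add: algebra_simps sum.distrib sum_subtractf)
  moreover have "(\<Sum>z\<in>S. \<Sum>w\<in>S. - (((a z)\<^sup>2 + (a w)\<^sup>2) / 2 - (if z = w then (a z)\<^sup>2 else 0)))
      \<le> (\<Sum>z\<in>S. \<Sum>w\<in>S. adj F z w * (a z * a w))"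
    by (intro sum_mono pt)
  ultimately show ?thesis by simp
qed

text \<open>There are no cross terms: pendant vertices are joined only to the core, and vertices of
  \<open>Zc\<close> have no pendant neighbour.\<close>

lemma qform_pend_core:
  assumes pc: "\<And>v w. v \<in> Pend \<Longrightarrow> F v w \<Longrightarrow> w \<in> Core" and Z0: "Z0 \<subseteq> Zc"
    and supp: "\<And>i. i \<notin> Pend \<union> Z0 \<Longrightarrow> a i = 0"
  shows "qform n F a = (\<Sum>v\<in>Pend. (a v)\<^sup>2) + zform 0 Z0 a"
    and "sq n a = (\<Sum>v\<in>Pend. (a v)\<^sup>2) + (\<Sum>z\<in>Z0. (a z)\<^sup>2)"
proof -
  have fin: "finite Pend" "finite Z0" using class_finite finite_UZ finite_subset[OF Z0] by auto
  have dis: "Pend \<inter> Z0 = {}" using Z0 by (auto simp: Zc_def Core_def Pend_def)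
  have sub: "Pend \<union> Z0 \<subseteq> {..<n}" using Z0 by (auto simp: Zc_def Core_def Pend_def)
  have zero: "adj F i j * (a i * a j) = 0" if "i \<notin> Z0 \<or> j \<notin> Z0" for i j
  proof (cases "F i j \<and> a i \<noteq> 0 \<and> a j \<noteq> 0")
    case True
    then have m: "i \<in> Pend \<union> Z0" "j \<in> Pend \<union> Z0" using supp by blast+
    have "\<not> (i \<in> Pend)"
    proof
      assume i: "i \<in> Pend"
      then have "j \<in> Core" using pc True by blast
      then have "j \<in> Z0" using m by (auto simp: Core_def Pend_def)
      then show False using Z0 i True F_sym by (auto simp: Zc_def)
    qed
    moreover have "\<not> (j \<in> Pend)"
    proof
      assume j: "j \<in> Pend"
      then have "i \<in> Core" using pc True F_sym by blast
      then have "i \<in> Z0" using m by (auto simp: Core_def Pend_def)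
      then show False using Z0 j True by (auto simp: Zc_def)
    qed
    ultimately show ?thesis using m that by blast
  qed (auto simp: adj_def)
  have "(\<Sum>i<n. real (deg i) * (a i)\<^sup>2) = (\<Sum>i\<in>Pend \<union> Z0. real (deg i) * (a i)\<^sup>2)"
    by (rule sum_support[OF sub]) (use supp in simp)
  also have "\<dots> = (\<Sum>v\<in>Pend. real (deg v) * (a v)\<^sup>2) + (\<Sum>z\<in>Z0. real (deg z) * (a z)\<^sup>2)"
    by (rule sum.union_disjoint[OF fin dis])
  also have "(\<Sum>v\<in>Pend. real (deg v) * (a v)\<^sup>2) = (\<Sum>v\<in>Pend. (a v)\<^sup>2)"
    by (intro sum.cong refl) (simp add: Pend_def)
  finally have 1: "(\<Sum>i<n. real (deg i) * (a i)\<^sup>2) = (\<Sum>v\<in>Pend. (a v)\<^sup>2) + (\<Sum>z\<in>Z0. real (deg z) * (a z)\<^sup>2)" .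
  have 2: "(\<Sum>i<n. \<Sum>j<n. adj F i j * (a i * a j)) = (\<Sum>i\<in>Z0. \<Sum>j\<in>Z0. adj F i j * (a i * a j))"
    by (rule sum_sum_support) (use sub zero in blast)+
  show "qform n F a = (\<Sum>v\<in>Pend. (a v)\<^sup>2) + zform 0 Z0 a"
    unfolding qform_eq 1 2 zform_def by simp
  have "sq n a = (\<Sum>i\<in>Pend \<union> Z0. (a i)\<^sup>2)"
    unfolding sq_def by (rule sum_support[OF sub]) (use supp in simp)
  then show "sq n a = (\<Sum>v\<in>Pend. (a v)\<^sup>2) + (\<Sum>z\<in>Z0. (a z)\<^sup>2)"
    using sum.union_disjoint[OF fin dis] by simp
qed

lemma zform_shift: "zform t S a = zform 0 S a - t * (\<Sum>z\<in>S. (a z)\<^sup>2)"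
  by (simp add: zform_def algebra_simps sum_subtractf sum_distrib_left)

lemma sum_of_bool_member:
  fixes a :: "nat \<Rightarrow> real"
  assumes "finite I" "\<And>j. j \<notin> I \<Longrightarrow> a j = 0"
  shows "(\<Sum>j\<in>I. of_bool (i = j) * a j) = a i"
proof -
  have "(\<Sum>j\<in>I. of_bool (i = j) * a j) = (\<Sum>j\<in>I. if i = j then a j else 0)"
    by (intro sum.cong) auto
  then show ?thesis using assms by (simp add: sum.delta')
qed

text \<open>Pendant coordinates contribute equally to \<open>qform\<close> and \<open>sq\<close> and
  cancel, so the strict inequality falls entirely on \<open>Z0\<close>.\<close>

lemma pendant_count_at_least_one:
  fixes D :: "'d \<Rightarrow> nat \<Rightarrow> real"
  assumes pc: "\<And>v w. v \<in> Pend \<Longrightarrow> F v w \<Longrightarrow> w \<in> Core" and Z0: "Z0 \<subseteq> Zc"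
    and "finite Dx" and card: "p * q + card Dx < card Pend + card Z0"
  obtains a where "zform 1 Z0 a < 0" "\<And>d. d \<in> Dx \<Longrightarrow> (\<Sum>z\<in>Z0. D d z * a z) = 0"
proof -
  have fin: "finite Pend" "finite Z0" using class_finite finite_UZ finite_subset[OF Z0] by auto
  have dis: "Pend \<inter> Z0 = {}" using Z0 by (auto simp: Zc_def Core_def Pend_def)
  let ?I = "Pend \<union> Z0" and ?D = "\<lambda>d z. if z \<in> Z0 then D d z else 0"
  have finI: "finite ?I" using fin by simp
  have cardI: "p * q + card Dx < card ?I" using card card_Un_disjoint[OF fin dis] by simp
  obtain a where nz: "\<exists>j\<in>?I. a j \<noteq> 0" and supp: "\<And>j. j \<notin> ?I \<Longrightarrow> a j = 0"
    and less: "sq n (\<lambda>i. \<Sum>j\<in>?I. of_bool (i = j) * a j) \<noteq> 0 \<Longrightarrow>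
      qform n F (\<lambda>i. \<Sum>j\<in>?I. of_bool (i = j) * a j) < sq n (\<lambda>i. \<Sum>j\<in>?I. of_bool (i = j) * a j)"
    and D: "\<And>d. d \<in> Dx \<Longrightarrow> (\<Sum>j\<in>?I. ?D d j * a j) = 0"
    by (rule count_at_least_one[OF finI \<open>finite Dx\<close> cardI, of "\<lambda>i j. of_bool (i = j)" ?D]) (rule that)
  have x: "(\<lambda>i. \<Sum>j\<in>?I. of_bool (i = j) * a j) = a"
    using sum_of_bool_member[of ?I a] supp fin by auto
  have "sq n a \<noteq> 0"
    using nz Z0 unfolding sq_eq_0_iff by (auto simp: Pend_def Zc_def Core_def)
  then have "qform n F a < sq n a" using less unfolding x by simp
  have form: "qform n F a = (\<Sum>v\<in>Pend. (a v)\<^sup>2) + zform 0 Z0 a"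
      "sq n a = (\<Sum>v\<in>Pend. (a v)\<^sup>2) + (\<Sum>z\<in>Z0. (a z)\<^sup>2)"
    by (rule qform_pend_core[of Z0 a]; use pc Z0 supp in blast)+
  have "zform 1 Z0 a < 0"
    using \<open>qform n F a < sq n a\<close> unfolding form zform_shift[of 1] by simp
  moreover have "(\<Sum>z\<in>Z0. D d z * a z) = 0" if "d \<in> Dx" for d
  proof -
    have "(\<Sum>j\<in>?I. ?D d j * a j) = (\<Sum>j\<in>Pend. ?D d j * a j) + (\<Sum>j\<in>Z0. ?D d j * a j)"
      by (rule sum.union_disjoint[OF fin dis])
    also have "(\<Sum>j\<in>Pend. ?D d j * a j) = 0" by (rule sum.neutral) (use dis in auto)
    finally show ?thesis using D[OF that] by simp
  qed
  ultimately show ?thesis using that by blast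
qed

text \<open>At threshold \<open>4 / 5\<close> the pendant coordinates keep the positive weight
  \<open>1 / 5\<close>. A solution vanishing on \<open>Z0\<close> would therefore vanish
  everywhere.\<close>

lemma pendant_count_four_fifths:
  fixes D :: "'d \<Rightarrow> nat \<Rightarrow> real"
  assumes p1: "p = 1" and pc: "\<And>v w. v \<in> Pend \<Longrightarrow> F v w \<Longrightarrow> w \<in> Core" and Z0: "Z0 \<subseteq> Zc"
    and "finite Dx" and card: "q + card Dx < card Pend + card Z0"
  obtains a where "zform (4 / 5) Z0 a \<le> 0" "\<exists>z\<in>Z0. a z \<noteq> 0"
    "\<And>d. d \<in> Dx \<Longrightarrow> (\<Sum>z\<in>Z0. D d z * a z) = 0"
proof -
  have fin: "finite Pend" "finite Z0" using class_finite finite_UZ finite_subset[OF Z0] by auto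
  have dis: "Pend \<inter> Z0 = {}" using Z0 by (auto simp: Zc_def Core_def Pend_def)
  let ?I = "Pend \<union> Z0" and ?D = "\<lambda>d z. if z \<in> Z0 then D d z else 0"
  have finI: "finite ?I" using fin by simp
  have cardI: "q + card Dx < card ?I" using card card_Un_disjoint[OF fin dis] by simp
  obtain a where nz: "\<exists>j\<in>?I. a j \<noteq> 0" and supp: "\<And>j. j \<notin> ?I \<Longrightarrow> a j = 0"
    and le: "qform n F (\<lambda>i. \<Sum>j\<in>?I. of_bool (i = j) * a j) \<le> 4 / 5 * sq n (\<lambda>i. \<Sum>j\<in>?I. of_bool (i = j) * a j)"
    and D: "\<And>d. d \<in> Dx \<Longrightarrow> (\<Sum>j\<in>?I. ?D d j * a j) = 0"
    by (rule count_above_four_fifths[OF p1 finI \<open>finite Dx\<close> cardI, of "\<lambda>i j. of_bool (i = j)" ?D]) (rule that)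
  have x: "(\<lambda>i. \<Sum>j\<in>?I. of_bool (i = j) * a j) = a"
    using sum_of_bool_member[of ?I a] supp fin by auto
  have form: "qform n F a = (\<Sum>v\<in>Pend. (a v)\<^sup>2) + zform 0 Z0 a"
      "sq n a = (\<Sum>v\<in>Pend. (a v)\<^sup>2) + (\<Sum>z\<in>Z0. (a z)\<^sup>2)"
    by (rule qform_pend_core[of Z0 a]; use pc Z0 supp in blast)+
  have le: "1 / 5 * (\<Sum>v\<in>Pend. (a v)\<^sup>2) + zform (4 / 5) Z0 a \<le> 0"
    using le unfolding x form zform_shift[of "4 / 5"] by (simp add: algebra_simps)
  have nn: "0 \<le> (\<Sum>v\<in>Pend. (a v)\<^sup>2)" by (simp add: sum_nonneg)
  have "zform (4 / 5) Z0 a \<le> 0" using le nn by linarith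
  moreover have "\<exists>z\<in>Z0. a z \<noteq> 0"
  proof (rule ccontr)
    assume none: "\<not> (\<exists>z\<in>Z0. a z \<noteq> 0)"
    then have "zform (4 / 5) Z0 a = 0" by (simp add: zform_def)
    then have "(\<Sum>v\<in>Pend. (a v)\<^sup>2) = 0" using le nn by linarith
    then have "\<forall>v\<in>Pend. a v = 0" by (simp add: sum_nonneg_eq_0_iff fin)
    then show False using nz none by blast
  qed
  moreover have "(\<Sum>z\<in>Z0. D d z * a z) = 0" if "d \<in> Dx" for d
  proof -
    have "(\<Sum>j\<in>?I. ?D d j * a j) = (\<Sum>j\<in>Pend. ?D d j * a j) + (\<Sum>j\<in>Z0. ?D d j * a j)"
      by (rule sum.union_disjoint[OF fin dis])
    also have "(\<Sum>j\<in>Pend. ?D d j * a j) = 0" by (rule sum.neutral) (use dis in auto)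
    finally show ?thesis using D[OF that] by simp
  qed
  ultimately show ?thesis using that by blast
qed

text \<open>Each core vertex \<open>u\<close> with a pendant neighbour contributes one positive direction: the form
  \<open>Q - 1\<close> vanishes on the pendant vertices, so the value at one pendant neighbour of \<open>u\<close> can be
  chosen to cancel every term involving \<open>u\<close> except \<open>(a u)\<^sup>2\<close>.\<close>

lemma core_count:
  fixes D :: "'d \<Rightarrow> nat \<Rightarrow> real"
  assumes pc: "\<And>v w. v \<in> Pend \<Longrightarrow> F v w \<Longrightarrow> w \<in> Core" and Z0: "Z0 \<subseteq> Zc"
    and "finite Dx" and card: "q + card Dx < card Uc + card Z0"
  obtains a where "zform 1 Z0 a \<le> 0" "\<exists>z\<in>Z0. a z \<noteq> 0"
    "\<And>d. d \<in> Dx \<Longrightarrow> (\<Sum>z\<in>Z0. D d z * a z) = 0"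
proof -
  have fin: "finite Uc" "finite Z0" using finite_UZ finite_subset[OF Z0] by auto
  have dis: "Uc \<inter> Z0 = {}" using Z0 Core_split by blast
  have "\<forall>u\<in>Uc. \<exists>v. v \<in> Pend \<and> F u v" by (auto simp: Uc_def)
  then obtain v where v: "\<And>u. u \<in> Uc \<Longrightarrow> v u \<in> Pend" "\<And>u. u \<in> Uc \<Longrightarrow> F u (v u)" by metis
  have nbr: "F (v u) w \<longleftrightarrow> w = u" if "u \<in> Uc" for u w
    using pendant_nbr[OF v(1)[OF that]] F_sym[OF v(2)[OF that]] by metis
  have vinj: "inj_on v Uc"
  proof (rule inj_onI)
    fix u w assume "u \<in> Uc" "w \<in> Uc" "v u = v w"
    then show "u = w" using nbr[of u u] nbr[of w u] by simp
  qed
  define V where "V = v ` Uc"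
  let ?I = "Uc \<union> Z0" and ?D = "\<lambda>d z. if z \<in> Z0 then D d z else 0"
  define u' where "u' = the_inv_into Uc v"
  have u': "u' (v u) = u" if "u \<in> Uc" for u
    unfolding u'_def by (rule the_inv_into_f_f[OF vinj that])
  \<comment> \<open>The value at the pendant neighbour \<open>v u\<close>. Couplings within
    \<open>Uc\<close> are halved since each is corrected at both of its ends, couplings to
    \<open>Z0\<close> only at one. The term \<open>2 - deg u\<close> lowers the coefficient
    \<open>deg u - 1\<close> of \<open>(a u)\<^sup>2\<close> to \<open>1\<close>.\<close>
  define H where "H u j = (if j \<in> Uc then (of_bool (u = j) * (2 - real (deg u)) - adj F u j) / 2
    else - adj F u j)" for u j
  define G where "G i j = (if i \<in> ?I then of_bool (i = j) else if i \<in> V then H (u' i) j else 0)" for i j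
  have VP: "V \<subseteq> Pend" using v by (auto simp: V_def)
  have PC: "Pend \<inter> Core = {}" by (auto simp: Pend_def Core_def)
  have ICore: "?I \<subseteq> Core" using Z0 Core_split by blast
  have IV: "?I \<inter> V = {}" using VP PC ICore by blast
  have finV: "finite V" using fin by (simp add: V_def)
  have finI: "finite ?I" using fin by simp
  have cardI: "q + card Dx < card ?I" using card card_Un_disjoint[OF fin dis] by simp
  obtain a where nz: "\<exists>j\<in>?I. a j \<noteq> 0" and supp: "\<And>j. j \<notin> ?I \<Longrightarrow> a j = 0"
    and le: "qform n F (\<lambda>i. \<Sum>j\<in>?I. G i j * a j) \<le> sq n (\<lambda>i. \<Sum>j\<in>?I. G i j * a j)"
    and D: "\<And>d. d \<in> Dx \<Longrightarrow> (\<Sum>j\<in>?I. ?D d j * a j) = 0"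
    by (rule count_above_one[OF finI \<open>finite Dx\<close> cardI, of G ?D]) (rule that)
  define x where "x i = (\<Sum>j\<in>?I. G i j * a j)" for i
  have xI: "x i = a i" if "i \<in> ?I" for i
    using sum_of_bool_member[of ?I a i] supp fin that by (simp add: x_def G_def)
  define ZU where "ZU u = (\<Sum>z\<in>Z0. adj F u z * a z)" for u
  define UU where "UU u = (\<Sum>w\<in>Uc. adj F u w * a w)" for u
  have xV: "x (v u) = ((2 - real (deg u)) * a u - UU u) / 2 - ZU u" if u: "u \<in> Uc" for u
  proof -
    have "v u \<in> V" using u by (simp add: V_def)
    then have "v u \<notin> ?I" using IV by blast
    then have "x (v u) = (\<Sum>j\<in>?I. H u j * a j)"
      unfolding x_def G_def using \<open>v u \<in> V\<close> u'[OF u] by (intro sum.cong) auto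
    also have "\<dots> = (\<Sum>j\<in>Uc. H u j * a j) + (\<Sum>j\<in>Z0. H u j * a j)"
      by (rule sum.union_disjoint[OF fin dis])
    also have "(\<Sum>j\<in>Z0. H u j * a j) = - ZU u"
      unfolding ZU_def sum_negf[symmetric] using dis by (intro sum.cong) (auto simp: H_def)
    also have "(\<Sum>j\<in>Uc. H u j * a j) =
        (\<Sum>j\<in>Uc. (if u = j then (2 - real (deg u)) * a j / 2 else 0) - adj F u j * a j / 2)"
      by (intro sum.cong refl) (auto simp: H_def field_simps)
    also have "\<dots> = (2 - real (deg u)) * a u / 2 - UU u / 2"
      using u fin by (simp add: sum_subtractf sum.delta' UU_def sum_divide_distrib)
    finally show ?thesis by (simp add: field_simps)
  qed
  have x0: "x i = 0" if "i \<notin> ?I \<union> V" for i using that by (simp add: x_def G_def)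
  have "Core \<subseteq> {..<n}" "Pend \<subseteq> {..<n}" by (auto simp: Core_def Pend_def)
  then have sub: "?I \<union> V \<subseteq> {..<n}" using VP ICore by blast
  have S: "(\<Sum>i\<in>?I \<union> V. f i) = (\<Sum>i\<in>Uc. f i) + (\<Sum>i\<in>Z0. f i) + (\<Sum>u\<in>Uc. f (v u))" for f :: "nat \<Rightarrow> real"
  proof -
    have "(\<Sum>i\<in>?I \<union> V. f i) = (\<Sum>i\<in>?I. f i) + (\<Sum>i\<in>V. f i)"
      by (rule sum.union_disjoint) (use fin finV IV in auto)
    moreover have "(\<Sum>i\<in>V. f i) = (\<Sum>u\<in>Uc. f (v u))"
      unfolding V_def using vinj by (simp add: sum.reindex)
    ultimately show ?thesis using sum.union_disjoint[OF fin dis, of f] by simp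
  qed
  have A: "qform n F x - sq n x = (\<Sum>i\<in>?I \<union> V. (real (deg i) - 1) * (x i)\<^sup>2)
      + (\<Sum>i\<in>?I \<union> V. \<Sum>j\<in>?I \<union> V. adj F i j * (x i * x j))"
  proof -
    have "(\<Sum>i<n. real (deg i) * (x i)\<^sup>2) - sq n x = (\<Sum>i<n. (real (deg i) - 1) * (x i)\<^sup>2)"
      by (simp add: sq_def sum_subtractf[symmetric] algebra_simps)
    also have "\<dots> = (\<Sum>i\<in>?I \<union> V. (real (deg i) - 1) * (x i)\<^sup>2)"
      by (rule sum_support[OF sub]) (use x0 in simp)
    finally have 1: "(\<Sum>i<n. real (deg i) * (x i)\<^sup>2) - sq n x = (\<Sum>i\<in>?I \<union> V. (real (deg i) - 1) * (x i)\<^sup>2)" .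
    have "(\<Sum>i<n. \<Sum>j<n. adj F i j * (x i * x j)) = (\<Sum>i\<in>?I \<union> V. \<Sum>j\<in>?I \<union> V. adj F i j * (x i * x j))"
      by (rule sum_sum_support[OF sub]) (use x0 in auto)
    then show ?thesis using 1 unfolding qform_eq by linarith
  qed
  have degV: "real (deg (v u)) = 1" if "u \<in> Uc" for u using v(1)[OF that] by (simp add: Pend_def)
  have adjV: "adj F (v u) j = of_bool (j = u)" if "u \<in> Uc" for u j using nbr[OF that] by (simp add: adj_def)
  have B: "(\<Sum>i\<in>?I \<union> V. (real (deg i) - 1) * (x i)\<^sup>2) =
      (\<Sum>u\<in>Uc. (real (deg u) - 1) * (a u)\<^sup>2) + (\<Sum>z\<in>Z0. (real (deg z) - 1) * (a z)\<^sup>2)"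
    unfolding S by (simp add: xI degV)
  have rowU: "(\<Sum>j\<in>?I \<union> V. adj F u j * (x u * x j)) = a u * (UU u + ZU u + x (v u))" if u: "u \<in> Uc" for u
  proof -
    have "(\<Sum>w\<in>Uc. adj F u (v w) * (x u * x (v w))) = (\<Sum>w\<in>Uc. if w = u then x u * x (v w) else 0)"
      by (intro sum.cong refl) (simp add: adj_F_sym[of u] adjV)
    also have "\<dots> = x u * x (v u)" using u fin by (simp add: sum.delta)
    finally have "(\<Sum>w\<in>Uc. adj F u (v w) * (x u * x (v w))) = a u * x (v u)" using xI u by simp
    moreover have "(\<Sum>w\<in>Uc. adj F u w * (x u * x w)) = a u * UU u"
      unfolding UU_def sum_distrib_left by (intro sum.cong refl) (simp add: xI u)
    moreover have "(\<Sum>z\<in>Z0. adj F u z * (x u * x z)) = a u * ZU u"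
      unfolding ZU_def sum_distrib_left by (intro sum.cong refl) (simp add: xI u)
    ultimately show ?thesis unfolding S by (simp add: algebra_simps)
  qed
  have rowV: "(\<Sum>j\<in>?I \<union> V. adj F (v u) j * (x (v u) * x j)) = a u * x (v u)" if u: "u \<in> Uc" for u
  proof -
    have "(\<Sum>j\<in>?I \<union> V. adj F (v u) j * (x (v u) * x j)) = (\<Sum>j\<in>?I \<union> V. if j = u then x (v u) * x j else 0)"
      by (intro sum.cong refl) (simp add: adjV[OF u])
    also have "\<dots> = x (v u) * x u" using u fin finV by (simp add: sum.delta)
    finally show ?thesis using xI u by simp
  qed
  have rowZ: "(\<Sum>j\<in>?I \<union> V. adj F z j * (x z * x j)) = (\<Sum>u\<in>Uc. a u * (adj F u z * a z))
      + (\<Sum>w\<in>Z0. adj F z w * (a z * a w))" if z: "z \<in> Z0" for z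
  proof -
    have "(\<Sum>w\<in>Uc. adj F z (v w) * (x z * x (v w))) = 0"
    proof (rule sum.neutral, intro ballI)
      fix w assume "w \<in> Uc"
      then have "\<not> F z (v w)" using v(1) z Z0 by (auto simp: Zc_def)
      then show "adj F z (v w) * (x z * x (v w)) = 0" by (simp add: adj_def)
    qed
    moreover have "(\<Sum>w\<in>Uc. adj F z w * (x z * x w)) = (\<Sum>u\<in>Uc. a u * (adj F u z * a z))"
      by (intro sum.cong refl) (simp add: xI z adj_F_sym[of z])
    moreover have "(\<Sum>w\<in>Z0. adj F z w * (x z * x w)) = (\<Sum>w\<in>Z0. adj F z w * (a z * a w))"
      by (intro sum.cong refl) (simp add: xI z)
    ultimately show ?thesis unfolding S by simp
  qed
  have C: "(\<Sum>i\<in>?I \<union> V. \<Sum>j\<in>?I \<union> V. adj F i j * (x i * x j)) =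
      (\<Sum>u\<in>Uc. a u * (UU u + 2 * ZU u + 2 * x (v u))) + (\<Sum>z\<in>Z0. \<Sum>w\<in>Z0. adj F z w * (a z * a w))"
  proof -
    have "(\<Sum>z\<in>Z0. \<Sum>u\<in>Uc. a u * (adj F u z * a z)) = (\<Sum>u\<in>Uc. a u * ZU u)"
      unfolding ZU_def sum_distrib_left by (rule sum.swap)
    moreover have "(\<Sum>u\<in>Uc. \<Sum>j\<in>?I \<union> V. adj F u j * (x u * x j)) = (\<Sum>u\<in>Uc. a u * (UU u + ZU u + x (v u)))"
      by (intro sum.cong refl rowU)
    moreover have "(\<Sum>u\<in>Uc. \<Sum>j\<in>?I \<union> V. adj F (v u) j * (x (v u) * x j)) = (\<Sum>u\<in>Uc. a u * x (v u))"
      by (intro sum.cong refl rowV)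
    moreover have "(\<Sum>z\<in>Z0. \<Sum>j\<in>?I \<union> V. adj F z j * (x z * x j)) =
        (\<Sum>z\<in>Z0. (\<Sum>u\<in>Uc. a u * (adj F u z * a z)) + (\<Sum>w\<in>Z0. adj F z w * (a z * a w)))"
      by (intro sum.cong refl rowZ)
    ultimately have "(\<Sum>i\<in>?I \<union> V. \<Sum>j\<in>?I \<union> V. adj F i j * (x i * x j)) =
        (\<Sum>u\<in>Uc. a u * (UU u + ZU u + x (v u))) + ((\<Sum>u\<in>Uc. a u * ZU u)
          + (\<Sum>z\<in>Z0. \<Sum>w\<in>Z0. adj F z w * (a z * a w))) + (\<Sum>u\<in>Uc. a u * x (v u))"
      unfolding S[of "\<lambda>i. \<Sum>j\<in>?I \<union> V. adj F i j * (x i * x j)"] sum.distrib by simp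
    moreover have "(\<Sum>u\<in>Uc. a u * (UU u + 2 * ZU u + 2 * x (v u))) = (\<Sum>u\<in>Uc. a u * (UU u + ZU u + x (v u)))
        + (\<Sum>u\<in>Uc. a u * ZU u) + (\<Sum>u\<in>Uc. a u * x (v u))"
      unfolding sum.distrib[symmetric] by (intro sum.cong refl) (simp add: algebra_simps)
    ultimately show ?thesis by linarith
  qed
  have "qform n F x - sq n x = (\<Sum>u\<in>Uc. (a u)\<^sup>2) + zform 1 Z0 a"
  proof -
    have "(\<Sum>u\<in>Uc. (real (deg u) - 1) * (a u)\<^sup>2) + (\<Sum>u\<in>Uc. a u * (UU u + 2 * ZU u + 2 * x (v u))) =
        (\<Sum>u\<in>Uc. (a u)\<^sup>2)"
      unfolding sum.distrib[symmetric]
    proof (intro sum.cong refl)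
      fix u assume "u \<in> Uc"
      then have x2: "2 * x (v u) = (2 - real (deg u)) * a u - UU u - 2 * ZU u" by (simp add: xV)
      show "(real (deg u) - 1) * (a u)\<^sup>2 + a u * (UU u + 2 * ZU u + 2 * x (v u)) = (a u)\<^sup>2"
        unfolding x2 by (simp add: power2_eq_square algebra_simps)
    qed
    then show ?thesis unfolding A B C zform_def by linarith
  qed
  then have le': "(\<Sum>u\<in>Uc. (a u)\<^sup>2) + zform 1 Z0 a \<le> 0" using le unfolding x_def by linarith
  have nn: "0 \<le> (\<Sum>u\<in>Uc. (a u)\<^sup>2)" by (simp add: sum_nonneg)
  have "zform 1 Z0 a \<le> 0" using le' nn by linarith
  moreover have "\<exists>z\<in>Z0. a z \<noteq> 0"
  proof (rule ccontr)
    assume none: "\<not> (\<exists>z\<in>Z0. a z \<noteq> 0)"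
    then have "zform 1 Z0 a = 0" by (simp add: zform_def)
    then have "(\<Sum>v\<in>Uc. (a v)\<^sup>2) = 0" using le' nn by linarith
    then have "\<forall>v\<in>Uc. a v = 0" by (simp add: sum_nonneg_eq_0_iff fin)
    then show False using nz none by blast
  qed
  moreover have "(\<Sum>z\<in>Z0. D d z * a z) = 0" if "d \<in> Dx" for d
  proof -
    have "(\<Sum>j\<in>?I. ?D d j * a j) = (\<Sum>j\<in>Uc. ?D d j * a j) + (\<Sum>j\<in>Z0. ?D d j * a j)"
      by (rule sum.union_disjoint[OF fin dis])
    also have "(\<Sum>j\<in>Uc. ?D d j * a j) = 0" by (rule sum.neutral) (use dis in auto)
    finally show ?thesis using D[OF that] by simp
  qed
  ultimately show ?thesis using that by blast
qed

end

section \<open>Definiteness of small symmetric matrices with prescribed diagonal\<close>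

text \<open>The family \<open>pd1\<close> to \<open>pd4\<close> tests pivots of symmetric
  elimination, where each reduced matrix is the Schur complement multiplied by the pivot, to avoid
  quotients. The flag \<open>st\<close> concerns only the last pivot: strict for definiteness, weak
  for semidefiniteness.\<close>

definition pd1 :: "bool \<Rightarrow> real \<Rightarrow> bool" where
  "pd1 st a \<longleftrightarrow> (if st then 0 < a else 0 \<le> a)"

definition pd2 :: "bool \<Rightarrow> real \<Rightarrow> real \<Rightarrow> real \<Rightarrow> bool" where
  "pd2 st a b e \<longleftrightarrow> 0 < a \<and> pd1 st (a * b - e * e)"

definition pd3 :: "bool \<Rightarrow> real \<Rightarrow> real \<Rightarrow> real \<Rightarrow> real \<Rightarrow> real \<Rightarrow> real \<Rightarrow> bool" where
  "pd3 st a b c e01 e02 e12 \<longleftrightarrow> 0 < a \<and>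
     pd2 st (a * b - e01 * e01) (a * c - e02 * e02) (a * e12 - e01 * e02)"

definition pd4 :: "bool \<Rightarrow> real \<Rightarrow> real \<Rightarrow> real \<Rightarrow> real \<Rightarrow> real \<Rightarrow> real \<Rightarrow> real \<Rightarrow> real \<Rightarrow> real \<Rightarrow> real \<Rightarrow> bool" where
  "pd4 st a b c d e01 e02 e03 e12 e13 e23 \<longleftrightarrow> 0 < a \<and>
     pd3 st (a * b - e01 * e01) (a * c - e02 * e02) (a * d - e03 * e03)
       (a * e12 - e01 * e02) (a * e13 - e01 * e03) (a * e23 - e02 * e03)"

lemmas pd_defs = pd1_def pd2_def pd3_def pd4_def

text \<open>Symmetric Gaussian elimination: each step completes the square in the first variable.\<close>

lemma pd2_form:
  fixes y0 y1 :: real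
  assumes "pd2 st a b e"
  defines "f \<equiv> a * y0\<^sup>2 + b * y1\<^sup>2 + 2 * (e * (y0 * y1))"
  shows "0 \<le> f" and "st \<Longrightarrow> f \<le> 0 \<Longrightarrow> y0 = 0 \<and> y1 = 0"
proof -
  let ?m = "a * b - e * e"
  have a: "0 < a" and m: "0 \<le> ?m" "st \<Longrightarrow> 0 < ?m" using assms by (auto simp: pd_defs split: if_splits)
  have id: "a * f = (a * y0 + e * y1)\<^sup>2 + ?m * y1\<^sup>2"
    by (simp add: f_def power2_eq_square algebra_simps)
  have "0 \<le> a * f" unfolding id using m by simp
  then show "0 \<le> f" using a by (simp add: zero_le_mult_iff)
  assume st: st and "f \<le> 0"
  then have "a * f \<le> 0" using a by (simp add: mult_le_0_iff)
  moreover have "0 \<le> ?m * y1\<^sup>2" using m by simp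
  ultimately have "?m * y1\<^sup>2 = 0" "(a * y0 + e * y1)\<^sup>2 = 0"
    unfolding id by (smt (verit) zero_le_power2)+
  then show "y0 = 0 \<and> y1 = 0" using m(2)[OF st] a by simp
qed

lemma pd3_form:
  fixes y0 y1 y2 :: real
  assumes "pd3 st a b c e01 e02 e12"
  defines "f \<equiv> a * y0\<^sup>2 + b * y1\<^sup>2 + c * y2\<^sup>2 + 2 * (e01 * (y0 * y1) + e02 * (y0 * y2) + e12 * (y1 * y2))"
  shows "0 \<le> f" and "st \<Longrightarrow> f \<le> 0 \<Longrightarrow> y0 = 0 \<and> y1 = 0 \<and> y2 = 0"
proof -
  have a: "0 < a" and m: "pd2 st (a * b - e01 * e01) (a * c - e02 * e02) (a * e12 - e01 * e02)"
    using assms by (auto simp: pd3_def)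
  define g where "g = (a * b - e01 * e01) * y1\<^sup>2 + (a * c - e02 * e02) * y2\<^sup>2
    + 2 * ((a * e12 - e01 * e02) * (y1 * y2))"
  note G = pd2_form[OF m, of y1 y2, folded g_def]
  have id: "a * f = (a * y0 + e01 * y1 + e02 * y2)\<^sup>2 + g"
    by (simp add: f_def g_def power2_eq_square algebra_simps)
  have "0 \<le> a * f" unfolding id using G(1) by simp
  then show "0 \<le> f" using a by (simp add: zero_le_mult_iff)
  assume st: st and "f \<le> 0"
  then have "a * f \<le> 0" using a by (simp add: mult_le_0_iff)
  then have "g \<le> 0" "(a * y0 + e01 * y1 + e02 * y2)\<^sup>2 = 0"
    using G(1) unfolding id by (smt (verit) zero_le_power2)+
  then show "y0 = 0 \<and> y1 = 0 \<and> y2 = 0" using G(2)[OF st] a by simp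
qed

lemma pd4_form:
  fixes y0 y1 y2 y3 :: real
  assumes "pd4 st a b c d e01 e02 e03 e12 e13 e23"
  defines "f \<equiv> a * y0\<^sup>2 + b * y1\<^sup>2 + c * y2\<^sup>2 + d * y3\<^sup>2 + 2 * (e01 * (y0 * y1) + e02 * (y0 * y2)
    + e03 * (y0 * y3) + e12 * (y1 * y2) + e13 * (y1 * y3) + e23 * (y2 * y3))"
  shows "0 \<le> f" and "st \<Longrightarrow> f \<le> 0 \<Longrightarrow> y0 = 0 \<and> y1 = 0 \<and> y2 = 0 \<and> y3 = 0"
proof -
  have a: "0 < a" and m: "pd3 st (a * b - e01 * e01) (a * c - e02 * e02) (a * d - e03 * e03)
       (a * e12 - e01 * e02) (a * e13 - e01 * e03) (a * e23 - e02 * e03)"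
    using assms by (auto simp: pd4_def)
  define g where "g = (a * b - e01 * e01) * y1\<^sup>2 + (a * c - e02 * e02) * y2\<^sup>2 + (a * d - e03 * e03) * y3\<^sup>2
    + 2 * ((a * e12 - e01 * e02) * (y1 * y2) + (a * e13 - e01 * e03) * (y1 * y3)
      + (a * e23 - e02 * e03) * (y2 * y3))"
  note G = pd3_form[OF m, of y1 y2 y3, folded g_def]
  have id: "a * f = (a * y0 + e01 * y1 + e02 * y2 + e03 * y3)\<^sup>2 + g"
    by (simp add: f_def g_def power2_eq_square algebra_simps)
  have "0 \<le> a * f" unfolding id using G(1) by simp
  then show "0 \<le> f" using a by (simp add: zero_le_mult_iff)
  assume st: st and "f \<le> 0"
  then have "a * f \<le> 0" using a by (simp add: mult_le_0_iff)
  then have "g \<le> 0" "(a * y0 + e01 * y1 + e02 * y2 + e03 * y3)\<^sup>2 = 0"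
    using G(1) unfolding id by (smt (verit) zero_le_power2)+
  then show "y0 = 0 \<and> y1 = 0 \<and> y2 = 0 \<and> y3 = 0" using G(2)[OF st] a by simp
qed

definition ind :: "bool \<Rightarrow> real" where "ind b = (if b then 1 else 0)"

text \<open>Degrees \<open>2, 3, 3, 4\<close> less the threshold \<open>1\<close> give the diagonal,
  and the assumptions forbid triangles. The extra disjuncts are edge patterns covering the graphs
  that fail the test.\<close>

lemma diag_1223:
  assumes "\<not> (b01 \<and> b12 \<and> b02)" "\<not> (b01 \<and> b13 \<and> b03)" "\<not> (b02 \<and> b23 \<and> b03)" "\<not> (b12 \<and> b23 \<and> b13)"
  shows "pd4 False 1 2 2 3 (ind b01) (ind b02) (ind b03) (ind b12) (ind b13) (ind b23) \<or>
    (b02 \<and> b03 \<and> b12 \<and> b13) \<or> (b01 \<and> b03 \<and> b12 \<and> b23) \<or> (b01 \<and> b02)"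
  using assms by (cases b01; cases b02; cases b03; cases b12; cases b13; cases b23; simp add: pd_defs ind_def)

lemma diag_1123:
  assumes "\<not> (b01 \<and> b12 \<and> b02)" "\<not> (b01 \<and> b13 \<and> b03)" "\<not> (b02 \<and> b23 \<and> b03)" "\<not> (b12 \<and> b23 \<and> b13)"
  shows "pd4 False 1 1 2 3 (ind b01) (ind b02) (ind b03) (ind b12) (ind b13) (ind b23) \<or>
    (b02 \<and> b12) \<or> (b01)"
  using assms by (cases b01; cases b02; cases b03; cases b12; cases b13; cases b23; simp add: pd_defs ind_def)

text \<open>Entries multiplied by five: \<open>6 = 5 * (2 - 4 / 5)\<close>,
  \<open>11 = 5 * (3 - 4 / 5)\<close>, and \<open>5\<close> for an edge.\<close>

lemma diag_66:
  shows "pd4 True 6 6 11 11 (5 * ind b01) (5 * ind b02) (5 * ind b03) (5 * ind b12) (5 * ind b13) (5 * ind b23) \<or>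
    (\<not> b01 \<and> b02 \<and> b03 \<and> b12 \<and> b13) \<or> (b01 \<and> \<not> b03 \<and> b13) \<or> (b01 \<and> \<not> b02 \<and> b12) \<or> (b01 \<and> b03 \<and> \<not> b13) \<or> (b01 \<and> b02 \<and> \<not> b12)"
  by (cases b01; cases b02; cases b03; cases b12; cases b13; cases b23; simp add: pd_defs ind_def)

lemma diag_666:
  shows "pd4 True 6 6 6 11 (5 * ind b01) (5 * ind b02) (5 * ind b03) (5 * ind b12) (5 * ind b13) (5 * ind b23) \<or>
    (b12 \<and> \<not> b13 \<and> b23) \<or> (b12 \<and> b13 \<and> \<not> b23) \<or> (\<not> b01 \<and> \<not> b02 \<and> b03 \<and> \<not> b12 \<and> b13 \<and> b23) \<or> (b02 \<and> \<not> b03 \<and> b23) \<or> (\<not> b01 \<and> b02 \<and> b12) \<or> (b02 \<and> b03 \<and> \<not> b23) \<or> (b01 \<and> \<not> b03 \<and> b13) \<or> (b01 \<and> \<not> b02 \<and> b12) \<or> (b01 \<and> b03 \<and> \<not> b13) \<or> (b01 \<and> b02 \<and> \<not> b12)"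
  by (cases b01; cases b02; cases b03; cases b12; cases b13; cases b23; simp add: pd_defs ind_def)

lemma diag_6:
  shows "pd4 True 6 11 11 11 (5 * ind b01) (5 * ind b02) (5 * ind b03) (5 * ind b12) (5 * ind b13) (5 * ind b23) \<or>
    (\<not> b01 \<and> b02 \<and> b03 \<and> b12 \<and> b13 \<and> \<not> b23) \<or> (b01 \<and> \<not> b02 \<and> b03 \<and> b12 \<and> \<not> b13 \<and> b23) \<or> (b01 \<and> b02 \<and> \<not> b03 \<and> \<not> b12 \<and> b13 \<and> b23) \<or> (b01 \<and> b02 \<and> b03 \<and> \<not> b12 \<and> \<not> b13 \<and> \<not> b23)"
  by (cases b01; cases b02; cases b03; cases b12; cases b13; cases b23; simp add: pd_defs ind_def)

lemma four_vertices_pos: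
  assumes "\<not> (b01 \<and> b12 \<and> b02)" "\<not> (b01 \<and> b13 \<and> b03)" "\<not> (b02 \<and> b23 \<and> b03)" "\<not> (b12 \<and> b23 \<and> b13)"
  shows "pd3 True 1 2 2 (ind b12) (ind b13) (ind b23) \<or>
    pd3 True 1 2 2 (ind b02) (ind b03) (ind b23) \<or>
    b02 \<and> b03 \<and> b12 \<and> b13"
  using assms by (cases b01; cases b02; cases b03; cases b12; cases b13; cases b23; simp add: pd_defs ind_def)

text \<open>\<open>P0\<close> to \<open>P3\<close> stand for the tests after deleting vertex
  \<open>0\<close> to \<open>3\<close>. Keeping them abstract leaves a propositional problem in
  place of arithmetic over all choices of ten edges.\<close>

lemma five_nonneg_prop:
  assumes "P0 \<or> (b13 \<and> b14 \<and> b23 \<and> b24) \<or> (b12 \<and> b14 \<and> b23 \<and> b34) \<or> (b12 \<and> b13)"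
    "P1 \<or> (b03 \<and> b04 \<and> b23 \<and> b24) \<or> (b02 \<and> b04 \<and> b23 \<and> b34) \<or> (b02 \<and> b03)"
    "P2 \<or> (b03 \<and> b13) \<or> (b01)"
    "P3 \<or> (b02 \<and> b12) \<or> (b01)" "\<not> (b01 \<and> b12 \<and> b02)" "\<not> (b01 \<and> b13 \<and> b03)" "\<not> (b01 \<and> b14 \<and> b04)" "\<not> (b02 \<and> b23 \<and> b03)" "\<not> (b02 \<and> b24 \<and> b04)" "\<not> (b03 \<and> b34 \<and> b04)" "\<not> (b12 \<and> b23 \<and> b13)" "\<not> (b12 \<and> b24 \<and> b14)" "\<not> (b13 \<and> b34 \<and> b14)" "\<not> (b23 \<and> b34 \<and> b24)"
  shows "P0 \<or> P1 \<or> P2 \<or> P3 \<or> (b02 \<and> b03 \<and> b12 \<and> b13)"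
  using assms by satx

text \<open>With degrees at least \<open>2, 2, 3, 3, 4\<close>, the pattern escaping all four
  deletions contains the four-cycle with sides \<open>{0, 1}\<close> and
  \<open>{2, 3}\<close>.\<close>

lemma five_vertices_nonneg:
  assumes "\<not> (b01 \<and> b12 \<and> b02)" "\<not> (b01 \<and> b13 \<and> b03)" "\<not> (b01 \<and> b14 \<and> b04)" "\<not> (b02 \<and> b23 \<and> b03)" "\<not> (b02 \<and> b24 \<and> b04)" "\<not> (b03 \<and> b34 \<and> b04)" "\<not> (b12 \<and> b23 \<and> b13)" "\<not> (b12 \<and> b24 \<and> b14)" "\<not> (b13 \<and> b34 \<and> b14)" "\<not> (b23 \<and> b34 \<and> b24)"
  shows "pd4 False 1 2 2 3 (ind b12) (ind b13) (ind b14) (ind b23) (ind b24) (ind b34) \<or>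
    pd4 False 1 2 2 3 (ind b02) (ind b03) (ind b04) (ind b23) (ind b24) (ind b34) \<or>
    pd4 False 1 1 2 3 (ind b01) (ind b03) (ind b04) (ind b13) (ind b14) (ind b34) \<or>
    pd4 False 1 1 2 3 (ind b01) (ind b02) (ind b04) (ind b12) (ind b14) (ind b24) \<or>
    b02 \<and> b03 \<and> b12 \<and> b13"
  by (rule five_nonneg_prop[OF diag_1223[where ?b01.0 = b12 and ?b02.0 = b13 and ?b03.0 = b14 and ?b12.0 = b23 and ?b13.0 = b24 and ?b23.0 = b34] diag_1223[where ?b01.0 = b02 and ?b02.0 = b03 and ?b03.0 = b04 and ?b12.0 = b23 and ?b13.0 = b24 and ?b23.0 = b34] diag_1123[where ?b01.0 = b01 and ?b02.0 = b03 and ?b03.0 = b04 and ?b12.0 = b13 and ?b13.0 = b14 and ?b23.0 = b34] diag_1123[where ?b01.0 = b01 and ?b02.0 = b02 and ?b03.0 = b04 and ?b12.0 = b12 and ?b13.0 = b14 and ?b23.0 = b24]]) (rule assms)+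

lemma five_scaled_3_prop:
  assumes "P0 \<or> (\<not> b12 \<and> b13 \<and> b14 \<and> b23 \<and> b24) \<or> (b12 \<and> \<not> b14 \<and> b24) \<or> (b12 \<and> \<not> b13 \<and> b23) \<or> (b12 \<and> b14 \<and> \<not> b24) \<or> (b12 \<and> b13 \<and> \<not> b23)"
    "P1 \<or> (\<not> b02 \<and> b03 \<and> b04 \<and> b23 \<and> b24) \<or> (b02 \<and> \<not> b04 \<and> b24) \<or> (b02 \<and> \<not> b03 \<and> b23) \<or> (b02 \<and> b04 \<and> \<not> b24) \<or> (b02 \<and> b03 \<and> \<not> b23)"
    "P2 \<or> (\<not> b01 \<and> b03 \<and> b04 \<and> b13 \<and> b14) \<or> (b01 \<and> \<not> b04 \<and> b14) \<or> (b01 \<and> \<not> b03 \<and> b13) \<or> (b01 \<and> b04 \<and> \<not> b14) \<or> (b01 \<and> b03 \<and> \<not> b13)"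
    "P3 \<or> (b12 \<and> \<not> b14 \<and> b24) \<or> (b12 \<and> b14 \<and> \<not> b24) \<or> (\<not> b01 \<and> \<not> b02 \<and> b04 \<and> \<not> b12 \<and> b14 \<and> b24) \<or> (b02 \<and> \<not> b04 \<and> b24) \<or> (\<not> b01 \<and> b02 \<and> b12) \<or> (b02 \<and> b04 \<and> \<not> b24) \<or> (b01 \<and> \<not> b04 \<and> b14) \<or> (b01 \<and> \<not> b02 \<and> b12) \<or> (b01 \<and> b04 \<and> \<not> b14) \<or> (b01 \<and> b02 \<and> \<not> b12)"
    "P4 \<or> (b12 \<and> \<not> b13 \<and> b23) \<or> (b12 \<and> b13 \<and> \<not> b23) \<or> (\<not> b01 \<and> \<not> b02 \<and> b03 \<and> \<not> b12 \<and> b13 \<and> b23) \<or> (b02 \<and> \<not> b03 \<and> b23) \<or> (\<not> b01 \<and> b02 \<and> b12) \<or> (b02 \<and> b03 \<and> \<not> b23) \<or> (b01 \<and> \<not> b03 \<and> b13) \<or> (b01 \<and> \<not> b02 \<and> b12) \<or> (b01 \<and> b03 \<and> \<not> b13) \<or> (b01 \<and> b02 \<and> \<not> b12)" "\<not> (b01 \<and> b02 \<and> b03)" "\<not> (b01 \<and> b02 \<and> b04)" "\<not> (b01 \<and> b03 \<and> b04)" "\<not> (b02 \<and> b03 \<and> b04)" "\<not> (b01 \<and> b12 \<and> b13)" "\<not> (b01 \<and> b12 \<and> b14)" "\<not> (b01 \<and> b13 \<and> b14)" "\<not> (b12 \<and> b13 \<and> b14)" "\<not> (b02 \<and> b12 \<and>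 b23)" "\<not> (b02 \<and> b12 \<and> b24)" "\<not> (b02 \<and> b23 \<and> b24)" "\<not> (b12 \<and> b23 \<and> b24)" "\<not> (b03 \<and> b13 \<and> b23 \<and> b34)" "\<not> (b04 \<and> b14 \<and> b24 \<and> b34)"
  shows "P0 \<or> P1 \<or> P2 \<or> P3 \<or> P4 \<or> (\<not> b01 \<and> \<not> b02 \<and> \<not> b12 \<and> b03 \<and> b04 \<and> b13 \<and> b14 \<and> b23 \<and> b24 \<and> \<not> b34)"
  using assms by satx

text \<open>Degrees \<open>2, 2, 2, 3, 3\<close>: the assumptions say that no vertex has more
  neighbours than its degree. The exception is the complete bipartite graph with sides
  \<open>{0, 1, 2}\<close> and \<open>{3, 4}\<close>.\<close>

lemma five_vertices_scaled_pos_3: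
  assumes "\<not> (b01 \<and> b02 \<and> b03)" "\<not> (b01 \<and> b02 \<and> b04)" "\<not> (b01 \<and> b03 \<and> b04)" "\<not> (b02 \<and> b03 \<and> b04)" "\<not> (b01 \<and> b12 \<and> b13)" "\<not> (b01 \<and> b12 \<and> b14)" "\<not> (b01 \<and> b13 \<and> b14)" "\<not> (b12 \<and> b13 \<and> b14)" "\<not> (b02 \<and> b12 \<and> b23)" "\<not> (b02 \<and> b12 \<and> b24)" "\<not> (b02 \<and> b23 \<and> b24)" "\<not> (b12 \<and> b23 \<and> b24)" "\<not> (b03 \<and> b13 \<and> b23 \<and> b34)" "\<not> (b04 \<and> b14 \<and> b24 \<and> b34)"
  shows "pd4 True 6 6 11 11 (5 * ind b12) (5 * ind b13) (5 * ind b14) (5 * ind b23) (5 * ind b24) (5 * ind b34) \<or>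
    pd4 True 6 6 11 11 (5 * ind b02) (5 * ind b03) (5 * ind b04) (5 * ind b23) (5 * ind b24) (5 * ind b34) \<or>
    pd4 True 6 6 11 11 (5 * ind b01) (5 * ind b03) (5 * ind b04) (5 * ind b13) (5 * ind b14) (5 * ind b34) \<or>
    pd4 True 6 6 6 11 (5 * ind b01) (5 * ind b02) (5 * ind b04) (5 * ind b12) (5 * ind b14) (5 * ind b24) \<or>
    pd4 True 6 6 6 11 (5 * ind b01) (5 * ind b02) (5 * ind b03) (5 * ind b12) (5 * ind b13) (5 * ind b23) \<or>
    \<not> b01 \<and> \<not> b02 \<and> \<not> b12 \<and> b03 \<and> b04 \<and> b13 \<and> b14 \<and> b23 \<and> b24 \<and> \<not> b34"
  by (rule five_scaled_3_prop[OF diag_66[where ?b01.0 = b12 and ?b02.0 = b13 and ?b03.0 = b14 and ?b12.0 = b23 and ?b13.0 = b24 and ?b23.0 = b34] diag_66[where ?b01.0 = b02 and ?b02.0 = b03 and ?b03.0 = b04 and ?b12.0 = b23 and ?b13.0 = b24 and ?b23.0 = b34] diag_66[where ?b01.0 = b01 and ?b02.0 = b03 and ?b03.0 = b04 and ?b12.0 = b13 and ?b13.0 = b14 and ?b23.0 = b34] diag_666[where ?b01.0 = b01 and ?b02.0 = b02 and ?b03.0 = b04 and ?b12.0 = b12 and ?b13.0 = b14 and ?b23.0 = b24] diag_666[where ?b01.0 = b01 and ?b02.0 = b02 and ?b03.0 = b03 and ?b12.0 = b12 and ?b13.0 = b13 and ?b23.0 = b23]]) (rule assms)+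

lemma five_scaled_2_prop:
  assumes "P0 \<or> (\<not> b12 \<and> b13 \<and> b14 \<and> b23 \<and> b24 \<and> \<not> b34) \<or> (b12 \<and> \<not> b13 \<and> b14 \<and> b23 \<and> \<not> b24 \<and> b34) \<or> (b12 \<and> b13 \<and> \<not> b14 \<and> \<not> b23 \<and> b24 \<and> b34) \<or> (b12 \<and> b13 \<and> b14 \<and> \<not> b23 \<and> \<not> b24 \<and> \<not> b34)"
    "P1 \<or> (\<not> b02 \<and> b03 \<and> b04 \<and> b23 \<and> b24 \<and> \<not> b34) \<or> (b02 \<and> \<not> b03 \<and> b04 \<and> b23 \<and> \<not> b24 \<and> b34) \<or> (b02 \<and> b03 \<and> \<not> b04 \<and> \<not> b23 \<and> b24 \<and> b34) \<or> (b02 \<and> b03 \<and> b04 \<and> \<not> b23 \<and> \<not> b24 \<and> \<not> b34)"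
    "P2 \<or> (\<not> b01 \<and> b03 \<and> b04 \<and> b13 \<and> b14) \<or> (b01 \<and> \<not> b04 \<and> b14) \<or> (b01 \<and> \<not> b03 \<and> b13) \<or> (b01 \<and> b04 \<and> \<not> b14) \<or> (b01 \<and> b03 \<and> \<not> b13)"
    "P3 \<or> (\<not> b01 \<and> b02 \<and> b04 \<and> b12 \<and> b14) \<or> (b01 \<and> \<not> b04 \<and> b14) \<or> (b01 \<and> \<not> b02 \<and> b12) \<or> (b01 \<and> b04 \<and> \<not> b14) \<or> (b01 \<and> b02 \<and> \<not> b12)"
    "P4 \<or> (\<not> b01 \<and> b02 \<and> b03 \<and> b12 \<and> b13) \<or> (b01 \<and> \<not> b03 \<and> b13) \<or> (b01 \<and> \<not> b02 \<and> b12) \<or> (b01 \<and> b03 \<and> \<not> b13) \<or> (b01 \<and> b02 \<and> \<not> b12)"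
  shows "P0 \<or> P1 \<or> P2 \<or> P3 \<or> P4 \<or> (\<not> b01 \<and> b02 \<and> b03 \<and> b04 \<and> b12 \<and> b13 \<and> b14 \<and> \<not> b23 \<and> \<not> b24 \<and> \<not> b34)"
  using assms by satx

text \<open>The diagonal belongs to degrees \<open>2, 2, 3, 3, 3\<close>; the exception is the
  complete bipartite graph with sides \<open>{0, 1}\<close> and \<open>{2, 3, 4}\<close>.\<close>

lemma five_vertices_scaled_pos_2:
  shows "pd4 True 6 11 11 11 (5 * ind b12) (5 * ind b13) (5 * ind b14) (5 * ind b23) (5 * ind b24) (5 * ind b34) \<or>
    pd4 True 6 11 11 11 (5 * ind b02) (5 * ind b03) (5 * ind b04) (5 * ind b23) (5 * ind b24) (5 * ind b34) \<or>
    pd4 True 6 6 11 11 (5 * ind b01) (5 * ind b03) (5 * ind b04) (5 * ind b13) (5 * ind b14) (5 * ind b34) \<or>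
    pd4 True 6 6 11 11 (5 * ind b01) (5 * ind b02) (5 * ind b04) (5 * ind b12) (5 * ind b14) (5 * ind b24) \<or>
    pd4 True 6 6 11 11 (5 * ind b01) (5 * ind b02) (5 * ind b03) (5 * ind b12) (5 * ind b13) (5 * ind b23) \<or>
    \<not> b01 \<and> b02 \<and> b03 \<and> b04 \<and> b12 \<and> b13 \<and> b14 \<and> \<not> b23 \<and> \<not> b24 \<and> \<not> b34"
  by (rule five_scaled_2_prop[OF diag_6[where ?b01.0 = b12 and ?b02.0 = b13 and ?b03.0 = b14 and ?b12.0 = b23 and ?b13.0 = b24 and ?b23.0 = b34] diag_6[where ?b01.0 = b02 and ?b02.0 = b03 and ?b03.0 = b04 and ?b12.0 = b23 and ?b13.0 = b24 and ?b23.0 = b34] diag_66[where ?b01.0 = b01 and ?b02.0 = b03 and ?b03.0 = b04 and ?b12.0 = b13 and ?b13.0 = b14 and ?b23.0 = b34] diag_66[where ?b01.0 = b01 and ?b02.0 = b02 and ?b03.0 = b04 and ?b12.0 = b12 and ?b13.0 = b14 and ?b23.0 = b24] diag_66[where ?b01.0 = b01 and ?b02.0 = b02 and ?b03.0 = b03 and ?b12.0 = b12 and ?b13.0 = b13 and ?b23.0 = b23]])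

lemma double_product_le: "2 * (x * y) \<le> x\<^sup>2 + y\<^sup>2" "- (2 * (x * y)) \<le> x\<^sup>2 + y\<^sup>2" for x y :: real
  using sum_squares_bound[of x y] sum_squares_bound[of "- x" y] by (simp_all add: mult.assoc)

text \<open>What remains of the five-vertex form with a four-cycle after setting
  \<open>x1 = - x0\<close>. Each of the three couplings to \<open>x4\<close> is paid for by one unit
  of the coefficient of \<open>x4\<^sup>2\<close>.\<close>

lemma c4_form:
  fixes x0 x2 x3 x4 :: real
  assumes "\<not> (b0 \<and> b2)" "\<not> (b0 \<and> b3)" "\<not> (b1 \<and> b2)" "\<not> (b1 \<and> b3)"
  shows "0 \<le> 2 * x0\<^sup>2 + 2 * x2\<^sup>2 + 2 * x3\<^sup>2 + 3 * x4\<^sup>2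
    + 2 * ((ind b0 - ind b1) * (x0 * x4)) + 2 * (ind b2 * (x2 * x4)) + 2 * (ind b3 * (x3 * x4))"
proof -
  have nn: "0 \<le> x0\<^sup>2" "0 \<le> x2\<^sup>2" "0 \<le> x3\<^sup>2" "0 \<le> x4\<^sup>2" by auto
  have A: "0 \<le> x0\<^sup>2 + x4\<^sup>2 + 2 * ((ind b0 - ind b1) * (x0 * x4))"
    using double_product_le[of x0 x4] nn by (cases b0; cases b1) (simp_all add: ind_def)
  have B: "0 \<le> x2\<^sup>2 + x4\<^sup>2 + 2 * (ind b2 * (x2 * x4))" "0 \<le> x3\<^sup>2 + x4\<^sup>2 + 2 * (ind b3 * (x3 * x4))"
    using double_product_le[of x2 x4] double_product_le[of x3 x4] nn
    by (cases b2; cases b3; simp add: ind_def)+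
  show ?thesis using A B nn by linarith
qed

section \<open>One linear condition suffices on four or five core vertices\<close>

context jellyfish_mate
begin

lemma adj_ind: "adj F u v = ind (F u v)"
  by (simp add: adj_def ind_def)

lemma zform_insert_zero:
  assumes "finite S" "z \<notin> S" "a z = 0"
  shows "zform t (insert z S) a = zform t S a"
  using assms by (simp add: zform_def)

lemma zform_five:
  assumes "distinct [z0, z1, z2, z3, z4]"
  shows "zform t {z0, z1, z2, z3, z4} a = (real (deg z0) - t) * (a z0)\<^sup>2 + (real (deg z1) - t) * (a z1)\<^sup>2
    + (real (deg z2) - t) * (a z2)\<^sup>2 + (real (deg z3) - t) * (a z3)\<^sup>2 + (real (deg z4) - t) * (a z4)\<^sup>2
    + 2 * (ind (F z0 z1) * (a z0 * a z1) + ind (F z0 z2) * (a z0 * a z2) + ind (F z0 z3) * (a z0 * a z3)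
      + ind (F z0 z4) * (a z0 * a z4) + ind (F z1 z2) * (a z1 * a z2) + ind (F z1 z3) * (a z1 * a z3)
      + ind (F z1 z4) * (a z1 * a z4) + ind (F z2 z3) * (a z2 * a z3) + ind (F z2 z4) * (a z2 * a z4)
      + ind (F z3 z4) * (a z3 * a z4))"
  using assms unfolding zform_def adj_ind[symmetric]
  by (simp add: adj_F_irrefl adj_F_sym[of z1 z0] adj_F_sym[of z2 z0] adj_F_sym[of z3 z0] adj_F_sym[of z4 z0]
      adj_F_sym[of z2 z1] adj_F_sym[of z3 z1] adj_F_sym[of z4 z1] adj_F_sym[of z3 z2] adj_F_sym[of z4 z2]
      adj_F_sym[of z4 z3] algebra_simps)

lemma zform_four:
  assumes "distinct [z0, z1, z2, z3]"
  shows "zform t {z0, z1, z2, z3} a = (real (deg z0) - t) * (a z0)\<^sup>2 + (real (deg z1) - t) * (a z1)\<^sup>2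
    + (real (deg z2) - t) * (a z2)\<^sup>2 + (real (deg z3) - t) * (a z3)\<^sup>2
    + 2 * (ind (F z0 z1) * (a z0 * a z1) + ind (F z0 z2) * (a z0 * a z2) + ind (F z0 z3) * (a z0 * a z3)
      + ind (F z1 z2) * (a z1 * a z2) + ind (F z1 z3) * (a z1 * a z3) + ind (F z2 z3) * (a z2 * a z3))"
  using assms unfolding zform_def adj_ind[symmetric]
  by (simp add: adj_F_irrefl adj_F_sym[of z1 z0] adj_F_sym[of z2 z0] adj_F_sym[of z3 z0]
      adj_F_sym[of z2 z1] adj_F_sym[of z3 z1] adj_F_sym[of z3 z2] algebra_simps)

lemma sorted_by_degree:
  assumes "finite S"
  obtains ys where "distinct ys" "set ys = S" "length ys = card S" "sorted (map deg ys)"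
proof -
  obtain zs where zs: "distinct zs" "set zs = S" using finite_distinct_list[OF assms] by blast
  show ?thesis
    by (rule that[of "sort_key deg zs"]) (use zs distinct_card[of zs] in auto)
qed

text \<open>Otherwise the first \<open>i + 1\<close> entries would all have degree at most
  \<open>k\<close>, more than there are such core vertices.\<close>

lemma sorted_degree_gt:
  assumes ys: "distinct ys" "set ys \<subseteq> Core" "sorted (map deg ys)" and i: "i < length ys"
    and card: "card {v \<in> Core. deg v \<le> k} \<le> i"
  shows "k < deg (ys ! i)"
proof (rule ccontr)
  assume "\<not> k < deg (ys ! i)"
  then have le: "deg (ys ! j) \<le> k" if "j \<le> i" for j
    using sorted_nth_mono[OF ys(3) that] i that by simp
  have "inj_on ((!) ys) {..i}" using ys(1) i by (auto simp: inj_on_def nth_eq_iff_index_eq)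
  then have "card ((!) ys ` {..i}) = Suc i" by (simp add: card_image)
  moreover have "(!) ys ` {..i} \<subseteq> {v \<in> Core. deg v \<le> k}"
  proof
    fix v assume "v \<in> (!) ys ` {..i}"
    then obtain j where j: "j \<le> i" "v = ys ! j" by auto
    then have "v \<in> set ys" using i by simp
    then show "v \<in> {v \<in> Core. deg v \<le> k}" using ys(2) le[OF j(1)] j(2) by auto
  qed
  then have "card ((!) ys ` {..i}) \<le> card {v \<in> Core. deg v \<le> k}"
    by (rule card_mono[rotated]) (simp add: class_finite)
  ultimately show False using card by simp
qed

lemma coeff_mono: "r \<le> s \<Longrightarrow> r * (y::real)\<^sup>2 \<le> s * y\<^sup>2"
  by (rule mult_right_mono) auto

text \<open>One condition is what the counts can afford when \<open>card Core = q + 2\<close>.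
  Usually it deletes a vertex; the exceptional four-cycle needs a different hyperplane.\<close>

lemma hyperplane_five_nonneg:
  assumes dist: "distinct [z0, z1, z2, z3, z4]"
    and deg: "2 \<le> deg z0" "2 \<le> deg z1" "3 \<le> deg z2" "3 \<le> deg z3" "4 \<le> deg z4"
    and tf: "tri n F = 0"
  shows "\<exists>c. \<forall>a. (\<Sum>z\<in>{z0, z1, z2, z3, z4}. c z * a z) = 0 \<longrightarrow> 0 \<le> zform 1 {z0, z1, z2, z3, z4} a"
proof -
  let ?S = "{z0, z1, z2, z3, z4}"
  note form = zform_five[OF dist, of 1]
  have no: "\<not> (F u v \<and> F v w \<and> F u w)" for u v w
    using no_triangle[OF tf, of u v w] F_sym by blast
  have D: "1 * (a z0)\<^sup>2 \<le> (real (deg z0) - 1) * (a z0)\<^sup>2" "1 * (a z1)\<^sup>2 \<le> (real (deg z1) - 1) * (a z1)\<^sup>2"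
    "2 * (a z2)\<^sup>2 \<le> (real (deg z2) - 1) * (a z2)\<^sup>2" "2 * (a z3)\<^sup>2 \<le> (real (deg z3) - 1) * (a z3)\<^sup>2"
    "3 * (a z4)\<^sup>2 \<le> (real (deg z4) - 1) * (a z4)\<^sup>2" for a
    by (rule coeff_mono, use deg in linarith)+
  have single: "(\<Sum>z\<in>?S. of_bool (z = u) * a z) = a u" if "u \<in> ?S" for u and a :: "nat \<Rightarrow> real"
    using sum_of_bool_member[of ?S "\<lambda>z. if z \<in> ?S then a z else 0" u] that by (simp add: eq_commute)
  consider
      "pd4 False 1 2 2 3 (ind (F z1 z2)) (ind (F z1 z3)) (ind (F z1 z4)) (ind (F z2 z3)) (ind (F z2 z4)) (ind (F z3 z4))"
    | "pd4 False 1 2 2 3 (ind (F z0 z2)) (ind (F z0 z3)) (ind (F z0 z4)) (ind (F z2 z3)) (ind (F z2 z4)) (ind (F z3 z4))"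
    | "pd4 False 1 1 2 3 (ind (F z0 z1)) (ind (F z0 z3)) (ind (F z0 z4)) (ind (F z1 z3)) (ind (F z1 z4)) (ind (F z3 z4))"
    | "pd4 False 1 1 2 3 (ind (F z0 z1)) (ind (F z0 z2)) (ind (F z0 z4)) (ind (F z1 z2)) (ind (F z1 z4)) (ind (F z2 z4))"
    | "F z0 z2 \<and> F z0 z3 \<and> F z1 z2 \<and> F z1 z3"
    using five_vertices_nonneg[where ?b01.0 = "F z0 z1" and ?b02.0 = "F z0 z2" and ?b03.0 = "F z0 z3" and ?b04.0 = "F z0 z4" and ?b12.0 = "F z1 z2" and ?b13.0 = "F z1 z3" and ?b14.0 = "F z1 z4" and ?b23.0 = "F z2 z3" and ?b24.0 = "F z2 z4" and ?b34.0 = "F z3 z4", OF no no no no no no no no no no] by blast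
  then show ?thesis
  proof cases
    case 1
    show ?thesis
    proof (intro exI allI impI)
      fix a :: "nat \<Rightarrow> real" assume "(\<Sum>z\<in>?S. of_bool (z = z0) * a z) = 0"
      then have z: "a z0 = 0" using single[of z0 a] by simp
      show "0 \<le> zform 1 ?S a"
        using pd4_form(1)[OF 1, of "a z1" "a z2" "a z3" "a z4"] D[of a]
        unfolding form by (simp add: z)
    qed
  next
    case 2
    show ?thesis
    proof (intro exI allI impI)
      fix a :: "nat \<Rightarrow> real" assume "(\<Sum>z\<in>?S. of_bool (z = z1) * a z) = 0"
      then have z: "a z1 = 0" using single[of z1 a] by simp
      show "0 \<le> zform 1 ?S a"
        using pd4_form(1)[OF 2, of "a z0" "a z2" "a z3" "a z4"] D[of a]
        unfolding form by (simp add: z)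
    qed
  next
    case 3
    show ?thesis
    proof (intro exI allI impI)
      fix a :: "nat \<Rightarrow> real" assume "(\<Sum>z\<in>?S. of_bool (z = z2) * a z) = 0"
      then have z: "a z2 = 0" using single[of z2 a] by simp
      show "0 \<le> zform 1 ?S a"
        using pd4_form(1)[OF 3, of "a z0" "a z1" "a z3" "a z4"] D[of a]
        unfolding form by (simp add: z)
    qed
  next
    case 4
    show ?thesis
    proof (intro exI allI impI)
      fix a :: "nat \<Rightarrow> real" assume "(\<Sum>z\<in>?S. of_bool (z = z3) * a z) = 0"
      then have z: "a z3 = 0" using single[of z3 a] by simp
      show "0 \<le> zform 1 ?S a"
        using pd4_form(1)[OF 4, of "a z0" "a z1" "a z2" "a z4"] D[of a]
        unfolding form by (simp add: z)
    qed
  next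
    case 5
    have n01: "\<not> F z0 z1" and n23: "\<not> F z2 z3"
      using 5 no[of z0 z1 z2] no[of z0 z2 z3] F_sym by blast+
    have n4: "\<not> (F z0 z4 \<and> F z2 z4)" "\<not> (F z0 z4 \<and> F z3 z4)" "\<not> (F z1 z4 \<and> F z2 z4)" "\<not> (F z1 z4 \<and> F z3 z4)"
      using 5 no[of z0 z2 z4] no[of z0 z3 z4] no[of z1 z2 z4] no[of z1 z3 z4] by blast+
    show ?thesis
    proof (intro exI allI impI)
      \<comment> \<open>The couplings of the four-cycle are
        \<open>(a z0 + a z1) * (a z2 + a z3)\<close> and vanish on this hyperplane.\<close>
      fix a :: "nat \<Rightarrow> real" assume "(\<Sum>z\<in>?S. (of_bool (z = z0) + of_bool (z = z1)) * a z) = 0"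
      then have z: "a z1 = - a z0"
        using single[of z0 a] single[of z1 a] by (simp add: distrib_right sum.distrib)
      have i1: "ind (F z0 z1) = 0" "ind (F z2 z3) = 0" "ind (F z0 z2) = 1" "ind (F z0 z3) = 1"
        "ind (F z1 z2) = 1" "ind (F z1 z3) = 1" using 5 n01 n23 by (simp_all add: ind_def)
      have "zform 1 ?S a = (real (deg z0) - 1) * (a z0)\<^sup>2 + (real (deg z1) - 1) * (a z1)\<^sup>2
        + (real (deg z2) - 1) * (a z2)\<^sup>2 + (real (deg z3) - 1) * (a z3)\<^sup>2 + (real (deg z4) - 1) * (a z4)\<^sup>2
        + 2 * ((ind (F z0 z4) - ind (F z1 z4)) * (a z0 * a z4)) + 2 * (ind (F z2 z4) * (a z2 * a z4))
        + 2 * (ind (F z3 z4) * (a z3 * a z4))"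
        unfolding form i1 z by (simp add: algebra_simps)
      moreover have "(a z1)\<^sup>2 = (a z0)\<^sup>2" by (simp add: z)
      ultimately show "0 \<le> zform 1 ?S a"
        using D[of a] c4_form[OF n4(1,2,3,4), of "a z0" "a z2" "a z3" "a z4"] by linarith
    qed
  qed
qed

lemma hyperplane_four_pos:
  assumes dist: "distinct [z0, z1, z2, z3]"
    and deg: "2 \<le> deg z0" "2 \<le> deg z1" "3 \<le> deg z2" "3 \<le> deg z3"
    and tf: "tri n F = 0"
  shows "\<exists>c. \<forall>a. (\<Sum>z\<in>{z0, z1, z2, z3}. c z * a z) = 0 \<longrightarrow> zform 1 {z0, z1, z2, z3} a \<le> 0 \<longrightarrow>
    (\<forall>z\<in>{z0, z1, z2, z3}. a z = 0)"
proof -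
  let ?S = "{z0, z1, z2, z3}"
  note form = zform_four[OF dist, of 1]
  have no: "\<not> (F u v \<and> F v w \<and> F u w)" for u v w
    using no_triangle[OF tf, of u v w] F_sym by blast
  have D: "1 * (a z0)\<^sup>2 \<le> (real (deg z0) - 1) * (a z0)\<^sup>2" "1 * (a z1)\<^sup>2 \<le> (real (deg z1) - 1) * (a z1)\<^sup>2"
    "2 * (a z2)\<^sup>2 \<le> (real (deg z2) - 1) * (a z2)\<^sup>2" "2 * (a z3)\<^sup>2 \<le> (real (deg z3) - 1) * (a z3)\<^sup>2" for a
    by (rule coeff_mono, use deg in linarith)+
  have single: "(\<Sum>z\<in>?S. of_bool (z = u) * a z) = a u" if "u \<in> ?S" for u and a :: "nat \<Rightarrow> real"
    using sum_of_bool_member[of ?S "\<lambda>z. if z \<in> ?S then a z else 0" u] that by (simp add: eq_commute)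
  consider "pd3 True 1 2 2 (ind (F z1 z2)) (ind (F z1 z3)) (ind (F z2 z3))"
    | "pd3 True 1 2 2 (ind (F z0 z2)) (ind (F z0 z3)) (ind (F z2 z3))"
    | "F z0 z2 \<and> F z0 z3 \<and> F z1 z2 \<and> F z1 z3"
    using four_vertices_pos[where ?b01.0 = "F z0 z1" and ?b02.0 = "F z0 z2" and ?b03.0 = "F z0 z3" and ?b12.0 = "F z1 z2" and ?b13.0 = "F z1 z3" and ?b23.0 = "F z2 z3", OF no no no no] by blast
  then show ?thesis
  proof cases
    case 1
    show ?thesis
    proof (intro exI allI impI)
      fix a :: "nat \<Rightarrow> real" assume "(\<Sum>z\<in>?S. of_bool (z = z0) * a z) = 0" and le: "zform 1 ?S a \<le> 0"
      then have z: "a z0 = 0" using single[of z0 a] by simp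
      show "\<forall>z\<in>?S. a z = 0"
        using pd3_form(2)[OF 1, of "a z1" "a z2" "a z3"] D[of a] le z unfolding form by simp
    qed
  next
    case 2
    show ?thesis
    proof (intro exI allI impI)
      fix a :: "nat \<Rightarrow> real" assume "(\<Sum>z\<in>?S. of_bool (z = z1) * a z) = 0" and le: "zform 1 ?S a \<le> 0"
      then have z: "a z1 = 0" using single[of z1 a] by simp
      show "\<forall>z\<in>?S. a z = 0"
        using pd3_form(2)[OF 2, of "a z0" "a z2" "a z3"] D[of a] le z unfolding form by simp
    qed
  next
    case 3
    have n01: "\<not> F z0 z1" and n23: "\<not> F z2 z3"
      using 3 no[of z0 z1 z2] no[of z0 z2 z3] F_sym by blast+
    show ?thesis
    proof (intro exI allI impI)
      fix a :: "nat \<Rightarrow> real" assume "(\<Sum>z\<in>?S. (of_bool (z = z0) + of_bool (z = z1)) * a z) = 0" and le: "zform 1 ?S a \<le> 0"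
      then have z: "a z1 = - a z0"
        using single[of z0 a] single[of z1 a] by (simp add: distrib_right sum.distrib)
      have nn: "0 \<le> (a z0)\<^sup>2" "0 \<le> (a z2)\<^sup>2" "0 \<le> (a z3)\<^sup>2" by auto
      have "(a z0)\<^sup>2 + (a z0)\<^sup>2 + 2 * (a z2)\<^sup>2 + 2 * (a z3)\<^sup>2 \<le> 0"
        using D[of a] le 3 n01 n23 unfolding form z by (simp add: ind_def)
      then have "(a z0)\<^sup>2 = 0" "(a z2)\<^sup>2 = 0" "(a z3)\<^sup>2 = 0" using nn by linarith+
      then show "\<forall>z\<in>?S. a z = 0" using z by simp
    qed
  qed
qed

text \<open>Deleting one vertex leaves a positive definite form except for two complete bipartite
  graphs. There the couplings factor as a product of the two side sums, and one side sum is set to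
  zero.\<close>

lemma hyperplane_five_scaled:
  assumes dist: "distinct [z0, z1, z2, z3, z4]"
    and deg: "2 \<le> deg z0" "2 \<le> deg z1" "2 \<le> deg z2" "3 \<le> deg z3" "3 \<le> deg z4"
    and two: "deg z2 = 2 \<Longrightarrow> deg z0 = 2 \<and> deg z1 = 2 \<and> deg z3 = 3 \<and> deg z4 = 3"
  shows "\<exists>c. \<forall>a. (\<Sum>z\<in>{z0, z1, z2, z3, z4}. c z * a z) = 0 \<longrightarrow> zform (4 / 5) {z0, z1, z2, z3, z4} a \<le> 0
    \<longrightarrow> (\<forall>z\<in>{z0, z1, z2, z3, z4}. a z = 0)"
proof -
  let ?S = "{z0, z1, z2, z3, z4}"
  note form = zform_five[OF dist, of "4 / 5"]
  have single: "(\<Sum>z\<in>?S. of_bool (z = u) * a z) = a u" if "u \<in> ?S" for u and a :: "nat \<Rightarrow> real"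
    using sum_of_bool_member[of ?S "\<lambda>z. if z \<in> ?S then a z else 0" u] that by (simp add: eq_commute)
  have D: "6 * (a z0)\<^sup>2 \<le> 5 * (real (deg z0) - 4 / 5) * (a z0)\<^sup>2" "6 * (a z1)\<^sup>2 \<le> 5 * (real (deg z1) - 4 / 5) * (a z1)\<^sup>2"
    "11 * (a z3)\<^sup>2 \<le> 5 * (real (deg z3) - 4 / 5) * (a z3)\<^sup>2" "11 * (a z4)\<^sup>2 \<le> 5 * (real (deg z4) - 4 / 5) * (a z4)\<^sup>2" for a
    by (rule coeff_mono, use deg in simp)+
  have le5: "5 * zform (4 / 5) ?S a \<le> 0" if "zform (4 / 5) ?S a \<le> 0" for a using that by simp
  have form5: "5 * zform (4 / 5) ?S a = 5 * (real (deg z0) - 4 / 5) * (a z0)\<^sup>2 + 5 * (real (deg z1) - 4 / 5) * (a z1)\<^sup>2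
    + 5 * (real (deg z2) - 4 / 5) * (a z2)\<^sup>2 + 5 * (real (deg z3) - 4 / 5) * (a z3)\<^sup>2 + 5 * (real (deg z4) - 4 / 5) * (a z4)\<^sup>2
    + 2 * (5 * ind (F z0 z1) * (a z0 * a z1) + 5 * ind (F z0 z2) * (a z0 * a z2) + 5 * ind (F z0 z3) * (a z0 * a z3)
      + 5 * ind (F z0 z4) * (a z0 * a z4) + 5 * ind (F z1 z2) * (a z1 * a z2) + 5 * ind (F z1 z3) * (a z1 * a z3)
      + 5 * ind (F z1 z4) * (a z1 * a z4) + 5 * ind (F z2 z3) * (a z2 * a z3) + 5 * ind (F z2 z4) * (a z2 * a z4)
      + 5 * ind (F z3 z4) * (a z3 * a z4))" for a
    unfolding form by (simp add: algebra_simps)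
  \<comment> \<open>The scaled diagonal bound at \<open>z2\<close>, whose degree decides between the
    patterns \<open>2, 2, 2, 3, 3\<close> and \<open>2, 2, 3, 3, 3\<close>.\<close>
  define m :: real where "m = (if deg z2 = 2 then 6 else 11)"
  have D2: "m * (a z2)\<^sup>2 \<le> 5 * (real (deg z2) - 4 / 5) * (a z2)\<^sup>2" for a
    by (rule coeff_mono) (use deg in \<open>simp add: m_def\<close>)
  have m0: "m > 0" by (simp add: m_def)
  have drop: ?thesis if "z \<in> ?S"
    and "\<And>a. a z = 0 \<Longrightarrow> zform (4 / 5) ?S a \<le> 0 \<Longrightarrow> \<forall>z\<in>?S. a z = 0" for z
    by (intro exI[of _ "\<lambda>v. of_bool (v = z)"]) (use that single[OF that(1)] in auto)
  have final: "\<forall>z\<in>?S. a z = 0"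
    if le: "zform (4 / 5) ?S a \<le> 0"
      and C: "5 * ind (F z0 z1) * (a z0 * a z1) + 5 * ind (F z0 z2) * (a z0 * a z2) + 5 * ind (F z0 z3) * (a z0 * a z3)
      + 5 * ind (F z0 z4) * (a z0 * a z4) + 5 * ind (F z1 z2) * (a z1 * a z2) + 5 * ind (F z1 z3) * (a z1 * a z3)
      + 5 * ind (F z1 z4) * (a z1 * a z4) + 5 * ind (F z2 z3) * (a z2 * a z3) + 5 * ind (F z2 z4) * (a z2 * a z4)
      + 5 * ind (F z3 z4) * (a z3 * a z4) = 0" for a
  proof -
    have s: "6 * (a z0)\<^sup>2 + 6 * (a z1)\<^sup>2 + m * (a z2)\<^sup>2 + 11 * (a z3)\<^sup>2 + 11 * (a z4)\<^sup>2 \<le> 0"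
      using D[of a] D2[of a] le5[OF le] unfolding form5 C by linarith
    have nn: "0 \<le> 6 * (a z0)\<^sup>2" "0 \<le> 6 * (a z1)\<^sup>2" "0 \<le> m * (a z2)\<^sup>2" "0 \<le> 11 * (a z3)\<^sup>2" "0 \<le> 11 * (a z4)\<^sup>2"
      using m0 by simp_all
    have "6 * (a z0)\<^sup>2 = 0" "6 * (a z1)\<^sup>2 = 0" "m * (a z2)\<^sup>2 = 0" "11 * (a z3)\<^sup>2 = 0" "11 * (a z4)\<^sup>2 = 0"
      using s nn by linarith+
    then show ?thesis using m0 by simp
  qed
  have P0: ?thesis if P: "pd4 True 6 m 11 11 (5 * ind (F z1 z2)) (5 * ind (F z1 z3)) (5 * ind (F z1 z4)) (5 * ind (F z2 z3)) (5 * ind (F z2 z4)) (5 * ind (F z3 z4))"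
  proof (rule drop[of z0])
    fix a :: "nat \<Rightarrow> real" assume z: "a z0 = 0" and le: "zform (4 / 5) ?S a \<le> 0"
    show "\<forall>z\<in>?S. a z = 0"
      using pd4_form(2)[OF P, of "a z1" "a z2" "a z3" "a z4"] D[of a] D2[of a] le5[OF le] z
      unfolding form5 by simp
  qed simp
  have P1: ?thesis if P: "pd4 True 6 m 11 11 (5 * ind (F z0 z2)) (5 * ind (F z0 z3)) (5 * ind (F z0 z4)) (5 * ind (F z2 z3)) (5 * ind (F z2 z4)) (5 * ind (F z3 z4))"
  proof (rule drop[of z1])
    fix a :: "nat \<Rightarrow> real" assume z: "a z1 = 0" and le: "zform (4 / 5) ?S a \<le> 0"
    show "\<forall>z\<in>?S. a z = 0"
      using pd4_form(2)[OF P, of "a z0" "a z2" "a z3" "a z4"] D[of a] D2[of a] le5[OF le] z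
      unfolding form5 by simp
  qed simp
  have P2: ?thesis if P: "pd4 True 6 6 11 11 (5 * ind (F z0 z1)) (5 * ind (F z0 z3)) (5 * ind (F z0 z4)) (5 * ind (F z1 z3)) (5 * ind (F z1 z4)) (5 * ind (F z3 z4))"
  proof (rule drop[of z2])
    fix a :: "nat \<Rightarrow> real" assume z: "a z2 = 0" and le: "zform (4 / 5) ?S a \<le> 0"
    show "\<forall>z\<in>?S. a z = 0"
      using pd4_form(2)[OF P, of "a z0" "a z1" "a z3" "a z4"] D[of a] D2[of a] le5[OF le] z
      unfolding form5 by simp
  qed simp
  have P3: ?thesis if P: "pd4 True 6 6 m 11 (5 * ind (F z0 z1)) (5 * ind (F z0 z2)) (5 * ind (F z0 z4)) (5 * ind (F z1 z2)) (5 * ind (F z1 z4)) (5 * ind (F z2 z4))"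
  proof (rule drop[of z3])
    fix a :: "nat \<Rightarrow> real" assume z: "a z3 = 0" and le: "zform (4 / 5) ?S a \<le> 0"
    show "\<forall>z\<in>?S. a z = 0"
      using pd4_form(2)[OF P, of "a z0" "a z1" "a z2" "a z4"] D[of a] D2[of a] le5[OF le] z
      unfolding form5 by simp
  qed simp
  have P4: ?thesis if P: "pd4 True 6 6 m 11 (5 * ind (F z0 z1)) (5 * ind (F z0 z2)) (5 * ind (F z0 z3)) (5 * ind (F z1 z2)) (5 * ind (F z1 z3)) (5 * ind (F z2 z3))"
  proof (rule drop[of z4])
    fix a :: "nat \<Rightarrow> real" assume z: "a z4 = 0" and le: "zform (4 / 5) ?S a \<le> 0"
    show "\<forall>z\<in>?S. a z = 0"
      using pd4_form(2)[OF P, of "a z0" "a z1" "a z2" "a z3"] D[of a] D2[of a] le5[OF le] z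
      unfolding form5 by simp
  qed simp
  have K32: ?thesis if K: "(\<not> F z0 z1 \<and> \<not> F z0 z2 \<and> \<not> F z1 z2 \<and> F z0 z3 \<and> F z0 z4 \<and> F z1 z3 \<and> F z1 z4 \<and> F z2 z3 \<and> F z2 z4 \<and> \<not> F z3 z4)"
  proof (intro exI[of _ "\<lambda>z. of_bool (z = z0) + of_bool (z = z1) + of_bool (z = z2)"] allI impI)
    fix a :: "nat \<Rightarrow> real" assume "(\<Sum>z\<in>?S. (of_bool (z = z0) + of_bool (z = z1) + of_bool (z = z2)) * a z) = 0"
      and le: "zform (4 / 5) ?S a \<le> 0"
    then have z: "a z0 = - a z1 - a z2"
      using single[of z0 a] single[of z1 a] single[of z2 a] by (simp add: distrib_right sum.distrib)
    show "\<forall>z\<in>?S. a z = 0"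
      by (rule final[OF le]) (simp add: K ind_def z algebra_simps)
  qed
  have K23: ?thesis if K: "(\<not> F z0 z1 \<and> F z0 z2 \<and> F z0 z3 \<and> F z0 z4 \<and> F z1 z2 \<and> F z1 z3 \<and> F z1 z4 \<and> \<not> F z2 z3 \<and> \<not> F z2 z4 \<and> \<not> F z3 z4)"
  proof (intro exI[of _ "\<lambda>z. of_bool (z = z0) + of_bool (z = z1)"] allI impI)
    fix a :: "nat \<Rightarrow> real" assume "(\<Sum>z\<in>?S. (of_bool (z = z0) + of_bool (z = z1)) * a z) = 0"
      and le: "zform (4 / 5) ?S a \<le> 0"
    then have z: "a z0 = - a z1"
      using single[of z0 a] single[of z1 a] by (simp add: distrib_right sum.distrib)
    show "\<forall>z\<in>?S. a z = 0"
      by (rule final[OF le]) (simp add: K ind_def z algebra_simps)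
  qed
  show ?thesis
  proof (cases "deg z2 = 2")
    case True
    have le2: "\<not> (F u v1 \<and> F u v2 \<and> F u v3)" if "deg u = 2" "distinct [v1, v2, v3]" for u v1 v2 v3
    proof
      assume "F u v1 \<and> F u v2 \<and> F u v3"
      then have "card {v1, v2, v3} \<le> card {j. F u j}" by (intro card_mono finite_nbrs) auto
      then show False using that by (simp add: deg_card)
    qed
    have le3: "\<not> (F u v1 \<and> F u v2 \<and> F u v3 \<and> F u v4)" if "deg u = 3" "distinct [v1, v2, v3, v4]" for u v1 v2 v3 v4
    proof
      assume "F u v1 \<and> F u v2 \<and> F u v3 \<and> F u v4"
      then have "card {v1, v2, v3, v4} \<le> card {j. F u j}" by (intro card_mono finite_nbrs) auto
      then show False using that by (simp add: deg_card)
    qed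
    note d = two[OF True] True
    have FS: "F u v = F v u" for u v using F_sym by blast
    have c1: "\<not> (F z0 z1 \<and> F z0 z2 \<and> F z0 z3)"
      using le2[of z0 z1 z2 z3] d dist by (simp)
    have c2: "\<not> (F z0 z1 \<and> F z0 z2 \<and> F z0 z4)"
      using le2[of z0 z1 z2 z4] d dist by (simp)
    have c3: "\<not> (F z0 z1 \<and> F z0 z3 \<and> F z0 z4)"
      using le2[of z0 z1 z3 z4] d dist by (simp)
    have c4: "\<not> (F z0 z2 \<and> F z0 z3 \<and> F z0 z4)"
      using le2[of z0 z2 z3 z4] d dist by (simp)
    have c5: "\<not> (F z0 z1 \<and> F z1 z2 \<and> F z1 z3)"
      using le2[of z1 z0 z2 z3] d dist by (simp add: FS[of z1 z0])
    have c6: "\<not> (F z0 z1 \<and> F z1 z2 \<and> F z1 z4)"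
      using le2[of z1 z0 z2 z4] d dist by (simp add: FS[of z1 z0])
    have c7: "\<not> (F z0 z1 \<and> F z1 z3 \<and> F z1 z4)"
      using le2[of z1 z0 z3 z4] d dist by (simp add: FS[of z1 z0])
    have c8: "\<not> (F z1 z2 \<and> F z1 z3 \<and> F z1 z4)"
      using le2[of z1 z2 z3 z4] d dist by (simp)
    have c9: "\<not> (F z0 z2 \<and> F z1 z2 \<and> F z2 z3)"
      using le2[of z2 z0 z1 z3] d dist by (simp add: FS[of z2 z0] FS[of z2 z1])
    have c10: "\<not> (F z0 z2 \<and> F z1 z2 \<and> F z2 z4)"
      using le2[of z2 z0 z1 z4] d dist by (simp add: FS[of z2 z0] FS[of z2 z1])
    have c11: "\<not> (F z0 z2 \<and> F z2 z3 \<and> F z2 z4)"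
      using le2[of z2 z0 z3 z4] d dist by (simp add: FS[of z2 z0])
    have c12: "\<not> (F z1 z2 \<and> F z2 z3 \<and> F z2 z4)"
      using le2[of z2 z1 z3 z4] d dist by (simp add: FS[of z2 z1])
    have c13: "\<not> (F z0 z3 \<and> F z1 z3 \<and> F z2 z3 \<and> F z3 z4)"
      using le3[of z3 z0 z1 z2 z4] d dist by (simp add: FS[of z3 z0] FS[of z3 z1] FS[of z3 z2])
    have c14: "\<not> (F z0 z4 \<and> F z1 z4 \<and> F z2 z4 \<and> F z3 z4)"
      using le3[of z4 z0 z1 z2 z3] d dist by (simp add: FS[of z4 z0] FS[of z4 z1] FS[of z4 z2] FS[of z4 z3])
    have m6: "m = 6" using True by (simp add: m_def)
    from five_vertices_scaled_pos_3[where ?b01.0 = "F z0 z1" and ?b02.0 = "F z0 z2" and ?b03.0 = "F z0 z3" and ?b04.0 = "F z0 z4" and ?b12.0 = "F z1 z2" and ?b13.0 = "F z1 z3" and ?b14.0 = "F z1 z4" and ?b23.0 = "F z2 z3" and ?b24.0 = "F z2 z4" and ?b34.0 = "F z3 z4", OF c1 c2 c3 c4 c5 c6 c7 c8 c9 c10 c11 c12 c13 c14]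
    show ?thesis
      by (elim disjE) (erule P0[unfolded m6] P1[unfolded m6] P2[unfolded m6] P3[unfolded m6] P4[unfolded m6] K32)+
  next
    case False
    then have m11: "m = 11" by (simp add: m_def)
    from five_vertices_scaled_pos_2[where ?b01.0 = "F z0 z1" and ?b02.0 = "F z0 z2" and ?b03.0 = "F z0 z3" and ?b04.0 = "F z0 z4" and ?b12.0 = "F z1 z2" and ?b13.0 = "F z1 z3" and ?b14.0 = "F z1 z4" and ?b23.0 = "F z2 z3" and ?b24.0 = "F z2 z4" and ?b34.0 = "F z3 z4"]
    show ?thesis
      by (elim disjE) (erule P0[unfolded m11] P1[unfolded m11] P2[unfolded m11] P3[unfolded m11] P4[unfolded m11] K23)+
  qed
qed

end

section \<open>Degree deficiencies in the presence of an isolated vertex\<close>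

context jellyfish_mate
begin

text \<open>Two adjacent pendant vertices form a bipartite component, but the isolated vertex
  already occupies the kernel.\<close>

lemma pendant_nbr_core:
  assumes v0: "v0 \<in> Iso" and v: "v \<in> Pend" and vw: "F v w"
  shows "w \<in> Core"
proof (rule ccontr)
  assume nc: "w \<notin> Core"
  have w: "w < n" using F_lt[OF vw] by blast
  have "v \<in> {j. F w j}" using F_sym[OF vw] by simp
  then have "deg w \<noteq> 0" unfolding deg_card using finite_nbrs[of w] by auto
  then have wP: "w \<in> Pend" using nc w by (auto simp: Core_def Pend_def)
  obtain u where u: "\<And>z. F v z \<longleftrightarrow> z = u" using pendant_nbr[OF v] by metis
  obtain u' where u': "\<And>z. F w z \<longleftrightarrow> z = u'" using pendant_nbr[OF wP] by metis
  have uw: "u = w" using u[of w] vw by simp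
  have u'v: "u' = v" using u'[of v] F_sym[OF vw] by simp
  have ne: "v \<noteq> w" using vw F_irrefl by blast
  define y :: "nat \<Rightarrow> real" where "y i = (if i = v then 1 else if i = w then -1 else 0)" for i
  have "qform n F y = 0"
  proof (subst qform_eq_0_iff[OF F], intro allI impI)
    fix a b assume ab: "F a b"
    show "y a + y b = 0"
    proof (cases "a = v \<or> a = w")
      case True
      then show ?thesis using ab u u' uw u'v ne by (auto simp: y_def)
    next
      case False
      then have "b \<noteq> v" "b \<noteq> w" using F_sym[OF ab] u u' uw u'v by auto
      then show ?thesis using False by (simp add: y_def)
    qed
  qed
  moreover have "v \<noteq> v0" "v < n" using v0 v by (auto simp: Iso_def Pend_def)
  ultimately have "y v = 0" using isolated_excludes_kernel[OF v0] by blast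
  then show False by (simp add: y_def)
qed

abbreviation "gap v \<equiv> real p + 2 - real (deg v)"

text \<open>The degree identities rewritten for the deficiency from \<open>p + 2\<close>. Pendant
  vertices drop out of the quadratic and the cubic one, and the isolated vertex adds
  \<open>p + 2\<close> to the quadratic one.\<close>

lemma core_moments:
  assumes v0: "v0 \<in> Iso" and k: "real (card Core) = real q + k"
  shows "real (card Pend) = real p * real q - k - 1"
    and "(\<Sum>v\<in>Core. gap v) = (real p + 1) * k - 1"
    and "(\<Sum>v\<in>Core. (gap v)\<^sup>2) = (real p + 1)\<^sup>2 * k - (2 * real p + 3)"
    and "(\<Sum>v\<in>Core. (gap v)^3) = tri n F - tri n J + (2 * real p + 3) * (\<Sum>v\<in>Core. (gap v)\<^sup>2)
      - (real p + 1) * (real p + 2) * (\<Sum>v\<in>Core. gap v)"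
proof -
  have Iso1: "Iso = {v0}" using v0 isolated_unique by blast
  have d0: "deg v0 = 0" using v0 by (simp add: Iso_def)
  have dP: "v \<in> Pend \<Longrightarrow> real (deg v) = 1" for v by (simp add: Pend_def)
  have rn: "real n = real q + real q * real p" by (simp add: n_eq)
  have c: "real n = 1 + real (card Pend) + real (card Core)"
    using sum_classes[of "\<lambda>_. 1"] Iso1 by simp
  then show P: "real (card Pend) = real p * real q - k - 1"
    using rn k by (simp add: algebra_simps)
  have "2 * real n = real (card Pend) + (\<Sum>v\<in>Core. real (deg v))"
    using degree_moments(1) unfolding sum_classes Iso1 by (simp add: d0 dP)
  moreover have "(\<Sum>v\<in>Core. gap v) = (real p + 2) * real (card Core) - (\<Sum>v\<in>Core. real (deg v))"
    by (simp add: sum_subtractf)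
  ultimately show 1: "(\<Sum>v\<in>Core. gap v) = (real p + 1) * k - 1"
    unfolding P k rn by (simp add: algebra_simps)
  have "(\<Sum>v\<in>Core. (real (deg v) - 1) * (real (deg v) - real p - 2)) = - (real p + 2)"
    using degree_moments(2) unfolding sum_classes Iso1 by (simp add: d0 dP)
  moreover have "(\<Sum>v\<in>Core. (real (deg v) - 1) * (real (deg v) - real p - 2)) =
      (\<Sum>v\<in>Core. (gap v)\<^sup>2) - (real p + 1) * (\<Sum>v\<in>Core. gap v)"
    unfolding sum_distrib_left sum_subtractf[symmetric]
    by (intro sum.cong refl) (simp add: power2_eq_square algebra_simps)
  ultimately show 2: "(\<Sum>v\<in>Core. (gap v)\<^sup>2) = (real p + 1)\<^sup>2 * k - (2 * real p + 3)"
    unfolding 1 by (simp add: power2_eq_square algebra_simps)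
  have "(\<Sum>v\<in>Core. real (deg v) * (real (deg v) - 1) * (real (deg v) - real p - 2)) = tri n J - tri n F"
    using degree_moments(3) unfolding sum_classes Iso1 by (simp add: d0 dP)
  moreover have "(\<Sum>v\<in>Core. real (deg v) * (real (deg v) - 1) * (real (deg v) - real p - 2)) =
      (2 * real p + 3) * (\<Sum>v\<in>Core. (gap v)\<^sup>2) - (real p + 1) * (real p + 2) * (\<Sum>v\<in>Core. gap v)
      - (\<Sum>v\<in>Core. (gap v)^3)"
    unfolding sum_distrib_left sum_subtractf[symmetric]
    by (intro sum.cong refl) (simp add: power2_eq_square power3_eq_cube algebra_simps)
  ultimately show "(\<Sum>v\<in>Core. (gap v)^3) = tri n F - tri n J + (2 * real p + 3) * (\<Sum>v\<in>Core. (gap v)\<^sup>2)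
      - (real p + 1) * (real p + 2) * (\<Sum>v\<in>Core. gap v)"
    by linarith
qed

lemma card_class: "(\<Sum>v\<in>Core. of_bool (deg v = j)) = real (card {v \<in> Core. deg v = j})"
  by (simp add: class_finite Int_def of_bool_def sum.If_cases)

text \<open>For core degrees up to \<open>p + 2\<close> both \<open>gap v\<close> and
  \<open>real p - gap v = deg v - 2\<close> are nonnegative. Summing products of them bounds the
  excess \<open>k\<close> from above; only degree \<open>p + 3\<close>, where the gap is
  \<open>-1\<close>, needs correction by \<open>b\<close>.\<close>

lemma core_inequalities:
  assumes v0: "v0 \<in> Iso" and k: "real (card Core) = real q + k" and tJ: "tri n J = 0"
  defines "b \<equiv> real (card {v \<in> Core. deg v = p + 3})"
  shows "(real p + 1) * b + tri n F + (real p + 1)\<^sup>2 * k \<le> (real p)\<^sup>2 + 6 * real p + 7"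
    and "(real p + 1) * k \<le> (real p + 1) * b + real p + 3"
proof -
  note m = core_moments[OF v0 k]
  have b: "b = (\<Sum>v\<in>Core. of_bool (deg v = p + 3))" unfolding b_def card_class ..
  have range: "2 \<le> deg v \<and> (deg v \<le> p + 2 \<or> deg v = p + 3)" if "v \<in> Core" for v
    using that max_degree[of v] by (auto simp: Core_def)
  have "0 \<le> (\<Sum>v\<in>Core. (gap v)\<^sup>2 * (real p - gap v) - (real p + 1) * of_bool (deg v = p + 3))"
  proof (rule sum_nonneg)
    fix v assume v: "v \<in> Core"
    show "0 \<le> (gap v)\<^sup>2 * (real p - gap v) - (real p + 1) * of_bool (deg v = p + 3)"
    proof (cases "deg v = p + 3")
      case False
      have "0 \<le> (gap v)\<^sup>2 * (real (deg v) - 2)" using range[OF v] by (intro mult_nonneg_nonneg) auto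
      then show ?thesis using False by (simp add: algebra_simps)
    qed simp
  qed
  also have "\<dots> = real p * (\<Sum>v\<in>Core. (gap v)\<^sup>2) - (\<Sum>v\<in>Core. (gap v)^3) - (real p + 1) * b"
    unfolding b sum_distrib_left sum_subtractf[symmetric]
    by (intro sum.cong refl) (simp add: power2_eq_square power3_eq_cube algebra_simps)
  finally show "(real p + 1) * b + tri n F + (real p + 1)\<^sup>2 * k \<le> (real p)\<^sup>2 + 6 * real p + 7"
    unfolding m(4) m(2,3) tJ by (simp add: power2_eq_square algebra_simps)
  have "0 \<le> (\<Sum>v\<in>Core. gap v * (real p - gap v) + (real p + 1) * of_bool (deg v = p + 3))"
  proof (rule sum_nonneg)
    fix v assume v: "v \<in> Core"
    show "0 \<le> gap v * (real p - gap v) + (real p + 1) * of_bool (deg v = p + 3)"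
    proof (cases "deg v = p + 3")
      case False
      then have "real (deg v) \<le> real p + 2" "2 \<le> real (deg v)" using range[OF v] by linarith+
      then have "0 \<le> gap v * (real (deg v) - 2)" by (intro mult_nonneg_nonneg) auto
      then show ?thesis using False by (simp add: algebra_simps)
    qed simp
  qed
  also have "\<dots> = real p * (\<Sum>v\<in>Core. gap v) - (\<Sum>v\<in>Core. (gap v)\<^sup>2) + (real p + 1) * b"
    unfolding b sum_distrib_left sum_subtractf[symmetric] sum.distrib[symmetric]
    by (intro sum.cong refl) (simp add: power2_eq_square algebra_simps)
  finally show "(real p + 1) * k \<le> (real p + 1) * b + real p + 3"
    unfolding m(2,3) by (simp add: power2_eq_square algebra_simps)
qed

text \<open>The squared gaps sum to \<open>p\<^sup>2 - 2\<close>, less than a vertex of degree two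
  would contribute, so core degrees are at least three. Three vertices of \<open>Zc\<close> then
  carry a semidefinite form, against the count with all pendant vertices; two or fewer carry a
  definite one, against the count with \<open>Uc\<close>.\<close>

lemma excess_one_impossible:
  assumes v0: "v0 \<in> Iso" and k: "card Core = q + 1"
  shows False
proof -
  have k': "real (card Core) = real q + 1" using k by simp
  note m = core_moments[OF v0 k'] and pc = pendant_nbr_core[OF v0]
  have "(real p + 1)\<^sup>2 * 1 - (2 * real p + 3) = (real p)\<^sup>2 - 2" by (simp add: power2_eq_square algebra_simps)
  then have S2: "(\<Sum>v\<in>Core. (gap v)\<^sup>2) = (real p)\<^sup>2 - 2" using m(3) by simp
  have deg3: "3 \<le> deg v" if v: "v \<in> Core" for v
  proof (rule ccontr)
    assume "\<not> 3 \<le> deg v"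
    then have "deg v = 2" using v by (auto simp: Core_def)
    moreover have "(gap v)\<^sup>2 \<le> (\<Sum>v\<in>Core. (gap v)\<^sup>2)"
      by (rule member_le_sum) (use v class_finite in auto)
    ultimately show False unfolding S2 by simp
  qed
  have "real (card Pend) + 2 = real (p * q)" using m(1) by simp
  then have cP: "card Pend + 2 = p * q" by linarith
  have cUZ: "card Uc + card Zc = q + 1"
    using card_Un_disjoint[OF finite_UZ Core_split(2)] Core_split(1) k by simp
  have ZC: "Zc \<subseteq> Core" using Core_split by blast
  show False
  proof (cases "card Zc \<ge> 3")
    case True
    then obtain S where S: "S \<subseteq> Zc" "card S = 3" by (meson obtain_subset_with_card_n)
    have fS: "finite S" using S finite_UZ finite_subset by blast
    have card: "p * q + card ({} :: unit set) < card Pend + card S" using cP S by simp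
    have "\<exists>a. zform 1 S a < 0"
      by (rule pendant_count_at_least_one[where ?Z0.0 = S and Dx = "{} :: unit set" and D = "\<lambda>_ _. 0"];
          (use pc S(1) card in blast | simp))
    then obtain a where a: "zform 1 S a < 0" by blast
    have "0 \<le> (\<Sum>z\<in>S. (real (deg z) - 1 - (real (card S) - 1)) * (a z)\<^sup>2)"
    proof (rule sum_nonneg)
      fix z assume "z \<in> S"
      then have "3 \<le> deg z" using deg3 S(1) ZC by blast
      then show "0 \<le> (real (deg z) - 1 - (real (card S) - 1)) * (a z)\<^sup>2"
        using S(2) by (intro mult_nonneg_nonneg) auto
    qed
    then show False using zform_lower[OF fS, of 1 a] a by linarith
  next
    case False
    have card: "q + card ({} :: unit set) < card Uc + card Zc" using cUZ by simp
    have "\<exists>a. zform 1 Zc a \<le> 0 \<and> (\<exists>z\<in>Zc. a z \<noteq> 0)"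
      by (rule core_count[where ?Z0.0 = Zc and Dx = "{} :: unit set" and D = "\<lambda>_ _. 0"];
          (use pc card in blast | simp))
    then obtain a where a: "zform 1 Zc a \<le> 0" "\<exists>z\<in>Zc. a z \<noteq> 0" by blast
    have "(\<Sum>z\<in>Zc. (a z)\<^sup>2) \<le> (\<Sum>z\<in>Zc. (real (deg z) - 1 - (real (card Zc) - 1)) * (a z)\<^sup>2)"
    proof (rule sum_mono)
      fix z assume "z \<in> Zc"
      then have "3 \<le> deg z" using deg3 ZC by blast
      then have "1 * (a z)\<^sup>2 \<le> (real (deg z) - 1 - (real (card Zc) - 1)) * (a z)\<^sup>2"
        using False by (intro coeff_mono) linarith
      then show "(a z)\<^sup>2 \<le> (real (deg z) - 1 - (real (card Zc) - 1)) * (a z)\<^sup>2" by simp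
    qed
    then have "(\<Sum>z\<in>Zc. (a z)\<^sup>2) \<le> 0" using zform_lower[OF finite_UZ(2), of 1 a] a(1) by linarith
    moreover have "0 \<le> (\<Sum>z\<in>Zc. (a z)\<^sup>2)" by (simp add: sum_nonneg)
    ultimately have "(\<Sum>z\<in>Zc. (a z)\<^sup>2) = 0" by linarith
    then show False using a(2) by (simp add: sum_nonneg_eq_0_iff finite_UZ)
  qed
qed

lemma five_list:
  assumes "length ys = 5"
  obtains z0 z1 z2 z3 z4 where "ys = [z0, z1, z2, z3, z4]"
  using assms by (auto simp: length_Suc_conv eval_nat_numeral)

lemma four_list:
  assumes "length ys = 4"
  obtains z0 z1 z2 z3 where "ys = [z0, z1, z2, z3]"
  using assms by (auto simp: length_Suc_conv eval_nat_numeral)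

lemma core_class_le:
  assumes "c2 = card {v \<in> Core. deg v = 2}" "c3 = card {v \<in> Core. deg v = 3}"
  shows "card {v \<in> Core. deg v \<le> 2} = c2" and "card {v \<in> Core. deg v \<le> 3} = c2 + c3"
proof -
  have e: "{v \<in> Core. deg v \<le> 2} = {v \<in> Core. deg v = 2}" by (auto simp: Core_def)
  then show "card {v \<in> Core. deg v \<le> 2} = c2" using assms by simp
  have "{v \<in> Core. deg v \<le> 3} = {v \<in> Core. deg v = 2} \<union> {v \<in> Core. deg v = 3}" by (auto simp: Core_def)
  then show "card {v \<in> Core. deg v \<le> 3} = c2 + c3"
    using assms class_finite(3) by (simp add: card_Un_disjoint disjoint_iff)
qed

text \<open>For fewer than four vertices it suffices to delete one of least degree: at most two
  remain, and of two the larger degree is at least three.\<close>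

lemma small_hyperplane:
  assumes S: "S \<subseteq> Core" "card S \<le> 4" and c2: "card {v \<in> Core. deg v \<le> 2} \<le> 2" and tf: "tri n F = 0"
  shows "\<exists>c. \<forall>a. (\<Sum>z\<in>S. c z * a z) = 0 \<longrightarrow> zform 1 S a \<le> 0 \<longrightarrow> (\<forall>z\<in>S. a z = 0)"
proof -
  have fS: "finite S" using S class_finite finite_subset by blast
  obtain ys where ys: "distinct ys" "set ys = S" "length ys = card S" "sorted (map deg ys)"
    by (rule sorted_by_degree[OF fS])
  have sub: "set ys \<subseteq> Core" using ys S by simp
  have d2: "2 \<le> deg z" if "z \<in> S" for z using that S by (auto simp: Core_def)
  have d3: "3 \<le> deg (ys ! i)" if "i < length ys" "2 \<le> i" for i
    using sorted_degree_gt[OF ys(1) sub ys(4) that(1), of 2] c2 that(2) by simp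
  show ?thesis
  proof (cases "card S = 4")
    case True
    then obtain z0 z1 z2 z3 where z: "ys = [z0, z1, z2, z3]" using ys(3) four_list by metis
    have "3 \<le> deg z2" "3 \<le> deg z3" using d3[of 2] d3[of 3] z by simp_all
    moreover have "S = {z0, z1, z2, z3}" using ys(2) z by simp
    ultimately show ?thesis
      using hyperplane_four_pos[of z0 z1 z2 z3] ys(1) z d2 tf by simp
  next
    case False
    show ?thesis
    proof (cases ys)
      case Nil
      then show ?thesis using ys(2) by simp
    next
      case (Cons z0 zs)
      have S': "S = insert z0 (set zs)" "z0 \<notin> set zs" using ys Cons by auto
      have cz: "card (set zs) \<le> 2" using False S(2) ys(1,3) Cons distinct_card[of zs] by simp
      have "\<forall>z\<in>S. a z = 0" if z0: "a z0 = 0" and le: "zform 1 S a \<le> 0" for a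
      proof -
        have le: "zform 1 (set zs) a \<le> 0" using le zform_insert_zero[of "set zs" z0 a 1] S' z0 by simp
        have low: "(\<Sum>z\<in>set zs. (real (deg z) - 1 - (real (card (set zs)) - 1)) * (a z)\<^sup>2) \<le> 0"
          using zform_lower[of "set zs" 1 a] le by simp
        have "a z = 0" if "z \<in> set zs" for z
        proof (cases "length zs = 2")
          case False
          then have "card (set zs) \<le> 1" using cz card_length[of zs] ys(1) Cons distinct_card[of zs] by simp
          then have "set zs = {z}" using that by (metis card_le_Suc0_iff_eq One_nat_def List.finite_set is_singletonI' is_singleton_the_elem singletonD empty_iff)
          moreover have "2 \<le> deg z" using d2[of z] that S' by simp
          ultimately have "real (deg z) * (a z)\<^sup>2 \<le> (a z)\<^sup>2" "2 * (a z)\<^sup>2 \<le> real (deg z) * (a z)\<^sup>2"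
            using low coeff_mono[of 2 "real (deg z)" "a z"] by (simp_all add: algebra_simps)
          then have "(a z)\<^sup>2 \<le> 0" by linarith
          then show ?thesis by simp
        next
          case True
          then obtain u w where uw: "zs = [u, w]" by (auto simp: length_Suc_conv eval_nat_numeral)
          have ne: "u \<noteq> w" using ys(1) Cons uw by simp
          have du: "2 \<le> deg u" using d2[of u] S' uw by simp
          have dw: "3 \<le> deg w" using d3[of 2] Cons uw by simp
          \<comment> \<open>The coefficient of \<open>(a u)\<^sup>2\<close> may be zero here, so
            this settles only \<open>a w\<close>; afterwards the form on \<open>u\<close> alone
            settles \<open>a u\<close>.\<close>
          have low': "(real (deg u) - 2) * (a u)\<^sup>2 + (real (deg w) - 2) * (a w)\<^sup>2 \<le> 0"
            using low uw ne by (simp add: algebra_simps)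
          moreover have "0 * (a u)\<^sup>2 \<le> (real (deg u) - 2) * (a u)\<^sup>2" "1 * (a w)\<^sup>2 \<le> (real (deg w) - 2) * (a w)\<^sup>2"
            by (rule coeff_mono, use du dw in linarith)+
          ultimately have "(a w)\<^sup>2 \<le> 0" by linarith
          then have w0: "a w = 0" by simp
          have "zform 1 {w, u} a = zform 1 {u} a" using zform_insert_zero[of "{u}" w a 1] ne w0 by simp
          then have "(real (deg u) - 1) * (a u)\<^sup>2 \<le> 0"
            using le uw by (simp add: insert_commute zform_def adj_F_irrefl)
          moreover have "1 * (a u)\<^sup>2 \<le> (real (deg u) - 1) * (a u)\<^sup>2" by (rule coeff_mono) (use du in linarith)
          ultimately have "(a u)\<^sup>2 \<le> 0" by linarith
          then show ?thesis using that uw w0 by auto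
        qed
        then show ?thesis using S' z0 by simp
      qed
      moreover have "(\<Sum>z\<in>S. of_bool (z = z0) * a z) = a z0" for a :: "nat \<Rightarrow> real"
        using sum_of_bool_member[of S "\<lambda>z. if z \<in> S then a z else 0" z0] fS S'(1) by (simp add: eq_commute)
      ultimately show ?thesis by (intro exI[of _ "\<lambda>z. of_bool (z = z0)"]) metis
    qed
  qed
qed

end

section \<open>Elimination of the remaining degree sequences\<close>

context jellyfish_mate
begin

text \<open>Each count has room for exactly one extra condition:
  \<open>p * q + 1 < card Pend + 5\<close> when \<open>Zc\<close> has five vertices, and
  \<open>q + 1 < card Uc + card Zc\<close> otherwise. The hyperplane lemmas exclude both.\<close>

lemma excess_two_impossible_p2:
  assumes v0: "v0 \<in> Iso" and p2: "real p = 2" and k: "card Core = q + 2" and tF: "tri n F = 0"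
    and c2: "card {v \<in> Core. deg v \<le> 2} \<le> 2" and c3: "card {v \<in> Core. deg v \<le> 3} \<le> 4"
  shows False
proof -
  have k': "real (card Core) = real q + 2" using k by simp
  note pc = pendant_nbr_core[OF v0]
  have "real (card Pend) + 3 = real (p * q)" using core_moments(1)[OF v0 k'] by simp
  then have cP: "card Pend + 3 = p * q" by linarith
  have cUZ: "card Uc + card Zc = q + 2"
    using card_Un_disjoint[OF finite_UZ Core_split(2)] Core_split(1) k by simp
  have ZC: "Zc \<subseteq> Core" using Core_split by blast
  show False
  proof (cases "card Zc \<ge> 5")
    case True
    then obtain S where S: "S \<subseteq> Zc" "card S = 5" by (meson obtain_subset_with_card_n)
    have fS: "finite S" using S finite_UZ finite_subset by blast
    obtain ys where ys: "distinct ys" "set ys = S" "length ys = card S" "sorted (map deg ys)"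
      by (rule sorted_by_degree[OF fS])
    have sub: "set ys \<subseteq> Core" using ys S ZC by blast
    have l5: "length ys = 5" using ys(3) S(2) by simp
    then obtain z0 z1 z2 z3 z4 where z: "ys = [z0, z1, z2, z3, z4]" by (rule five_list)
    have Sz: "S = {z0, z1, z2, z3, z4}" using ys(2) z by simp
    have d2: "2 \<le> deg z0" "2 \<le> deg z1" using sub z by (auto simp: Core_def)
    have "2 < deg (ys ! 2)" "2 < deg (ys ! 3)" "3 < deg (ys ! 4)"
      using sorted_degree_gt[OF ys(1) sub ys(4), of 2 2] sorted_degree_gt[OF ys(1) sub ys(4), of 3 2]
        sorted_degree_gt[OF ys(1) sub ys(4), of 4 3] c2 c3 l5 by simp_all
    then have d3: "3 \<le> deg z2" "3 \<le> deg z3" "4 \<le> deg z4" using z by simp_all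
    obtain c where c: "\<And>a. (\<Sum>z\<in>S. c z * a z) = 0 \<Longrightarrow> 0 \<le> zform 1 S a"
      using hyperplane_five_nonneg[OF _ d2 d3 tF] ys(1) z Sz by auto
    have card: "p * q + card {()} < card Pend + card S" using cP S by simp
    have "\<exists>a. zform 1 S a < 0 \<and> (\<Sum>z\<in>S. c z * a z) = 0"
      by (rule pendant_count_at_least_one[where ?Z0.0 = S and Dx = "{()}" and D = "\<lambda>_. c"];
          (use pc S(1) card in blast | simp))
    then show False using c by (meson not_le)
  next
    case False
    obtain c where c: "\<And>a. (\<Sum>z\<in>Zc. c z * a z) = 0 \<Longrightarrow> zform 1 Zc a \<le> 0 \<Longrightarrow> \<forall>z\<in>Zc. a z = 0"
      using small_hyperplane[OF ZC _ c2 tF] False by auto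
    have card: "q + card {()} < card Uc + card Zc" using cUZ by simp
    have "\<exists>a. zform 1 Zc a \<le> 0 \<and> (\<exists>z\<in>Zc. a z \<noteq> 0) \<and> (\<Sum>z\<in>Zc. c z * a z) = 0"
      by (rule core_count[where ?Z0.0 = Zc and Dx = "{()}" and D = "\<lambda>_. c"];
          (use pc card in blast | simp))
    then show False using c by meson
  qed
qed

lemma card_Uc_le: "card Uc \<le> card Pend"
proof -
  have "Uc \<subseteq> (\<lambda>v. THE w. F v w) ` Pend"
  proof
    fix u assume "u \<in> Uc"
    then obtain v where v: "v \<in> Pend" "F u v" by (auto simp: Uc_def)
    obtain w where w: "\<And>z. F v z \<longleftrightarrow> z = w" using pendant_nbr[OF v(1)] by metis
    have "u = w" using w[of u] F_sym[OF v(2)] by simp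
    moreover have "(THE w. F v w) = w" unfolding w by simp
    ultimately show "u \<in> (\<lambda>v. THE w. F v w) ` Pend" using v(1) by blast
  qed
  then show ?thesis using surj_card_le[OF class_finite(2)] by blast
qed

text \<open>Here \<open>card Pend = q - 3\<close> bounds \<open>card Uc\<close>, so
  \<open>Zc\<close> always has at least five vertices and only the pendant count is needed, at
  threshold \<open>4 / 5\<close>.\<close>

lemma excess_two_impossible_p1:
  assumes v0: "v0 \<in> Iso" and p1: "p = 1" and k: "card Core = q + 2"
    and c2: "card {v \<in> Core. deg v \<le> 2} \<le> 3" and d: "\<And>v. v \<in> Core \<Longrightarrow> deg v \<le> 3"
  shows False
proof -
  have k': "real (card Core) = real q + 2" using k by simp
  note pc = pendant_nbr_core[OF v0]
  have "real (card Pend) + 3 = real (p * q)" using core_moments(1)[OF v0 k'] by simp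
  then have "card Pend + 3 = p * q" by linarith
  then have cP: "card Pend + 3 = q" using p1 by simp
  have cUZ: "card Uc + card Zc = q + 2"
    using card_Un_disjoint[OF finite_UZ Core_split(2)] Core_split(1) k by simp
  have ZC: "Zc \<subseteq> Core" using Core_split by blast
  have "card Zc \<ge> 5" using card_Uc_le cUZ cP by linarith
  then obtain S where S: "S \<subseteq> Zc" "card S = 5" by (meson obtain_subset_with_card_n)
  have fS: "finite S" using S finite_UZ finite_subset by blast
  obtain ys where ys: "distinct ys" "set ys = S" "length ys = card S" "sorted (map deg ys)"
    by (rule sorted_by_degree[OF fS])
  have sub: "set ys \<subseteq> Core" using ys S ZC by blast
  have l5: "length ys = 5" using ys(3) S(2) by simp
  then obtain z0 z1 z2 z3 z4 where z: "ys = [z0, z1, z2, z3, z4]" by (rule five_list)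
  have Sz: "S = {z0, z1, z2, z3, z4}" using ys(2) z by simp
  have d2: "2 \<le> deg z0" "2 \<le> deg z1" "2 \<le> deg z2" using sub z by (auto simp: Core_def)
  have "2 < deg (ys ! 3)" "2 < deg (ys ! 4)"
    using sorted_degree_gt[OF ys(1) sub ys(4), of 3 2] sorted_degree_gt[OF ys(1) sub ys(4), of 4 2] c2 l5
    by simp_all
  then have d3: "3 \<le> deg z3" "3 \<le> deg z4" using z by simp_all
  have le3: "deg z3 \<le> 3" "deg z4 \<le> 3" using d sub z by auto
  have mono: "deg z0 \<le> deg z2" "deg z1 \<le> deg z2" using ys(4) z by auto
  have two: "deg z2 = 2 \<Longrightarrow> deg z0 = 2 \<and> deg z1 = 2 \<and> deg z3 = 3 \<and> deg z4 = 3"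
    using d2 d3 le3 mono by linarith
  obtain c where c: "\<And>a. (\<Sum>z\<in>S. c z * a z) = 0 \<Longrightarrow> zform (4 / 5) S a \<le> 0 \<Longrightarrow> \<forall>z\<in>S. a z = 0"
    using hyperplane_five_scaled[OF _ d2 d3 two] ys(1) z Sz by auto
  have card: "q + card {()} < card Pend + card S" using cP S by simp
  have "\<exists>a. zform (4 / 5) S a \<le> 0 \<and> (\<exists>z\<in>S. a z \<noteq> 0) \<and> (\<Sum>z\<in>S. c z * a z) = 0"
    by (rule pendant_count_four_fifths[where ?Z0.0 = S and Dx = "{()}" and D = "\<lambda>_. c"];
        (use p1 pc S(1) card in blast | simp))
  then show False using c by meson
qed

text \<open>A spider centred at a vertex of degree four already reaches the spectral radius: the test
  vector below satisfies \<open>Q x \<ge> \<mu> x\<close>, so it is an eigenvector, and then the component is a tree.\<close>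

lemma degree_four_impossible_p1:
  assumes v0: "v0 \<in> Iso" and p1: "p = 1" and tF: "tri n F = 0" and w: "w < n" and dw: "deg w = 4"
  shows False
proof -
  note pc = pendant_nbr_core[OF v0]
  have \<rho>: "0 < \<rho>" "\<rho> * (\<mu> - 1) = 1" using pend_bounds[OF p] by auto
  have \<mu>: "\<mu> = 5 + \<rho>" using lam_pend[OF p] p1 by simp
  have \<rho>2: "\<rho> * (4 + \<rho>) = 1" using \<rho>(2) unfolding \<mu> by simp
  have \<rho>3: "\<rho> \<le> 1 / 3"
  proof (rule ccontr)
    assume "\<not> \<rho> \<le> 1 / 3"
    then have "1 / 3 * 4 < \<rho> * (4 + \<rho>)" by (intro mult_strict_mono) auto
    then show False using \<rho>2 by simp
  qed
  define A where "A = {z \<in> Core. F w z}"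
  define B where "B = {v \<in> Pend. F w v}"
  have fin: "finite A" "finite B" using class_finite by (simp_all add: A_def B_def)
  have disAB: "A \<inter> B = {}" by (auto simp: A_def B_def Core_def Pend_def)
  have nbr_w: "{j. F w j} = A \<union> B"
  proof
    show "{j. F w j} \<subseteq> A \<union> B"
    proof
      fix j assume "j \<in> {j. F w j}"
      then have wj: "F w j" by simp
      have "w \<in> {i. F j i}" using F_sym[OF wj] by simp
      then have "deg j \<noteq> 0" unfolding deg_card using finite_nbrs[of j] by auto
      then show "j \<in> A \<union> B" using wj F_lt(2)[OF wj] by (auto simp: A_def B_def Core_def Pend_def)
    qed
  qed (auto simp: A_def B_def)
  have cAB: "card A + card B = 4"
    using card_Un_disjoint[OF fin disAB] nbr_w dw deg_card[of w] by simp
  \<comment> \<open>The difference of two pendant neighbours of \<open>w\<close> would be an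
    eigenvector for eigenvalue \<open>1\<close>.\<close>
  have cB: "card B \<le> 1"
  proof (rule ccontr)
    assume "\<not> card B \<le> 1"
    then obtain v v' where v: "v \<in> B" "v' \<in> B" "v \<noteq> v'"
      by (metis One_nat_def card_le_Suc0_iff_eq fin(2))
    define x :: "nat \<Rightarrow> real" where "x i = of_bool (i = v) - of_bool (i = v')" for i
    have adjv: "adj F i v = of_bool (i = w)" "adj F i v' = of_bool (i = w)" for i
    proof -
      have vP: "v \<in> Pend" "v' \<in> Pend" using v by (simp_all add: B_def)
      obtain u where u: "\<And>z. F v z \<longleftrightarrow> z = u" using pendant_nbr[OF vP(1)] by metis
      obtain u' where u': "\<And>z. F v' z \<longleftrightarrow> z = u'" using pendant_nbr[OF vP(2)] by metis
      have "F v w" "F v' w" using v F_sym by (auto simp: B_def)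
      then have "u = w" "u' = w" using u[of w] u'[of w] by simp_all
      then show "adj F i v = of_bool (i = w)" "adj F i v' = of_bool (i = w)"
        using u[of i] u'[of i] adj_F_sym[of i v] adj_F_sym[of i v'] by (simp_all add: adj_def)
    qed
    have lt: "v < n" "v' < n" using v by (auto simp: B_def Pend_def)
    have dv: "deg v = 1" "deg v' = 1" using v by (auto simp: B_def Pend_def)
    have "qop n F x i = x i" if i: "i < n" for i
    proof -
      have "(\<Sum>j<n. adj F i j * x j) = (\<Sum>j<n. (if j = v then adj F i v else 0) - (if j = v' then adj F i v' else 0))"
        by (intro sum.cong refl) (auto simp: x_def)
      also have "\<dots> = 0" using lt by (simp add: sum_subtractf sum.delta adjv)
      finally show ?thesis using i dv by (simp add: qop_eq) (simp add: x_def)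
    qed
    from no_eigenvalue_one_mate[OF p1 this lt(1)] show False using v(3) by (simp add: x_def)
  qed
  have "\<exists>y. F z y \<and> y \<noteq> w" if "z \<in> A" for z
  proof (rule ccontr)
    assume "\<not> (\<exists>y. F z y \<and> y \<noteq> w)"
    then have "{j. F z j} \<subseteq> {w}" by blast
    then have "card {j. F z j} \<le> card {w}" by (rule card_mono[rotated]) simp
    then show False using that by (simp add: A_def Core_def deg_card)
  qed
  \<comment> \<open>The feet of the spider. They need not be distinct; the estimates below do not
    assume it.\<close>
  then obtain y where y: "\<And>z. z \<in> A \<Longrightarrow> F z (y z)" "\<And>z. z \<in> A \<Longrightarrow> y z \<noteq> w" by metis
  define Y where "Y = y ` A"
  have yN: "\<not> F w (y z)" if "z \<in> A" for z
  proof
    assume "F w (y z)"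
    then have "F z (y z) \<and> F (y z) w \<and> F w z" using y(1)[OF that] that F_sym by (simp add: A_def)
    then show False using no_triangle[OF tF] by blast
  qed
  have wA: "w \<notin> A" "w \<notin> B" using F_irrefl by (auto simp: A_def B_def)
  have YAB: "Y \<inter> (A \<union> B) = {}" "w \<notin> Y" using yN y(2) by (auto simp: Y_def A_def B_def)
  \<comment> \<open>The values give \<open>Q x = \<mu> x\<close> exactly on a spider with one
    pendant vertex and three legs of length two, where \<open>\<mu> = 5 + \<rho>\<close>. With four
    legs the centre has slack because \<open>\<rho> \<le> 1 / 3\<close>.\<close>
  define x :: "nat \<Rightarrow> real" where
    "x i = (if i = w then 1 else if i \<in> A then 1 / 3 else if i \<in> B then \<rho> else if i \<in> Y then \<rho> / 3 else 0)" for i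
  have xv: "x w = 1" "i \<in> A \<Longrightarrow> x i = 1 / 3" "i \<in> B \<Longrightarrow> x i = \<rho>" "i \<in> Y \<Longrightarrow> x i = \<rho> / 3" for i
    using wA disAB YAB by (auto simp: x_def)
  have x0: "x i = 0" if "i \<notin> {w} \<union> A \<union> B \<union> Y" for i using that by (simp add: x_def)
  have xnn: "0 \<le> x i" for i using \<rho>(1) by (simp add: x_def)
  have lower: "(\<Sum>j\<in>S. x j) \<le> (\<Sum>j<n. adj F i j * x j)" if "\<And>j. j \<in> S \<Longrightarrow> F i j" for S i
  proof -
    have S: "S \<subseteq> {..<n}" using that F_lt by blast
    have "(\<Sum>j\<in>S. x j) = (\<Sum>j\<in>S. adj F i j * x j)"
      by (intro sum.cong refl) (simp add: adj_def that)
    also have "\<dots> \<le> (\<Sum>j<n. adj F i j * x j)"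
      by (rule sum_mono2) (use S xnn in \<open>auto simp: adj_def\<close>)
    finally show ?thesis .
  qed
  have ltA: "z \<in> A \<Longrightarrow> z < n" "z \<in> B \<Longrightarrow> z < n" "z \<in> Y \<Longrightarrow> z < n" for z
    using y(1) F_lt(2) by (auto simp: A_def B_def Y_def Core_def Pend_def)
  have dz: "2 \<le> deg z" if "z \<in> A" for z using that by (simp add: A_def Core_def)
  have qz: "\<mu> * x z \<le> qop n F x z" and qzs: "qop n F x z = \<mu> * x z \<Longrightarrow> F z u \<Longrightarrow> u = w \<or> u = y z"
    if z: "z \<in> A" for z u
  proof -
    have wz: "F z w" using z F_sym by (simp add: A_def)
    have "(\<Sum>j\<in>{w, y z}. x j) = 1 + \<rho> / 3"
      using y(2)[OF z] xv(1) xv(4)[of "y z"] z by (simp add: Y_def)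
    then have s: "1 + \<rho> / 3 \<le> (\<Sum>j<n. adj F z j * x j)"
      using lower[of "{w, y z}" z] wz y(1)[OF z] by auto
    have q: "qop n F x z = real (deg z) / 3 + (\<Sum>j<n. adj F z j * x j)"
      using qop_eq[OF ltA(1)[OF z], of F x] xv(2)[OF z] by simp
    have d: "2 / 3 \<le> real (deg z) / 3" using dz[OF z] by simp
    show "\<mu> * x z \<le> qop n F x z" unfolding q xv(2)[OF z] \<mu> using s d by simp
    assume e: "qop n F x z = \<mu> * x z" and u: "F z u"
    have "real (deg z) / 3 = 2 / 3" using e s d unfolding q xv(2)[OF z] \<mu> by simp
    then have "card {j. F z j} = 2" by (simp add: deg_card)
    moreover have "card {w, y z} = 2" using y(2)[OF z] by simp
    moreover have "{w, y z} \<subseteq> {j. F z j}" using wz y(1)[OF z] by simp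
    ultimately have "{w, y z} = {j. F z j}" using finite_nbrs by (intro card_subset_eq) auto
    then show "u = w \<or> u = y z" using u by blast
  qed
  have nbrB: "F v u \<longleftrightarrow> u = w" if v: "v \<in> B" for v u
  proof -
    have "v \<in> Pend" using v by (simp add: B_def)
    then obtain u' where u': "\<And>z. F v z \<longleftrightarrow> z = u'" using pendant_nbr by metis
    have "F v w" using v F_sym by (simp add: B_def)
    then show ?thesis using u'[of w] u'[of u] by simp
  qed
  have qB: "\<mu> * x v \<le> qop n F x v" if v: "v \<in> B" for v
  proof -
    have "(\<Sum>j\<in>{w}. x j) \<le> (\<Sum>j<n. adj F v j * x j)" by (rule lower) (use nbrB[OF v] in simp)
    moreover have "deg v = 1" using v by (simp add: B_def Pend_def)
    ultimately have "\<rho> + 1 \<le> qop n F x v"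
      using qop_eq[OF ltA(2)[OF v], of F x] xv(1) xv(3)[OF v] by simp
    moreover have "\<mu> * x v = \<rho> + 1" unfolding xv(3)[OF v] \<mu> using \<rho>2 by (simp add: algebra_simps)
    ultimately show ?thesis by simp
  qed
  have qY: "\<mu> * x v \<le> qop n F x v" and qYs: "qop n F x v = \<mu> * x v \<Longrightarrow> F v u \<Longrightarrow> u \<in> A"
    if v: "v \<in> Y" for v u
  proof -
    obtain z where z: "z \<in> A" "v = y z" using v by (auto simp: Y_def)
    have vz: "F v z" using F_sym[OF y(1)[OF z(1)]] z(2) by simp
    have "(\<Sum>j\<in>{z}. x j) \<le> (\<Sum>j<n. adj F v j * x j)" by (rule lower) (use vz in simp)
    then have s: "1 / 3 \<le> (\<Sum>j<n. adj F v j * x j)" using xv(2)[OF z(1)] by simp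
    have q: "qop n F x v = real (deg v) * (\<rho> / 3) + (\<Sum>j<n. adj F v j * x j)"
      using qop_eq[OF ltA(3)[OF v], of F x] xv(4)[OF v] by simp
    have "z \<in> {j. F v j}" using vz by simp
    then have d1: "1 \<le> deg v" unfolding deg_card using finite_nbrs[of v]
      by (metis One_nat_def Suc_leI card_gt_0_iff empty_iff)
    have d: "1 * (\<rho> / 3) \<le> real (deg v) * (\<rho> / 3)" by (rule mult_right_mono) (use d1 \<rho>(1) in auto)
    have m: "\<mu> * x v = \<rho> / 3 + 1 / 3" unfolding xv(4)[OF v] \<mu> using \<rho>2 by (simp add: algebra_simps)
    show "\<mu> * x v \<le> qop n F x v" unfolding q m using s d by simp
    assume e: "qop n F x v = \<mu> * x v" and u: "F v u"
    have "real (deg v) * (\<rho> / 3) \<le> 1 * (\<rho> / 3)" using e s unfolding q m by simp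
    then have "deg v \<le> 1" using \<rho>(1) by simp
    then have "card {j. F v j} \<le> 1" by (simp add: deg_card)
    then have "u = z" using u vz finite_nbrs[of v] by (metis One_nat_def card_le_Suc0_iff_eq mem_Collect_eq)
    then show "u \<in> A" using z(1) by simp
  qed
  have qw: "\<mu> * x w \<le> qop n F x w"
  proof -
    have "(\<Sum>j\<in>A \<union> B. x j) = real (card A) / 3 + real (card B) * \<rho>"
      using sum.union_disjoint[OF fin disAB, of x] by (simp add: xv)
    moreover have "(\<Sum>j\<in>A \<union> B. x j) \<le> (\<Sum>j<n. adj F w j * x j)"
      by (rule lower) (use nbr_w in blast)
    ultimately have "4 + (real (card A) / 3 + real (card B) * \<rho>) \<le> qop n F x w"
      using qop_eq[OF w, of F x] dw xv(1) by simp
    moreover have "1 + \<rho> \<le> real (card A) / 3 + real (card B) * \<rho>"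
    proof (cases "card B = 0")
      case True
      then have "card A = 4" using cAB by simp
      then show ?thesis using True \<rho>3 by simp
    next
      case False
      then have "card B = 1" "card A = 3" using cAB cB by linarith+
      then show ?thesis by simp
    qed
    ultimately show ?thesis unfolding \<mu> xv(1) by simp
  qed
  have q_all: "\<mu> * x i \<le> qop n F x i" if i: "i < n" for i
  proof -
    consider "i = w" | "i \<in> A" | "i \<in> B" | "i \<in> Y" | "i \<notin> {w} \<union> A \<union> B \<union> Y" by blast
    then show ?thesis
    proof cases
      case 1 then show ?thesis using qw by simp
    next
      case 2 then show ?thesis by (rule qz)
    next
      case 3 then show ?thesis by (rule qB)
    next
      case 4 then show ?thesis by (rule qY)
    next
      case 5
      have "0 \<le> (\<Sum>j<n. adj F i j * x j)" using xnn by (intro sum_nonneg) (simp add: adj_def)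
      then show ?thesis using qop_eq[OF i, of F x] x0[OF 5] by simp
    qed
  qed
  have "\<mu> * sq n x \<le> qform n F x"
    unfolding sq_def qform_def sum_distrib_left
  proof (rule sum_mono)
    fix i assume "i \<in> {..<n}"
    then have "x i * (\<mu> * x i) \<le> x i * qop n F x i" using q_all xnn by (intro mult_left_mono) auto
    then show "\<mu> * (x i)\<^sup>2 \<le> x i * qop n F x i" by (simp add: power2_eq_square mult_ac)
  qed
  then have top: "qform n F x = \<mu> * sq n x" using qform_le[of x] by linarith
  note ev = top_eigenvector[OF top]
  \<comment> \<open>Equality is now known, so a neighbour outside the support would satisfy an
    eigenvalue equation with zero on one side and a positive sum on the other.\<close>
  have out: "\<not> F i j" if i: "i \<notin> {w} \<union> A \<union> B \<union> Y" and j: "j \<in> {w} \<union> A \<union> B \<union> Y" for i j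
  proof
    assume ij: "F i j"
    have "(\<Sum>j<n. adj F i j * x j) = 0"
      using ev[OF F_lt(1)[OF ij]] qop_eq[OF F_lt(1)[OF ij], of F x] x0[OF i] by simp
    moreover have "(\<Sum>j\<in>{j}. x j) \<le> (\<Sum>j<n. adj F i j * x j)" by (rule lower) (use ij in simp)
    moreover have "0 < x j" using j xv(1) xv(2)[of j] xv(3)[of j] xv(4)[of j] \<rho>(1) by auto
    ultimately show False by simp
  qed
  \<comment> \<open>The two colour classes of the component. Equality in the eigenvalue equations
    has left legs of degree two and feet of degree one, so the signs alternate along every
    edge.\<close>
  define s :: "nat \<Rightarrow> real" where "s i = (if i = w \<or> i \<in> Y then 1 else if i \<in> A \<union> B then -1 else 0)" for i
  have sv: "s w = 1" "i \<in> A \<Longrightarrow> s i = -1" "i \<in> B \<Longrightarrow> s i = -1" "i \<in> Y \<Longrightarrow> s i = 1"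
    "i \<notin> {w} \<union> A \<union> B \<union> Y \<Longrightarrow> s i = 0" for i
    using wA YAB by (auto simp: s_def)
  have "qform n F s = 0"
  proof (subst qform_eq_0_iff[OF F], intro allI impI)
    fix a b assume ab: "F a b"
    consider "a = w" | "a \<in> A" | "a \<in> B" | "a \<in> Y" | "a \<notin> {w} \<union> A \<union> B \<union> Y" by blast
    then show "s a + s b = 0"
    proof cases
      case 1
      then have "b \<in> A \<union> B" using ab nbr_w by blast
      then show ?thesis using 1 sv by auto
    next
      case 2
      then have "b = w \<or> b = y a" using qzs[OF 2 ev[OF ltA(1)[OF 2]] ab] by blast
      then have "b = w \<or> b \<in> Y" using 2 by (auto simp: Y_def)
      then show ?thesis using 2 sv by auto
    next
      case 3
      then show ?thesis using nbrB[OF 3, of b] ab sv by simp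
    next
      case 4
      then have "b \<in> A" using qYs[OF 4 ev[OF ltA(3)[OF 4]] ab] by blast
      then show ?thesis using 4 sv by simp
    next
      case 5
      then have "b \<notin> {w} \<union> A \<union> B \<union> Y" using out[OF 5] ab by blast
      then show ?thesis using 5 sv(5) by simp
    qed
  qed
  moreover have "w \<noteq> v0" using v0 dw by (auto simp: Iso_def)
  ultimately have "s w = 0" using isolated_excludes_kernel[OF v0 _ w] by blast
  then show False by (simp add: sv(1))
qed

text \<open>With \<open>card Core = q + m\<close>, the identities leave three sequences with
  \<open>m \<ge> 2\<close>. For \<open>p = 2\<close>, \<open>m = 2\<close> there are two core
  vertices of degree two, two of degree three and one of degree five. For \<open>p = 1\<close>,
  \<open>m = 2\<close> or \<open>m = 3\<close>, there are three of degree two, or six of degree two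
  and one of degree four. All other core degrees are \<open>p + 2\<close>.\<close>

lemma no_isolated: "Iso = {}"
proof (rule ccontr)
  assume "Iso \<noteq> {}"
  then obtain v0 where v0: "v0 \<in> Iso" by blast
  have "q \<noteq> 3"
  proof
    assume "q = 3"
    moreover have "v0 < n" using v0 by (simp add: Iso_def)
    ultimately show False using kernel_trivial_triangle[OF _ isolated_kernel[OF v0]] by force
  qed
  then have tJ: "tri n J = 0" by (rule tri_zero)
  define k where "k = real (card Core) - real q"
  have k: "real (card Core) = real q + k" by (simp add: k_def)
  have "0 \<le> (\<Sum>v\<in>Core. (gap v)\<^sup>2)" by (simp add: sum_nonneg)
  then have "0 < (real p + 1)\<^sup>2 * k" unfolding core_moments(3)[OF v0 k] by (smt (verit) of_nat_0_le_iff)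
  then have "0 < k" by (simp add: zero_less_mult_iff)
  then have "q < card Core" by (simp add: k_def)
  then obtain m where m: "card Core = q + m" "1 \<le> m" by (metis add.right_neutral le_add_diff_inverse less_imp_le less_one linorder_not_less nat_less_le)
  have m': "real (card Core) = real q + real m" using m by simp
  note I = core_inequalities[OF v0 m' tJ] and M = core_moments[OF v0 m']
  define b where "b = card {v \<in> Core. deg v = p + 3}"
  have I1: "(real p + 1) * real b + tri n F + (real p + 1)\<^sup>2 * real m \<le> (real p)\<^sup>2 + 6 * real p + 7"
    and I2: "(real p + 1) * real m \<le> (real p + 1) * real b + real p + 3"
    using I unfolding b_def by blast+
  have t0: "0 \<le> tri n F" by (rule tri_nonneg)
  have b0: "0 \<le> (real p + 1) * real b" by simp
  have m2: "2 \<le> m"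
  proof (rule ccontr)
    assume "\<not> 2 \<le> m"
    then have "card Core = q + 1" using m by simp
    then show False by (rule excess_one_impossible[OF v0])
  qed
  have "(real p + 1)\<^sup>2 * 2 \<le> (real p + 1)\<^sup>2 * real m" using m2 by (intro mult_left_mono) auto
  then have "(real p + 1)\<^sup>2 * 2 \<le> (real p)\<^sup>2 + 6 * real p + 7" using I1 t0 b0 by linarith
  then have P: "real p * real p \<le> 2 * real p + 5" by (simp add: power2_eq_square algebra_simps)
  have "p \<le> 3"
  proof (rule ccontr)
    assume "\<not> p \<le> 3"
    then have "4 \<le> real p" by simp
    moreover from this have "4 * real p \<le> real p * real p" by (intro mult_right_mono) auto
    ultimately show False using P by linarith
  qed
  have range: "2 \<le> deg v" "deg v \<le> p + 3" if "v \<in> Core" for v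
    using that max_degree[of v] by (auto simp: Core_def)
  define c2 where "c2 = card {v \<in> Core. deg v = 2}"
  define c3 where "c3 = card {v \<in> Core. deg v = 3}"
  have C2: "(\<Sum>v\<in>Core. of_bool (deg v = 2)) = real c2" and C3: "(\<Sum>v\<in>Core. of_bool (deg v = 3)) = real c3"
    and Cb: "(\<Sum>v\<in>Core. of_bool (deg v = p + 3)) = real b"
    unfolding c2_def c3_def b_def by (rule card_class)+
  consider "p = 3" | "p = 2" | "p = 1" using \<open>p \<le> 3\<close> p by linarith
  then show False
  proof cases
    case 1
    then have rp: "real p = 3" by simp
    \<comment> \<open>The two bounds would force the integer \<open>b\<close> to be
      \<open>1 / 2\<close>.\<close>
    have "4 * real b + tri n F + 16 * real m \<le> 34" "4 * real m \<le> 4 * real b + 6"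
      using I1 I2 unfolding rp by simp_all
    moreover have "2 \<le> real m" using m2 by simp
    ultimately have "real b < 1" "1 / 2 \<le> real b" using t0 by linarith+
    then show False by simp
  next
    case 2
    then have rp: "real p = 2" by simp
    have e: "3 * real b + tri n F + 9 * real m \<le> 23" "3 * real m \<le> 3 * real b + 5"
      using I1 I2 unfolding rp by simp_all
    then have "real m < 3" using t0 by linarith
    then have m: "m = 2" "real m = 2" using m2 by simp_all
    have "real b < 2" "1 / 3 \<le> real b" using e t0 unfolding m(2) by linarith+
    then have b1: "real b = 1" by simp
    \<comment> \<open>The gaps are \<open>2, 1, 0, -1\<close> for degrees \<open>2, 3, 4, 5\<close>,
      so the sums of their powers are linear in the three class sizes.\<close>
    have pt: "gap v = 2 * of_bool (deg v = 2) + of_bool (deg v = 3) - of_bool (deg v = p + 3)"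
      "(gap v)\<^sup>2 = 4 * of_bool (deg v = 2) + of_bool (deg v = 3) + of_bool (deg v = p + 3)"
      "(gap v)^3 = 8 * of_bool (deg v = 2) + of_bool (deg v = 3) - of_bool (deg v = p + 3)"
      if "v \<in> Core" for v
    proof -
      have "deg v = 2 \<or> deg v = 3 \<or> deg v = 4 \<or> deg v = p + 3" using range[OF that] 2 by linarith
      then show "gap v = 2 * of_bool (deg v = 2) + of_bool (deg v = 3) - of_bool (deg v = p + 3)"
        "(gap v)\<^sup>2 = 4 * of_bool (deg v = 2) + of_bool (deg v = 3) + of_bool (deg v = p + 3)"
        "(gap v)^3 = 8 * of_bool (deg v = 2) + of_bool (deg v = 3) - of_bool (deg v = p + 3)"
        using rp 2 by (elim disjE; simp)+
    qed
    have "(\<Sum>v\<in>Core. gap v) = 2 * real c2 + real c3 - real b"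
      unfolding C2[symmetric] C3[symmetric] Cb[symmetric]
      by (subst sum.cong[OF refl pt(1)], assumption)
        (simp add: sum.distrib sum_subtractf sum_distrib_left)
    then have s1: "2 * real c2 + real c3 = 6" using M(2) unfolding rp m b1 by simp
    have "(\<Sum>v\<in>Core. (gap v)\<^sup>2) = 4 * real c2 + real c3 + real b"
      unfolding C2[symmetric] C3[symmetric] Cb[symmetric]
      by (subst sum.cong[OF refl pt(2)], assumption)
        (simp add: sum.distrib sum_subtractf sum_distrib_left)
    then have s2: "4 * real c2 + real c3 = 10" using M(3) unfolding rp m b1 by simp
    have "(\<Sum>v\<in>Core. (gap v)^3) = 8 * real c2 + real c3 - real b"
      unfolding C2[symmetric] C3[symmetric] Cb[symmetric]
      by (subst sum.cong[OF refl pt(3)], assumption)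
        (simp add: sum.distrib sum_subtractf sum_distrib_left)
    moreover have "(\<Sum>v\<in>Core. gap v) = 5" "(\<Sum>v\<in>Core. (gap v)\<^sup>2) = 11"
      using M(2,3) by (simp_all add: rp m)
    ultimately have "8 * real c2 + real c3 - real b =
        tri n F - tri n J + (2 * real p + 3) * 11 - (real p + 1) * (real p + 2) * 5"
      using M(4) by (simp only:)
    then have s3: "8 * real c2 + real c3 - 1 = tri n F + 17" by (simp add: rp b1 tJ)
    have "real c2 = 2" "real c3 = 2" using s1 s2 by linarith+
    then have c: "c2 = 2" "c3 = 2" by simp_all
    have tF: "tri n F = 0" using s3 c by simp
    show False
      by (rule excess_two_impossible_p2[OF v0 rp _ tF])
        (use m \<open>card Core = q + m\<close> core_class_le[OF c2_def c3_def] c in simp_all)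
  next
    case 3
    then have rp: "real p = 1" by simp
    have e: "2 * real b + tri n F + 4 * real m \<le> 14" using I1 unfolding rp by simp
    have pt: "gap v = of_bool (deg v = 2) - of_bool (deg v = p + 3)"
      "(gap v)\<^sup>2 = of_bool (deg v = 2) + of_bool (deg v = p + 3)"
      "(gap v)^3 = of_bool (deg v = 2) - of_bool (deg v = p + 3)"
      if "v \<in> Core" for v
    proof -
      have "deg v = 2 \<or> deg v = 3 \<or> deg v = p + 3" using range[OF that] 3 by linarith
      then show "gap v = of_bool (deg v = 2) - of_bool (deg v = p + 3)"
        "(gap v)\<^sup>2 = of_bool (deg v = 2) + of_bool (deg v = p + 3)"
        "(gap v)^3 = of_bool (deg v = 2) - of_bool (deg v = p + 3)"
        using rp 3 by (elim disjE; simp)+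
    qed
    have "(\<Sum>v\<in>Core. gap v) = real c2 - real b"
      unfolding C2[symmetric] Cb[symmetric] 
      by (subst sum.cong[OF refl pt(1)], assumption)
        (simp add: sum.distrib sum_subtractf sum_distrib_left)
    then have s1: "real c2 - real b = 2 * real m - 1" using M(2) unfolding rp by simp
    have "(\<Sum>v\<in>Core. (gap v)\<^sup>2) = real c2 + real b"
      unfolding C2[symmetric] Cb[symmetric] 
      by (subst sum.cong[OF refl pt(2)], assumption)
        (simp add: sum.distrib sum_subtractf sum_distrib_left)
    then have s2: "real c2 + real b = 4 * real m - 5" using M(3) unfolding rp by simp
    have "(\<Sum>v\<in>Core. (gap v)^3) = real c2 - real b"
      unfolding C2[symmetric] Cb[symmetric] 
      by (subst sum.cong[OF refl pt(3)], assumption)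
        (simp add: sum.distrib sum_subtractf sum_distrib_left)
    moreover have "(\<Sum>v\<in>Core. gap v) = 2 * real m - 1" "(\<Sum>v\<in>Core. (gap v)\<^sup>2) = 4 * real m - 5"
      using M(2,3) by (simp_all add: rp)
    ultimately have "real c2 - real b = tri n F - tri n J + (2 * real p + 3) * (4 * real m - 5)
        - (real p + 1) * (real p + 2) * (2 * real m - 1)"
      using M(4) by (simp only:)
    then have s3: "real c2 - real b = tri n F + 5 * (4 * real m - 5) - 6 * (2 * real m - 1)"
      by (simp add: rp tJ)
    have "real m < 4" using e t0 by linarith
    then have "m = 2 \<or> m = 3" using m2 by auto
    then show False
    proof
      assume m: "m = 2"
      then have rm: "real m = 2" by simp
      have "real b = 0" "real c2 = 3" using s1 s2 unfolding rm by simp_all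
      then have c: "b = 0" "c2 = 3" by simp_all
      have d: "deg v \<le> 3" if "v \<in> Core" for v
      proof (rule ccontr)
        assume "\<not> deg v \<le> 3"
        then have "v \<in> {v \<in> Core. deg v = p + 3}" using that range[OF that] 3 by simp
        then have "b \<noteq> 0" unfolding b_def using class_finite(3) by (auto simp: card_eq_0_iff)
        then show False using c by simp
      qed
      show False
        by (rule excess_two_impossible_p1[OF v0 3 _ _ d])
          (use m \<open>card Core = q + m\<close> core_class_le(1)[OF c2_def c3_def] c in simp_all)
    next
      assume m: "m = 3"
      then have rm: "real m = 3" by simp
      have b1: "real b = 1" using s1 s2 unfolding rm by simp
      have tF: "tri n F = 0" using s1 s3 unfolding rm by simp
      have "card {v \<in> Core. deg v = p + 3} \<noteq> 0" using b1 unfolding b_def by simp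
      then obtain w where w: "w \<in> Core" "deg w = p + 3"
        by (metis (mono_tags, lifting) card.empty empty_Collect_eq)
      have "w < n" using w(1) by (simp add: Core_def)
      moreover have "deg w = 4" using w(2) 3 by linarith
      ultimately show False by (rule degree_four_impossible_p1[OF v0 3 tF])
    qed
  qed
qed

end

theorem theorem3p10:
  fixes p q :: nat
  assumes "p \<ge> 1" and "q \<ge> 3"
  shows "DQS (jfg_n p q) (jfg_E p q)"
  unfolding DQS_def
proof (intro allI impI)
  fix m F
  assume F: "simple_graph m F" and cosp: "Q_cospectral m F (jfg_n p q) (jfg_E p q)"
  interpret jellyfish p q by unfold_locales (use assms in auto)
  have m: "m = jfg_n p q" by (rule Q_cospectral_order[OF cosp])
  obtain W where W: "\<forall>i<jfg_n p q. \<forall>j<jfg_n p q. (\<Sum>k<jfg_n p q. W k i * W k j) = of_bool (i = j)"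
    "\<forall>i<jfg_n p q. \<forall>j<jfg_n p q. (\<Sum>k<jfg_n p q. W i k * W j k) = of_bool (i = j)"
    "\<forall>i<jfg_n p q. \<forall>j<jfg_n p q. (\<Sum>k<jfg_n p q. W i k * qent (jfg_n p q) F k j) =
      (\<Sum>k<jfg_n p q. qent (jfg_n p q) (jfg_E p q) i k * W k j)"
    using Q_cospectral_orthogonally_similar[OF F[unfolded m] simple_graph_jfg cosp[unfolded m]] by blast
  interpret jellyfish_mate p q F W
    by unfold_locales (use F m simple_graph_jfg W in auto)
  show "graph_iso m F (jfg_n p q) (jfg_E p q)"
    unfolding m by (rule iso_without_isolated[OF no_isolated])
qed

end
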